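(* Let $\mathfrak g$ be a Lie algebra of finite or affine type and let $\lambda\in\mathfrak h^*$. The cone $\mathbb Z_{\ge0}(\Delta^+\setminus\Delta^+_{J_\lambda})$ is minimally generated over $\mathbb Z_{\ge0}$ by $\Delta_{J_\lambda^c,1}$ (that is, $\Delta_{J_\lambda^c,1}$ generates this cone over $\mathbb Z_{\ge 0}$ and no proper subset of it does), and the set $\Delta_{J_\lambda^c,1}$ is always finite. Therefore, for every $\lambda\in\mathfrak h^*$, $$\mathrm{wt}\,L(\lambda)=\mathrm{wt}\,L_{J_\lambda}(\lambda)-\mathbb Z_{\ge0}\Delta_{J_\lambda^c,1}.$$
   Context: $\mathfrak g=\mathfrak g(A)$ is either a complex finite-dimensional simple Lie algebra ("finite type") or a complex affine Kac--Moody Lie algebra ("affine type"), with Cartan matrix $A$, fixed Cartan subalgebra $\mathfrak h$, root system $\Delta\subset\mathfrak h^*$ (all roots, real and imaginary), positive roots $\Delta^+$, simple roots $\Pi=\{\alpha_i\mid i\in\mathcal I\}$, simple co-roots $\{\alpha_i^\vee\mid i\in\mathcal I\}\subset\mathfrak h$, and Chevalley generators $e_i,f_i,\alpha_i^\vee$ $(i\in\mathcal I)$; $\mathcal I$ is the set of nodes of the Dynkin diagram. For $x=\sum_{i\in\mathcal I}c_i\alpha_i$ and $I\subseteq\mathcal I$, put $\mathrm{ht}_I(x):=\sum_{i\in I}c_i$, $I^c:=\mathcal I\setminus I$, and $\Delta_{I,1}:=\{\beta\in\Delta\mid\mathrm{ht}_I(\beta)=1\}\subseteq\Delta^+$ (so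 $\Delta_{\emptyset,1}=\emptyset$). For a subset $S$ of a real vector space, $\mathbb Z_{\ge0}S$ is the set of finite $\mathbb Z_{\ge0}$-linear combinations of elements of $S$ (so $\mathbb Z_{\ge0}\emptyset=\{0\}$). For $J\subseteq\mathcal I$: $\Pi_J=\{\alpha_j\mid j\in J\}$, $\Delta_J=\Delta\cap\mathbb Z\Pi_J$, $\Delta_J^+=\Delta_J\cap\Delta^+$, and $\mathfrak g_J$ is the Lie subalgebra of $\mathfrak g$ generated by $e_j,f_j,\alpha_j^\vee$, $j\in J$. For $\lambda\in\mathfrak h^*$, $J_\lambda:=\{j\in\mathcal I\mid\langle\lambda,\alpha_j^\vee\rangle\in\mathbb Z_{\ge0}\}$. $L(\lambda)$ is the simple highest weight $\mathfrak g$-module with highest weight $\lambda$, and $L_J(\lambda)$ is the simple highest weight $\mathfrak g_J$-module with highest weight (the restriction of) $\lambda$. For a $\mathfrak g$-module $V$, $\mathrm{wt}\,V:=\{\mu\in\mathfrak h^*\mid V_\mu\ne0\}$, where $V_\mu=\{v\in V\mid h v=\langle\mu,h\rangle v\ \forall h\in\mathfrak h\}$. The set $\mathrm{wt}\,L_J(\lambda)$ is regarded as a subset of $\lambda-\mathbb Z_{\ge0}\Pi_J\subset\mathfrak h^*$ (equivalently, $L_J(\lambda)$ is viewed as the simple highest weight $(\mathfrak g_J+\mathfrak h)$-module of highest weight $\lambda$); for $J=\emptyset$ it is $\{\lambda\}$. For sets $A,B\subset\mathfrak h^*$, $A-B:=\{a-b\mid a\in A,b\in B\}$. *)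

theory Defs
  imports "HOL-Analysis.Analysis" "HOL-Library.Function_Algebras"
begin

section \<open>Complex Lie algebras\<close>

text \<open>
  A complex vector space is given by its scalar multiplication on a type of class
  \<^class>\<open>ab_group_add\<close>, as in the locale \<^locale>\<open>vector_space\<close>.
\<close>

locale lie_algebra = vector_space smul
  for smul :: "complex \<Rightarrow> 'g::ab_group_add \<Rightarrow> 'g" +
  fixes bracket :: "'g \<Rightarrow> 'g \<Rightarrow> 'g"
  assumes bracket_add_left: "bracket (x + y) z = bracket x z + bracket y z"
    and bracket_add_right: "bracket x (y + z) = bracket x y + bracket x z"
    and bracket_scale_left: "bracket (smul c x) y = smul c (bracket x y)"
    and bracket_scale_right: "bracket x (smul c y) = smul c (bracket x y)"
    and bracket_self: "bracket x x = 0"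
    and jacobi: "bracket x (bracket y z) + bracket y (bracket z x) + bracket z (bracket x y) = 0"

definition lie_subalgebra ::
    "(complex \<Rightarrow> 'g \<Rightarrow> 'g) \<Rightarrow> ('g \<Rightarrow> 'g \<Rightarrow> 'g) \<Rightarrow> 'g::ab_group_add set \<Rightarrow> bool" where
  "lie_subalgebra smul bracket K \<longleftrightarrow>
     module.subspace smul K \<and> (\<forall>x\<in>K. \<forall>y\<in>K. bracket x y \<in> K)"

definition lie_ideal ::
    "(complex \<Rightarrow> 'g \<Rightarrow> 'g) \<Rightarrow> ('g \<Rightarrow> 'g \<Rightarrow> 'g) \<Rightarrow> 'g::ab_group_add set \<Rightarrow> bool" where
  "lie_ideal smul bracket K \<longleftrightarrow>
     module.subspace smul K \<and> (\<forall>x. \<forall>y\<in>K. bracket x y \<in> K)"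

definition simple_lie_algebra ::
    "(complex \<Rightarrow> 'g \<Rightarrow> 'g) \<Rightarrow> ('g::ab_group_add \<Rightarrow> 'g \<Rightarrow> 'g) \<Rightarrow> bool" where
  "simple_lie_algebra smul bracket \<longleftrightarrow>
     lie_algebra smul bracket \<and> (\<exists>x y. bracket x y \<noteq> 0) \<and>
     (\<forall>K. lie_ideal smul bracket K \<longrightarrow> K = {0} \<or> K = UNIV)"

definition finite_dimensional :: "(complex \<Rightarrow> 'g::ab_group_add \<Rightarrow> 'g) \<Rightarrow> bool" where
  "finite_dimensional smul \<longleftrightarrow> (\<exists>B. finite B \<and> module.span smul B = UNIV)"


section \<open>Generalized Cartan matrices\<close>

definition generalized_cartan_matrix :: "int^'i^'i \<Rightarrow> bool" where
  "generalized_cartan_matrix A \<longleftrightarrow>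
     (\<forall>i. A $ i $ i = 2) \<and>
     (\<forall>i j. i \<noteq> j \<longrightarrow> A $ i $ j \<le> 0) \<and>
     (\<forall>i j. A $ i $ j = 0 \<longrightarrow> A $ j $ i = 0)"

definition indecomposable_matrix :: "int^'i^'i \<Rightarrow> bool" where
  "indecomposable_matrix A \<longleftrightarrow>
     (\<forall>S. S \<noteq> {} \<and> S \<noteq> UNIV \<longrightarrow>
        (\<exists>i\<in>S. \<exists>j\<in>-S. A $ i $ j \<noteq> 0 \<or> A $ j $ i \<noteq> 0))"

abbreviation real_matrix :: "int^'i^'i \<Rightarrow> real^'i^'i" where
  "real_matrix A \<equiv> map_matrix real_of_int A"

text \<open>
  This is condition (Aff) in Kac, Infinite-dimensional Lie algebras, Theorem 4.3; it covers
  the untwisted and the twisted affine matrices.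
\<close>

definition affine_cartan_matrix :: "int^'i^'i \<Rightarrow> bool" where
  "affine_cartan_matrix A \<longleftrightarrow>
     generalized_cartan_matrix A \<and> indecomposable_matrix A \<and>
     rank (real_matrix A) + 1 = CARD('i) \<and>
     (\<exists>u. (\<forall>i. u $ i > 0) \<and> real_matrix A *v u = 0) \<and>
     (\<forall>v. (\<forall>i. (real_matrix A *v v) $ i \<ge> 0) \<longrightarrow> real_matrix A *v v = 0)"


section \<open>Kac--Moody algebras\<close>

text \<open>
  The dual of a subspace \<open>H\<close>: a functional on \<open>H\<close> is represented by its extension by zero to
  the ambient type, so that equality, addition and subtraction of functionals are those of
  functions.
\<close>

definition dual_space ::
    "(complex \<Rightarrow> 'g \<Rightarrow> 'g) \<Rightarrow> 'g::ab_group_add set \<Rightarrow> ('g \<Rightarrow> complex) set" where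
  "dual_space smul H = {\<mu>.
     (\<forall>x\<in>H. \<forall>y\<in>H. \<mu> (x + y) = \<mu> x + \<mu> y) \<and>
     (\<forall>c. \<forall>x\<in>H. \<mu> (smul c x) = c * \<mu> x) \<and>
     (\<forall>x. x \<notin> H \<longrightarrow> \<mu> x = 0)}"

text \<open>
  The Lie algebra \<open>\<gg>(A)\<close> with its Cartan subalgebra \<open>H\<close>, Chevalley generators \<open>e\<close>, \<open>f\<close>,
  simple co-roots and simple roots, following Kac, Chapter 1: \<open>(H, sroot, coroot)\<close> is a
  realization of \<open>A\<close>, the algebra is generated by \<open>H\<close>, \<open>e\<close>, \<open>f\<close> subject to the usual
  relations, and the largest ideal meeting \<open>H\<close> trivially has been divided out. These
  properties determine the algebra up to isomorphism (Kac, Proposition 1.4). The assumption on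
  \<open>dim H\<close> forces \<open>H\<close> to be finite-dimensional: \<open>dim\<close> is \<open>0\<close> for infinite-dimensional spaces,
  and the rank is at most the number of nodes.
\<close>

locale kac_moody_algebra = lie_algebra smul bracket
  for smul :: "complex \<Rightarrow> 'g::ab_group_add \<Rightarrow> 'g"
    and bracket :: "'g \<Rightarrow> 'g \<Rightarrow> 'g" +
  fixes A :: "int^'i^'i"
    and H :: "'g set"
    and e f coroot :: "'i \<Rightarrow> 'g"
    and sroot :: "'i \<Rightarrow> 'g \<Rightarrow> complex"
  assumes cartan_matrix: "generalized_cartan_matrix A"
    and H_subspace: "subspace H"
    and dim_H: "dim H + rank (real_matrix A) = 2 * CARD('i)"
    and coroot_in_H: "coroot i \<in> H"
    and coroot_independent: "inj coroot" "independent (range coroot)"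
    and sroot_in_dual: "sroot i \<in> dual_space smul H"
    and sroot_independent: "(\<forall>h\<in>H. (\<Sum>i\<in>UNIV. c i * sroot i h) = 0) \<Longrightarrow> c i = 0"
    and sroot_coroot: "sroot j (coroot i) = of_int (A $ i $ j)"
    and bracket_H: "h \<in> H \<Longrightarrow> h' \<in> H \<Longrightarrow> bracket h h' = 0"
    and bracket_e: "h \<in> H \<Longrightarrow> bracket h (e i) = smul (sroot i h) (e i)"
    and bracket_f: "h \<in> H \<Longrightarrow> bracket h (f i) = smul (- sroot i h) (f i)"
    and bracket_e_f: "bracket (e i) (f j) = (if i = j then coroot i else 0)"
    and generated: "lie_subalgebra smul bracket hull (H \<union> range e \<union> range f) = UNIV"
    and ideal_trivial: "lie_ideal smul bracket K \<Longrightarrow> K \<inter> H = {0} \<Longrightarrow> K = {0}"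


section \<open>Roots\<close>

definition nonneg_int_span :: "('g \<Rightarrow> complex) set \<Rightarrow> ('g \<Rightarrow> complex) set" where
  "nonneg_int_span S =
     {(\<lambda>h. \<Sum>\<beta>\<in>T. of_nat (n \<beta>) * \<beta> h) | T (n :: ('g \<Rightarrow> complex) \<Rightarrow> nat). finite T \<and> T \<subseteq> S}"

definition int_span :: "('g \<Rightarrow> complex) set \<Rightarrow> ('g \<Rightarrow> complex) set" where
  "int_span S =
     {(\<lambda>h. \<Sum>\<beta>\<in>T. of_int (n \<beta>) * \<beta> h) | T (n :: ('g \<Rightarrow> complex) \<Rightarrow> int). finite T \<and> T \<subseteq> S}"

definition roots ::
    "(complex \<Rightarrow> 'g \<Rightarrow> 'g) \<Rightarrow> ('g \<Rightarrow> 'g \<Rightarrow> 'g) \<Rightarrow> 'g::ab_group_add set \<Rightarrow> ('g \<Rightarrow> complex) set"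
  where
  "roots smul bracket H =
     {\<beta> \<in> dual_space smul H. \<beta> \<noteq> 0 \<and> (\<exists>x. x \<noteq> 0 \<and> (\<forall>h\<in>H. bracket h x = smul (\<beta> h) x))}"

definition positive_roots ::
    "(complex \<Rightarrow> 'g \<Rightarrow> 'g) \<Rightarrow> ('g \<Rightarrow> 'g \<Rightarrow> 'g) \<Rightarrow> 'g::ab_group_add set \<Rightarrow>
     ('i \<Rightarrow> 'g \<Rightarrow> complex) \<Rightarrow> ('g \<Rightarrow> complex) set" where
  "positive_roots smul bracket H sroot =
     roots smul bracket H \<inter> nonneg_int_span (range sroot)"

text \<open>The sets \<open>\<Delta>\<^sub>J = \<Delta> \<inter> \<int>\<Pi>\<^sub>J\<close> and \<open>\<Delta>\<^sub>J\<^sup>+ = \<Delta>\<^sub>J \<inter> \<Delta>\<^sup>+\<close>.\<close>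

definition sub_roots ::
    "(complex \<Rightarrow> 'g \<Rightarrow> 'g) \<Rightarrow> ('g \<Rightarrow> 'g \<Rightarrow> 'g) \<Rightarrow> 'g::ab_group_add set \<Rightarrow>
     ('i \<Rightarrow> 'g \<Rightarrow> complex) \<Rightarrow> 'i set \<Rightarrow> ('g \<Rightarrow> complex) set" where
  "sub_roots smul bracket H sroot J = roots smul bracket H \<inter> int_span (sroot ` J)"

definition sub_positive_roots ::
    "(complex \<Rightarrow> 'g \<Rightarrow> 'g) \<Rightarrow> ('g \<Rightarrow> 'g \<Rightarrow> 'g) \<Rightarrow> 'g::ab_group_add set \<Rightarrow>
     ('i \<Rightarrow> 'g \<Rightarrow> complex) \<Rightarrow> 'i set \<Rightarrow> ('g \<Rightarrow> complex) set" where
  "sub_positive_roots smul bracket H sroot J =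
     sub_roots smul bracket H sroot J \<inter> positive_roots smul bracket H sroot"

text \<open>
  The coefficients below are unique because the simple roots are linearly independent; the
  height is meaningful only on their span, which contains all roots.
\<close>

definition sroot_coeff ::
    "('i::finite \<Rightarrow> 'g \<Rightarrow> complex) \<Rightarrow> ('g \<Rightarrow> complex) \<Rightarrow> 'i \<Rightarrow> complex" where
  "sroot_coeff sroot x = (THE c. x = (\<lambda>h. \<Sum>i\<in>UNIV. c i * sroot i h))"

definition height ::
    "('i::finite \<Rightarrow> 'g \<Rightarrow> complex) \<Rightarrow> 'i set \<Rightarrow> ('g \<Rightarrow> complex) \<Rightarrow> complex" where
  "height sroot I x = (\<Sum>i\<in>I. sroot_coeff sroot x i)"

definition height_one_roots ::
    "(complex \<Rightarrow> 'g \<Rightarrow> 'g) \<Rightarrow> ('g \<Rightarrow> 'g \<Rightarrow> 'g) \<Rightarrow> 'g::ab_group_add set \<Rightarrow>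
     ('i::finite \<Rightarrow> 'g \<Rightarrow> complex) \<Rightarrow> 'i set \<Rightarrow> ('g \<Rightarrow> complex) set" where
  "height_one_roots smul bracket H sroot I =
     {\<beta> \<in> roots smul bracket H. height sroot I \<beta> = 1}"


section \<open>Highest weight modules\<close>

text \<open>The subalgebra \<open>\<gg>\<^sub>J\<close> generated by \<open>e\<^sub>j, f\<^sub>j, \<alpha>\<^sub>j\<^sup>\<or>\<close>, and \<open>\<gg>\<^sub>J + \<hh>\<close>.\<close>

definition sub_kac_moody ::
    "(complex \<Rightarrow> 'g \<Rightarrow> 'g) \<Rightarrow> ('g \<Rightarrow> 'g \<Rightarrow> 'g) \<Rightarrow> ('i \<Rightarrow> 'g) \<Rightarrow> ('i \<Rightarrow> 'g) \<Rightarrow> ('i \<Rightarrow> 'g) \<Rightarrow>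
     'i set \<Rightarrow> 'g::ab_group_add set" where
  "sub_kac_moody smul bracket e f coroot J =
     lie_subalgebra smul bracket hull (e ` J \<union> f ` J \<union> coroot ` J)"

definition levi_subalgebra ::
    "(complex \<Rightarrow> 'g \<Rightarrow> 'g) \<Rightarrow> ('g \<Rightarrow> 'g \<Rightarrow> 'g) \<Rightarrow> 'g set \<Rightarrow>
     ('i \<Rightarrow> 'g) \<Rightarrow> ('i \<Rightarrow> 'g) \<Rightarrow> ('i \<Rightarrow> 'g) \<Rightarrow> 'i set \<Rightarrow> 'g::ab_group_add set" where
  "levi_subalgebra smul bracket H e f coroot J =
     {x + h | x h. x \<in> sub_kac_moody smul bracket e f coroot J \<and> h \<in> H}"

text \<open>
  Modules over a subalgebra \<open>P\<close> of the ambient Lie algebra; the action of elements outside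
  \<open>P\<close> is irrelevant.
\<close>

definition lie_module ::
    "(complex \<Rightarrow> 'g \<Rightarrow> 'g) \<Rightarrow> ('g \<Rightarrow> 'g \<Rightarrow> 'g) \<Rightarrow> 'g::ab_group_add set \<Rightarrow>
     (complex \<Rightarrow> 'v \<Rightarrow> 'v) \<Rightarrow> ('g \<Rightarrow> 'v::ab_group_add \<Rightarrow> 'v) \<Rightarrow> bool" where
  "lie_module smul bracket P scaleV act \<longleftrightarrow>
     vector_space scaleV \<and>
     (\<forall>x\<in>P. Vector_Spaces.linear scaleV scaleV (act x)) \<and>
     (\<forall>x\<in>P. \<forall>y\<in>P. \<forall>v. act (x + y) v = act x v + act y v) \<and>
     (\<forall>c. \<forall>x\<in>P. \<forall>v. act (smul c x) v = scaleV c (act x v)) \<and>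
     (\<forall>x\<in>P. \<forall>y\<in>P. \<forall>v. act (bracket x y) v = act x (act y v) - act y (act x v))"

definition lie_submodule ::
    "'g set \<Rightarrow> (complex \<Rightarrow> 'v \<Rightarrow> 'v) \<Rightarrow> ('g \<Rightarrow> 'v \<Rightarrow> 'v) \<Rightarrow> 'v::ab_group_add set \<Rightarrow> bool" where
  "lie_submodule P scaleV act N \<longleftrightarrow>
     module.subspace scaleV N \<and> (\<forall>x\<in>P. \<forall>v\<in>N. act x v \<in> N)"

definition simple_lie_module ::
    "(complex \<Rightarrow> 'g \<Rightarrow> 'g) \<Rightarrow> ('g \<Rightarrow> 'g \<Rightarrow> 'g) \<Rightarrow> 'g::ab_group_add set \<Rightarrow>
     (complex \<Rightarrow> 'v \<Rightarrow> 'v) \<Rightarrow> ('g \<Rightarrow> 'v::ab_group_add \<Rightarrow> 'v) \<Rightarrow> bool" where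
  "simple_lie_module smul bracket P scaleV act \<longleftrightarrow>
     lie_module smul bracket P scaleV act \<and> (\<exists>v::'v. v \<noteq> 0) \<and>
     (\<forall>N. lie_submodule P scaleV act N \<longrightarrow> N = {0} \<or> N = UNIV)"

text \<open>
  A highest weight \<open>P\<close>-module of highest weight \<open>\<lambda>\<close>, where \<open>P\<close> contains \<open>H\<close> and its raising
  operators are \<open>e\<^sub>j\<close> for \<open>j \<in> J\<close>: it is generated by a nonzero vector of weight \<open>\<lambda>\<close> that is
  annihilated by these \<open>e\<^sub>j\<close>.
\<close>

definition highest_weight_module ::
    "(complex \<Rightarrow> 'g \<Rightarrow> 'g) \<Rightarrow> ('g \<Rightarrow> 'g \<Rightarrow> 'g) \<Rightarrow> 'g::ab_group_add set \<Rightarrow> ('i \<Rightarrow> 'g) \<Rightarrow>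
     'g set \<Rightarrow> 'i set \<Rightarrow> ('g \<Rightarrow> complex) \<Rightarrow>
     (complex \<Rightarrow> 'v \<Rightarrow> 'v) \<Rightarrow> ('g \<Rightarrow> 'v::ab_group_add \<Rightarrow> 'v) \<Rightarrow> bool" where
  "highest_weight_module smul bracket H e P J lam scaleV act \<longleftrightarrow>
     lie_module smul bracket P scaleV act \<and>
     (\<exists>v. v \<noteq> 0 \<and> (\<forall>h\<in>H. act h v = scaleV (lam h) v) \<and> (\<forall>j\<in>J. act (e j) v = 0) \<and>
          lie_submodule P scaleV act hull {v} = UNIV)"

text \<open>
  The modules \<open>L(\<lambda>)\<close> (over the whole Lie algebra) and \<open>L\<^sub>J(\<lambda>)\<close> (over \<open>\<gg>\<^sub>J + \<hh>\<close>, so that its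
  weights are functionals on all of \<open>H\<close>). Both are unique up to isomorphism; the predicates
  say that a given module is a model of them.
\<close>

definition is_L ::
    "(complex \<Rightarrow> 'g \<Rightarrow> 'g) \<Rightarrow> ('g \<Rightarrow> 'g \<Rightarrow> 'g) \<Rightarrow> 'g::ab_group_add set \<Rightarrow> ('i \<Rightarrow> 'g) \<Rightarrow>
     ('g \<Rightarrow> complex) \<Rightarrow> (complex \<Rightarrow> 'v \<Rightarrow> 'v) \<Rightarrow> ('g \<Rightarrow> 'v::ab_group_add \<Rightarrow> 'v) \<Rightarrow> bool" where
  "is_L smul bracket H e lam scaleV act \<longleftrightarrow>
     simple_lie_module smul bracket UNIV scaleV act \<and>
     highest_weight_module smul bracket H e UNIV UNIV lam scaleV act"

definition is_L_sub ::
    "(complex \<Rightarrow> 'g \<Rightarrow> 'g) \<Rightarrow> ('g \<Rightarrow> 'g \<Rightarrow> 'g) \<Rightarrow> 'g::ab_group_add set \<Rightarrow>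
     ('i \<Rightarrow> 'g) \<Rightarrow> ('i \<Rightarrow> 'g) \<Rightarrow> ('i \<Rightarrow> 'g) \<Rightarrow> 'i set \<Rightarrow>
     ('g \<Rightarrow> complex) \<Rightarrow> (complex \<Rightarrow> 'v \<Rightarrow> 'v) \<Rightarrow> ('g \<Rightarrow> 'v::ab_group_add \<Rightarrow> 'v) \<Rightarrow> bool" where
  "is_L_sub smul bracket H e f coroot J lam scaleV act \<longleftrightarrow>
     simple_lie_module smul bracket
       (levi_subalgebra smul bracket H e f coroot J) scaleV act \<and>
     highest_weight_module smul bracket H e
       (levi_subalgebra smul bracket H e f coroot J) J lam scaleV act"

definition wt ::
    "(complex \<Rightarrow> 'g \<Rightarrow> 'g) \<Rightarrow> 'g::ab_group_add set \<Rightarrow>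
     (complex \<Rightarrow> 'v \<Rightarrow> 'v) \<Rightarrow> ('g \<Rightarrow> 'v::ab_group_add \<Rightarrow> 'v) \<Rightarrow> ('g \<Rightarrow> complex) set" where
  "wt smul H scaleV act =
     {\<mu> \<in> dual_space smul H. \<exists>v. v \<noteq> 0 \<and> (\<forall>h\<in>H. act h v = scaleV (\<mu> h) v)}"

definition integrable_nodes :: "('i \<Rightarrow> 'g) \<Rightarrow> ('g \<Rightarrow> complex) \<Rightarrow> 'i set" where
  "integrable_nodes coroot lam = {j. lam (coroot j) \<in> \<nat>}"

end

theory Submission
  imports Defs
begin

text \<open>
  Write \<open>I\<close> for the complement of \<open>J\<close>. Minimality holds because every generator has \<open>I\<close>-height 1.
  They generate because the subalgebra spanned by the products of root vectors of
  \<open>I\<close>-height 1 is stable under all \<open>e\<^sub>i\<close> modulo the part supported on \<open>J\<close>. If \<open>J\<close> is not the whole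
  diagram, then \<open>A\<^sub>J\<close> is of finite type, that is, \<open>A\<^sub>J x > 0\<close> for some \<open>x > 0\<close>; no symmetrizability
  is needed in what follows. The roots of \<open>I\<close>-height 1 are closed under the reflections at \<open>J\<close>,
  so averaging them shows that they are finite in number.

  For the weights, the vectors of \<open>L(\<lambda>)\<close> on which \<open>f\<^sub>i\<close> is nilpotent form a submodule. Hence \<open>f\<^sub>j\<close>
  is locally nilpotent for \<open>j \<in> J\<close>, so that the weights are closed under the reflections at \<open>J\<close>,
  and \<open>f\<^sub>i\<close> is injective for \<open>i \<in> I\<close>, so that \<open>\<alpha>\<^sub>i\<close> may be subtracted from any weight. A member of the
  right-hand side can be reflected to a \<open>J\<close>-dominant one, which lies below the weight with the
  same \<open>I\<close>-part and no \<open>J\<close>-part, and finite type lets one descend from the latter to it along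
  root strings. The same argument, applied to the adjoint representation, shows that the roots
  of \<open>I\<close>-height 1 are the negatives of those of \<open>I\<close>-height -1.
\<close>

section \<open>Cartan matrices and reflections\<close>

text \<open>The inclusion of \<open>wt L(\<lambda>)\<close> in the right-hand side is the generation
  argument once more, with \<open>e\<close> and \<open>f\<close> exchanged: from the vectors whose
  weight differs from \<lambda> only along J, products of vectors of I-height -1 exhaust the module.
  This yields roots of I-height -1, whereas the cone is made of those of I-height 1; hence the need
  to compare the two sets. \<open>L\<^sub>J(\<lambda>)\<close> is never embedded in
  \<open>L(\<lambda>)\<close>. In either module a monomial in the \<open>f\<^sub>i\<close> is
  nonzero on the highest weight vector exactly when some monomial in the \<open>e\<^sub>i\<close> of
  the same length brings it back to a nonzero multiple of that vector, and the multiples depend only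
  on A and the numbers \<open>\<lambda>(\<alpha>\<^sub>i\<^sup>\<or>)\<close>. The alternative
  \<open>J = UNIV\<close> accompanies finite type throughout: in affine type \<open>A\<close> itself
  is not of finite type, but for \<open>J = UNIV\<close> there are no roots of I-height 1 and the
  cone is 0. The algebra is known only through its axioms. The triangular decomposition, the Serre
  relations and the local nilpotency of the adjoint \<open>e\<^sub>i\<close> are therefore derived,
  the last two from the absence of ideals meeting H trivially.\<close>

lemma sum_UNIV_split:
  fixes g :: "'i::finite \<Rightarrow> 'b::comm_monoid_add"
  shows "(\<Sum>i\<in>UNIV. g i) = (\<Sum>i\<in>J. g i) + (\<Sum>i\<in>-J. g i)"
  using sum.union_disjoint[of J "-J" g] by (simp add: Compl_partition)

text \<open>The value of the coroot \<open>\<alpha>\<^sub>j\<^sup>\<or>\<close> on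
  \<open>\<Sum> n\<^sub>i \<alpha>\<^sub>i\<close> (see \<open>rt_coroot\<close>), in a form that
  makes the combinatorics independent of the Lie algebra.\<close>

definition pairing :: "int^'i^'i \<Rightarrow> 'i \<Rightarrow> ('i::finite \<Rightarrow> int) \<Rightarrow> int" where
  "pairing A j n = (\<Sum>i\<in>UNIV. A $ j $ i * n i)"

lemma pairing_add: "pairing A j (\<lambda>i. m i + n i) = pairing A j m + pairing A j n"
  by (simp add: pairing_def algebra_simps sum.distrib)

lemma pairing_diff: "pairing A j (\<lambda>i. m i - n i) = pairing A j m - pairing A j n"
  by (simp add: pairing_def algebra_simps sum_subtractf)

lemma pairing_uminus: "pairing A j (\<lambda>i. - n i) = - pairing A j n"
  by (simp add: pairing_def sum_negf)

lemma pairing_upd: "pairing A j (n(k := n k + r)) = pairing A j n + A $ j $ k * r"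
proof -
  have "A $ j $ i * (n(k := n k + r)) i = A $ j $ i * n i + (if i = k then A $ j $ k * r else 0)" for i
    by (simp add: algebra_simps)
  then show ?thesis by (simp add: pairing_def sum.distrib del: fun_upd_apply)
qed

section \<open>Submatrices of finite type\<close>

definition finite_type_on :: "int^'i^'i \<Rightarrow> 'i::finite set \<Rightarrow> bool" where
  "finite_type_on A J \<longleftrightarrow>
     (\<exists>x. \<forall>j\<in>J. x j > 0 \<and> (\<Sum>k\<in>J. real_of_int (A $ j $ k) * x k) > 0)"

text \<open>Dropping the columns outside \<open>J\<close> removes only nonpositive off-diagonal
  terms, so the row sums do not decrease.\<close>

lemma finite_type_on_subset:
  assumes gcm: "generalized_cartan_matrix A" and "finite_type_on A K" "J \<subseteq> K"
  shows "finite_type_on A J"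
proof -
  obtain x where x: "\<forall>j\<in>K. x j > 0 \<and> (\<Sum>k\<in>K. real_of_int (A $ j $ k) * x k) > 0"
    using assms(2) by (auto simp: finite_type_on_def)
  have "(\<Sum>k\<in>K. real_of_int (A $ j $ k) * x k) \<le> (\<Sum>k\<in>J. real_of_int (A $ j $ k) * x k)"
    if "j \<in> J" for j
  proof -
    have "(\<Sum>k\<in>K. real_of_int (A $ j $ k) * x k) =
        (\<Sum>k\<in>J. real_of_int (A $ j $ k) * x k) + (\<Sum>k\<in>K-J. real_of_int (A $ j $ k) * x k)"
      by (subst sum.subset_diff[OF \<open>J \<subseteq> K\<close>]) (simp_all add: add.commute)
    moreover have "(\<Sum>k\<in>K-J. real_of_int (A $ j $ k) * x k) \<le> 0"
    proof (rule sum_nonpos)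
      fix k assume "k \<in> K - J"
      then have "j \<noteq> k" using that by auto
      with \<open>k \<in> K - J\<close> have "A $ j $ k \<le> 0" "x k > 0"
        using gcm x by (auto simp: generalized_cartan_matrix_def)
      then show "real_of_int (A $ j $ k) * x k \<le> 0"
        by (simp add: mult_nonpos_nonneg)
    qed
    ultimately show ?thesis by simp
  qed
  then have "\<forall>j\<in>J. x j > 0 \<and> (\<Sum>k\<in>J. real_of_int (A $ j $ k) * x k) > 0"
    using x \<open>J \<subseteq> K\<close> by (meson less_le_trans subsetD)
  then show ?thesis unfolding finite_type_on_def by blast
qed

text \<open>Compare at an index where the ratio \<open>v j / x j\<close> is maximal.\<close>

lemma finite_type_bound:
  fixes x v :: "'i::finite \<Rightarrow> real"
  assumes gcm: "generalized_cartan_matrix A"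
    and x: "\<forall>j\<in>J. x j > 0 \<and> (\<Sum>k\<in>J. real_of_int (A $ j $ k) * x k) > 0"
    and c: "c \<ge> 0"
    and v: "\<And>j. j \<in> J \<Longrightarrow> v j > 0 \<Longrightarrow>
      (\<Sum>k\<in>J. real_of_int (A $ j $ k) * v k) \<le> c * (\<Sum>k\<in>J. real_of_int (A $ j $ k) * x k)"
    and j: "j \<in> J"
  shows "v j \<le> c * x j"
proof -
  define t where "t = Max ((\<lambda>j. v j / x j) ` J)"
  have "J \<noteq> {}" using j by auto
  have t_ge: "v k / x k \<le> t" if "k \<in> J" for k
    unfolding t_def using that by (intro Max_ge) auto
  have "t \<in> (\<lambda>j. v j / x j) ` J"
    unfolding t_def using \<open>J \<noteq> {}\<close> by (intro Max_in) auto
  then obtain i where i: "i \<in> J" "t = v i / x i" by auto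
  have vt: "v k \<le> t * x k" if "k \<in> J" for k
    using t_ge[OF that] x that by (simp add: pos_divide_le_eq)
  have "t \<le> c"
  proof (rule ccontr)
    assume "\<not> t \<le> c"
    then have "t > c" by simp
    have vi: "v i = t * x i" using i x by (metis less_numeral_extra(3) nonzero_eq_divide_eq)
    moreover have "t * x i > 0" using \<open>t > c\<close> c x i(1) by (intro mult_pos_pos) auto
    ultimately have "v i > 0" by simp
    then have 1: "(\<Sum>k\<in>J. real_of_int (A $ i $ k) * v k) \<le> c * (\<Sum>k\<in>J. real_of_int (A $ i $ k) * x k)"
      using v i by blast
    have "(\<Sum>k\<in>J. real_of_int (A $ i $ k) * (t * x k)) \<le> (\<Sum>k\<in>J. real_of_int (A $ i $ k) * v k)"
    proof (rule sum_mono)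
      fix k assume k: "k \<in> J"
      show "real_of_int (A $ i $ k) * (t * x k) \<le> real_of_int (A $ i $ k) * v k"
      proof (cases "k = i")
        case False
        then have "real_of_int (A $ i $ k) \<le> 0"
          using gcm by (auto simp: generalized_cartan_matrix_def)
        then show ?thesis using vt[OF k] by (intro mult_left_mono_neg)
      qed (simp add: vi)
    qed
    moreover have "(\<Sum>k\<in>J. real_of_int (A $ i $ k) * (t * x k)) = t * (\<Sum>k\<in>J. real_of_int (A $ i $ k) * x k)"
      by (simp add: sum_distrib_left mult_ac)
    ultimately have "t * (\<Sum>k\<in>J. real_of_int (A $ i $ k) * x k) \<le> c * (\<Sum>k\<in>J. real_of_int (A $ i $ k) * x k)"
      using 1 by linarith
    moreover have "c * (\<Sum>k\<in>J. real_of_int (A $ i $ k) * x k) < t * (\<Sum>k\<in>J. real_of_int (A $ i $ k) * x k)"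
      using \<open>t > c\<close> x i(1) by (intro mult_strict_right_mono) auto
    ultimately show False by linarith
  qed
  then have "t * x j \<le> c * x j" using x j by (intro mult_right_mono) auto
  then show ?thesis using vt[OF j] by linarith
qed

text \<open>The null vector \<open>u\<close>, restricted to \<open>J\<close>, has nonnegative row
  sums, and positive ones at nodes with a neighbour outside \<open>J\<close>; this is
  \<open>good\<close>. Among the good vectors take one with the most positive rows. If a zero row
  were left, indecomposability would give a zero row \<open>l\<close> next to a positive row
  \<open>k\<close>, and lowering the entry at \<open>k\<close> a little would make row
  \<open>l\<close> positive without spoiling the others.\<close>

lemma affine_finite_type:
  assumes aff: "affine_cartan_matrix A" and "J \<noteq> UNIV"
  shows "finite_type_on A J"
proof -
  have gcm: "generalized_cartan_matrix A" and ind: "indecomposable_matrix A"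
    using aff by (auto simp: affine_cartan_matrix_def)
  obtain u where u: "\<And>i. u $ i > 0" "real_matrix A *v u = 0"
    using aff by (auto simp: affine_cartan_matrix_def)
  define s where "s x j = (\<Sum>k\<in>J. real_of_int (A $ j $ k) * x k)" for x j
  define good where "good x \<longleftrightarrow> (\<forall>j\<in>J. x j > 0 \<and> s x j \<ge> 0 \<and>
    ((\<exists>i\<in>-J. A $ j $ i \<noteq> 0) \<longrightarrow> s x j > 0))" for x
  define p where "p x = card {j\<in>J. s x j > 0}" for x
  have "good (\<lambda>i. u $ i)"
    unfolding good_def
  proof (intro ballI conjI impI)
    fix j assume j: "j \<in> J"
    show "u $ j > 0" using u by simp
    have "(\<Sum>k\<in>UNIV. real_of_int (A $ j $ k) * u $ k) = 0"
      using u(2) by (simp add: vec_eq_iff matrix_vector_mult_def map_matrix_def)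
    moreover have "(\<Sum>k\<in>UNIV. real_of_int (A $ j $ k) * u $ k) =
       s (\<lambda>i. u $ i) j + (\<Sum>k\<in>-J. real_of_int (A $ j $ k) * u $ k)"
      unfolding s_def by (rule sum_UNIV_split)
    ultimately have eq: "s (\<lambda>i. u $ i) j = (\<Sum>k\<in>-J. - real_of_int (A $ j $ k) * u $ k)"
      by (simp add: sum_negf)
    have nn: "- real_of_int (A $ j $ k) * u $ k \<ge> 0" if "k \<in> -J" for k
    proof -
      have "j \<noteq> k" using that j by auto
      then have "A $ j $ k \<le> 0" using gcm by (auto simp: generalized_cartan_matrix_def)
      then show ?thesis using u(1)[of k] by (simp add: mult_nonpos_nonneg)
    qed
    then show "s (\<lambda>i. u $ i) j \<ge> 0" unfolding eq by (intro sum_nonneg) auto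
    assume "\<exists>i\<in>-J. A $ j $ i \<noteq> 0"
    then obtain i where i: "i \<in> -J" "A $ j $ i \<noteq> 0" by auto
    then have "- real_of_int (A $ j $ i) * u $ i \<noteq> 0" using u(1)[of i] by simp
    then have "- real_of_int (A $ j $ i) * u $ i > 0" using nn[OF i(1)] by linarith
    then show "s (\<lambda>i. u $ i) j > 0"
      unfolding eq using nn i(1) by (intro sum_pos2[of _ i]) auto
  qed
  moreover have "\<forall>x. good x \<longrightarrow> p x \<le> CARD('a)"
    by (auto simp: p_def intro: card_mono)
  ultimately obtain x where x: "good x" "\<And>y. good y \<Longrightarrow> p y \<le> p x"
    using ex_has_greatest_nat[of good "\<lambda>i. u $ i" p "Suc CARD('a)"] by (auto simp: less_Suc_eq_le)
  have "\<forall>j\<in>J. s x j > 0"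
  proof (rule ccontr)
    assume "\<not> ?thesis"
    define S where "S = {j\<in>J. \<not> s x j > 0}"
    have "S \<noteq> {}" "S \<noteq> UNIV" using \<open>\<not> (\<forall>j\<in>J. s x j > 0)\<close> \<open>J \<noteq> UNIV\<close> by (auto simp: S_def)
    then obtain l k where lk: "l \<in> S" "k \<notin> S" "A $ l $ k \<noteq> 0 \<or> A $ k $ l \<noteq> 0"
      using ind unfolding indecomposable_matrix_def by (metis ComplD)
    then have Alk: "A $ l $ k \<noteq> 0" using gcm by (auto simp: generalized_cartan_matrix_def)
    have lJ: "l \<in> J" using lk by (auto simp: S_def)
    \<comment> \<open>A node of \<open>J\<close> with a neighbour outside \<open>J\<close> has a
      positive row by \<open>good\<close>, and row \<open>l\<close> is not positive.\<close>
    have kJ: "k \<in> J"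
      using x(1) Alk lk lJ unfolding good_def S_def by auto
    have sk: "s x k > 0" using lk(2) kJ by (auto simp: S_def)
    \<comment> \<open>The first bound keeps the entry at \<open>k\<close> positive. The second keeps
      row \<open>k\<close> positive: it drops by \<open>2 * d\<close>, the diagonal entry being
      2.\<close>
    define d where "d = min (x k / 2) (s x k / 4)"
    have xk: "x k > 0" using x(1) kJ by (auto simp: good_def)
    have d: "d > 0" "d < x k" "2 * d < s x k"
      using sk xk by (auto simp: d_def min_def)
    define y where "y = x(k := x k - d)"
    have sy: "s y j = s x j - real_of_int (A $ j $ k) * d" for j
    proof -
      have "real_of_int (A $ j $ i) * y i =
         real_of_int (A $ j $ i) * x i - (if i = k then real_of_int (A $ j $ k) * d else 0)" for i
        by (simp add: y_def algebra_simps)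
      then show ?thesis using kJ by (simp add: s_def sum_subtractf)
    qed
    have sk': "s y k > 0" using d gcm sk by (simp add: sy generalized_cartan_matrix_def)
    have off: "A $ j $ k \<le> 0" if "j \<noteq> k" for j
      using gcm that by (auto simp: generalized_cartan_matrix_def)
    have sj: "s y j \<ge> s x j" if "j \<noteq> k" for j
      using off[OF that] d by (simp add: sy mult_nonpos_nonneg)
    have "l \<noteq> k" using lk by auto
    then have "real_of_int (A $ l $ k) * d < 0"
      using off[of l] Alk d by (simp add: mult_neg_pos)
    then have sl: "s y l > 0"
      using x(1) lJ unfolding sy good_def by (smt (verit, best))
    have "good y"
      unfolding good_def
    proof (intro ballI)
      fix j assume j: "j \<in> J"
      show "y j > 0 \<and> s y j \<ge> 0 \<and> ((\<exists>i\<in>-J. A $ j $ i \<noteq> 0) \<longrightarrow> s y j > 0)"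
      proof (cases "j = k")
        case True
        then show ?thesis using sk' d by (auto simp: y_def)
      next
        case False
        then show ?thesis using sj[OF False] x(1) j by (fastforce simp: good_def y_def)
      qed
    qed
    moreover have "p x < p y"
      unfolding p_def
    proof (rule psubset_card_mono)
      have "{j\<in>J. s x j > 0} \<subseteq> {j\<in>J. s y j > 0}" using sj sk' by force
      moreover have "l \<in> {j\<in>J. s y j > 0} - {j\<in>J. s x j > 0}" using sl lk lJ by (auto simp: S_def)
      ultimately show "{j\<in>J. s x j > 0} \<subset> {j\<in>J. s y j > 0}" by blast
    qed simp
    ultimately show False using x(2)[of y] by linarith
  qed
  then show ?thesis
    using x(1) unfolding finite_type_on_def good_def s_def by blast
qed

text \<open>
  The argument of Kac, Proposition 11.2: on a deepest member of \<open>S\<close> below a dominant \<open>n\<close>, the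
  difference to \<open>n\<close> would have nonpositive pairings on its support, which finite type excludes.
\<close>

lemma dominant_mem:
  fixes n :: "'i::finite \<Rightarrow> int"
  assumes gcm: "generalized_cartan_matrix A" and ft: "finite_type_on A J"
    and step: "\<And>m j. m \<in> S \<Longrightarrow> j \<in> J \<Longrightarrow> pairing A j m < l j \<Longrightarrow> m(j := m j + 1) \<in> S"
    and dom: "\<And>j. j \<in> J \<Longrightarrow> pairing A j n \<le> l j"
    and m: "m \<in> S" "\<And>i. m i \<le> n i" "\<And>i. i \<notin> J \<Longrightarrow> m i = n i"
  shows "n \<in> S"
  using m
proof (induction "nat (\<Sum>i\<in>UNIV. n i - m i)" arbitrary: m rule: less_induct)
  case less
  show ?case
  proof (cases "m = n")
    case False
    have "\<exists>j\<in>J. m j < n j \<and> pairing A j m < l j"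
    proof (rule ccontr)
      assume no: "\<not> ?thesis"
      obtain x where x: "\<forall>j\<in>J. x j > 0 \<and> (\<Sum>k\<in>J. real_of_int (A $ j $ k) * x k) > 0"
        using ft by (auto simp: finite_type_on_def)
      \<comment> \<open>The case \<open>c = 0\<close> of \<open>finite_type_bound\<close>: it leaves
        no positive entry in \<open>n - m\<close>.\<close>
      have "real_of_int (n j - m j) \<le> 0 * x j" if j: "j \<in> J" for j
      proof (rule finite_type_bound[OF gcm x _ _ j])
        fix j assume j: "j \<in> J" "real_of_int (n j - m j) > 0"
        have "(\<Sum>k\<in>J. A $ j $ k * (n k - m k)) = pairing A j (\<lambda>i. n i - m i)"
          unfolding pairing_def using less.prems by (intro sum.mono_neutral_left) auto
        also have "\<dots> \<le> 0" unfolding pairing_diff using dom[OF j(1)] no j by force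
        finally show "(\<Sum>k\<in>J. real_of_int (A $ j $ k) * real_of_int (n k - m k))
            \<le> 0 * (\<Sum>k\<in>J. real_of_int (A $ j $ k) * x k)"
          by (simp flip: of_int_mult of_int_diff of_int_sum)
      qed simp
      then have "n j = m j" for j
        using less.prems by (cases "j \<in> J") (force simp: antisym)+
      then show False using False by auto
    qed
    then obtain j where j: "j \<in> J" "m j < n j" "pairing A j m < l j" by auto
    let ?m = "m(j := m j + 1)"
    have "(\<Sum>i\<in>UNIV. n i - ?m i) < (\<Sum>i\<in>UNIV. n i - m i)"
      by (rule sum_strict_mono_ex1) auto
    moreover have "(\<Sum>i\<in>UNIV. n i - ?m i) \<ge> 0"
      using j less.prems by (intro sum_nonneg) auto
    ultimately show ?thesis
      using less.prems j step by (intro less.hyps[of ?m]) auto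
  qed (use less.prems in simp)
qed

text \<open>
  Here \<open>n\<close> stands for the weight \<open>\<lambda> - \<Sum> n\<^sub>i \<alpha>\<^sub>i\<close>, and \<open>l j\<close> for \<open>\<lambda>(\<alpha>\<^sub>j\<^sup>\<or>)\<close>, so that
  \<open>l j - pairing A j n\<close> is the pairing of that weight with the coroot. Lowering reflections
  bring a member of \<open>D\<close> to a dominant one, and the strings of \<open>S\<close> undo them.
\<close>

lemma reflection_closed_subset:
  fixes D S :: "('i::finite \<Rightarrow> int) set"
  assumes gcm: "generalized_cartan_matrix A" and ft: "finite_type_on A J"
    and string: "\<And>m j r. m \<in> S \<Longrightarrow> j \<in> J \<Longrightarrow> 0 \<le> r \<Longrightarrow> r \<le> l j - pairing A j m \<Longrightarrow>
      m(j := m j + r) \<in> S"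
    and refl: "\<And>n j. n \<in> D \<Longrightarrow> j \<in> J \<Longrightarrow> l j < pairing A j n \<Longrightarrow>
      n(j := n j + (l j - pairing A j n)) \<in> D"
    and nonneg: "\<And>n j. n \<in> D \<Longrightarrow> j \<in> J \<Longrightarrow> 0 \<le> n j"
    and base: "\<And>n. n \<in> D \<Longrightarrow> (\<lambda>i. if i \<in> J then 0 else n i) \<in> S"
  shows "D \<subseteq> S"
proof
  fix n assume "n \<in> D"
  then show "n \<in> S"
  proof (induction "nat (\<Sum>i\<in>J. n i)" arbitrary: n rule: less_induct)
    case less
    show ?case
    proof (cases "\<exists>j\<in>J. l j < pairing A j n")
      case False
      show ?thesis
      proof (rule dominant_mem[OF gcm ft, of S l])
        show "(\<lambda>i. if i \<in> J then 0 else n i) \<in> S" using base less.prems .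
        show "m(j := m j + 1) \<in> S" if "m \<in> S" "j \<in> J" "pairing A j m < l j" for m j
          using string[of m j 1] that by simp
      qed (use False less.prems nonneg in \<open>auto simp: not_less\<close>)
    next
      case True
      then obtain j where j: "j \<in> J" "l j < pairing A j n" by auto
      define r where "r = pairing A j n - l j"
      let ?n = "n(j := n j - r)"
      have "?n \<in> D" using refl[OF less.prems j] by (simp add: r_def algebra_simps)
      moreover have "(\<Sum>i\<in>J. ?n i) < (\<Sum>i\<in>J. n i)"
        using j by (intro sum_strict_mono_ex1) (auto simp: r_def)
      moreover have "(\<Sum>i\<in>J. ?n i) \<ge> 0"
        using nonneg[OF \<open>?n \<in> D\<close>] by (intro sum_nonneg) auto
      ultimately have "?n \<in> S" by (intro less.hyps) auto
      \<comment> \<open>The reflected weight pairs to \<open>r\<close> with the coroot, so a string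
        of length exactly \<open>r\<close> leads back to \<open>n\<close>.\<close>
      moreover have "A $ j $ j = 2" using gcm by (simp add: generalized_cartan_matrix_def)
      then have "pairing A j ?n = pairing A j n - 2 * r"
        using pairing_upd[of A j n j "- r"] by simp
      ultimately have "?n(j := ?n j + r) \<in> S"
        using j by (intro string) (auto simp: r_def)
      then show ?thesis by simp
    qed
  qed
qed

section \<open>Finiteness of reflection-closed sets\<close>

lemma finite_bounded_nonneg:
  "finite {n::'i::finite \<Rightarrow> int. (\<forall>i. 0 \<le> n i) \<and> (\<Sum>i\<in>UNIV. n i) \<le> N}"
proof -
  have "n i \<le> N" if "\<forall>i. 0 \<le> n i" "(\<Sum>i\<in>UNIV. n i) \<le> N" for n :: "'i \<Rightarrow> int" and i
    using that member_le_sum[of i UNIV n] by auto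
  then have "{n::'i \<Rightarrow> int. (\<forall>i. 0 \<le> n i) \<and> (\<Sum>i\<in>UNIV. n i) \<le> N} \<subseteq> PiE UNIV (\<lambda>_. {0..N})"
    by auto
  then show ?thesis by (rule finite_subset) (simp add: finite_PiE)
qed

text \<open>
  Sum the members of height at most \<open>N\<close>. The reflection at \<open>j\<close> maps those with positive pairing
  injectively to lower ones with the opposite pairing, so the sum pairs nonpositively with every
  \<open>j \<in> J\<close>, and by finite type the average height is bounded independently of \<open>N\<close>.
\<close>

lemma reflection_closed_finite:
  fixes X :: "('i::finite \<Rightarrow> int) set"
  assumes gcm: "generalized_cartan_matrix A" and ft: "finite_type_on A J"
    and nonneg: "\<And>n i. n \<in> X \<Longrightarrow> 0 \<le> n i"
    and one: "\<And>n. n \<in> X \<Longrightarrow> (\<Sum>i\<in>-J. n i) = 1"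
    and refl: "\<And>n j. n \<in> X \<Longrightarrow> j \<in> J \<Longrightarrow> 0 < pairing A j n \<Longrightarrow>
      n(j := n j - pairing A j n) \<in> X"
  shows "finite X"
proof -
  obtain x where x: "\<forall>j\<in>J. x j > 0 \<and> (\<Sum>k\<in>J. real_of_int (A $ j $ k) * x k) > 0"
    using ft by (auto simp: finite_type_on_def)
  define ht :: "('i \<Rightarrow> int) \<Rightarrow> int" where "ht n = (\<Sum>i\<in>UNIV. n i)" for n
  define XN where "XN N = {n\<in>X. ht n \<le> N}" for N
  have finXN: "finite (XN N)" for N
    by (rule finite_subset[OF _ finite_bounded_nonneg[of N]]) (auto simp: XN_def ht_def nonneg)
  have A2: "A $ j $ j = 2" for j using gcm by (simp add: generalized_cartan_matrix_def)
  have refl_pairing: "pairing A j (n(j := n j - pairing A j n)) = - pairing A j n" for j n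
    using pairing_upd[of A j n j "- pairing A j n"] A2 by simp
  have sum_nonpos: "(\<Sum>n\<in>XN N. pairing A j n) \<le> 0" if j: "j \<in> J" for j N
  proof -
    let ?s = "\<lambda>n. n(j := n j - pairing A j n)"
    define Po where "Po = {n\<in>XN N. 0 < pairing A j n}"
    define Ne where "Ne = {n\<in>XN N. pairing A j n < 0}"
    have inj: "inj_on ?s Po"
    proof (rule inj_onI)
      fix m n assume eq: "?s m = ?s n"
      then have "pairing A j m = pairing A j n" using refl_pairing by (metis neg_equal_iff_equal)
      moreover have "m i = n i" if "i \<noteq> j" for i using fun_cong[OF eq, of i] that by simp
      ultimately have "m i = n i" for i using fun_cong[OF eq, of j] by (cases "i = j") auto
      then show "m = n" by auto
    qed
    have img: "?s ` Po \<subseteq> Ne"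
    proof
      fix m assume "m \<in> ?s ` Po"
      then obtain n where n: "n \<in> Po" "m = ?s n" by auto
      have "ht m \<le> ht n" unfolding ht_def using n by (intro sum_mono) (auto simp: Po_def)
      then show "m \<in> Ne"
        using n refl[of n j] j refl_pairing[of j n] by (auto simp: Po_def Ne_def XN_def)
    qed
    have fin: "finite Po" "finite Ne" using finXN by (auto simp: Po_def Ne_def)
    have "(\<Sum>n\<in>XN N. pairing A j n) = (\<Sum>n\<in>Po \<union> Ne. pairing A j n)"
      using finXN by (intro sum.mono_neutral_right) (auto simp: Po_def Ne_def)
    also have "\<dots> = (\<Sum>n\<in>Po. pairing A j n) + (\<Sum>n\<in>Ne. pairing A j n)"
      using fin by (intro sum.union_disjoint) (auto simp: Po_def Ne_def)
    also have "(\<Sum>n\<in>Ne. pairing A j n) \<le> (\<Sum>n\<in>?s ` Po. pairing A j n)"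
      using sum_mono2[OF fin(2) img, of "\<lambda>n. - pairing A j n"]
      by (auto simp: sum_negf Ne_def)
    also have "(\<Sum>n\<in>?s ` Po. pairing A j n) = - (\<Sum>n\<in>Po. pairing A j n)"
      by (simp add: sum.reindex[OF inj] refl_pairing sum_negf)
    finally show ?thesis by simp
  qed
  \<comment> \<open>By the choice of \<open>a\<close>, row \<open>j\<close> applied to
    \<open>a * x\<close> is at least the sum of the absolute values of the entries of that row
    outside \<open>J\<close>. Hence \<open>card (XN N) * a * x\<close> bounds the summed
    \<open>J\<close>-coordinates; the coordinates outside \<open>J\<close> add 1 per member, which
    gives the bound \<open>B\<close> on the average height.\<close>
  define q where "q j = (\<Sum>k\<in>J. real_of_int (A $ j $ k) * x k)" for j
  define a where "a = (\<Sum>j\<in>J. (\<Sum>i\<in>-J. \<bar>real_of_int (A $ j $ i)\<bar>) / q j)"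
  define B where "B = 1 + a * (\<Sum>j\<in>J. x j)"
  have q: "q j > 0" if "j \<in> J" for j using x that by (simp add: q_def)
  have a_term: "0 \<le> (\<Sum>i\<in>-J. \<bar>real_of_int (A $ j $ i)\<bar>) / q j" if "j \<in> J" for j
    using q[OF that] by (intro divide_nonneg_pos sum_nonneg) auto
  have a0: "a \<ge> 0" unfolding a_def using a_term by (rule sum_nonneg)
  have a: "(\<Sum>i\<in>-J. \<bar>real_of_int (A $ j $ i)\<bar>) \<le> a * q j" if "j \<in> J" for j
  proof -
    have "(\<Sum>i\<in>-J. \<bar>real_of_int (A $ j $ i)\<bar>) / q j \<le> a"
      unfolding a_def using that a_term by (intro member_le_sum) auto
    then show ?thesis using q[OF that] by (simp add: pos_divide_le_eq)
  qed
  have B1: "B \<ge> 1" unfolding B_def using a0 x by (simp add: sum_nonneg less_imp_le)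
  have avg: "real_of_int (\<Sum>n\<in>XN N. ht n) \<le> B * card (XN N)" for N
  proof -
    define \<sigma> where "\<sigma> i = (\<Sum>n\<in>XN N. n i)" for i
    define c where "c = card (XN N)"
    have \<sigma>0: "\<sigma> i \<ge> 0" for i unfolding \<sigma>_def by (intro sum_nonneg) (auto simp: XN_def nonneg)
    have \<sigma>I: "(\<Sum>i\<in>-J. \<sigma> i) = int c"
    proof -
      have "(\<Sum>i\<in>-J. \<sigma> i) = (\<Sum>n\<in>XN N. \<Sum>i\<in>-J. n i)"
        unfolding \<sigma>_def by (rule sum.swap)
      also have "\<dots> = (\<Sum>n\<in>XN N. 1)"
        using one by (intro sum.cong) (auto simp: XN_def)
      finally show ?thesis by (simp add: c_def)
    qed
    have \<sigma>i: "real_of_int (\<sigma> i) \<le> c" if "i \<in> -J" for i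
      using member_le_sum[of i "-J" \<sigma>] that \<sigma>0 \<sigma>I by (metis finite of_int_le_iff of_int_of_nat_eq)
    have pj: "pairing A j \<sigma> \<le> 0" if "j \<in> J" for j
    proof -
      have "pairing A j \<sigma> = (\<Sum>n\<in>XN N. pairing A j n)"
        unfolding pairing_def \<sigma>_def sum_distrib_left by (rule sum.swap)
      then show ?thesis using sum_nonpos[OF that] by simp
    qed
    have "real_of_int (\<sigma> j) \<le> (c * a) * x j" if j: "j \<in> J" for j
    proof (rule finite_type_bound[OF gcm x _ _ j])
      show "0 \<le> real c * a" using a0 by simp
      fix j assume j: "j \<in> J"
      have "pairing A j \<sigma> = (\<Sum>k\<in>J. A $ j $ k * \<sigma> k) + (\<Sum>k\<in>-J. A $ j $ k * \<sigma> k)"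
        unfolding pairing_def by (rule sum_UNIV_split)
      then have "real_of_int (\<Sum>k\<in>J. A $ j $ k * \<sigma> k) \<le> real_of_int (- (\<Sum>k\<in>-J. A $ j $ k * \<sigma> k))"
        using pj[OF j] by (simp only: of_int_le_iff)
      also have "\<dots> = (\<Sum>k\<in>-J. - real_of_int (A $ j $ k) * real_of_int (\<sigma> k))"
        by (simp add: sum_negf)
      also have "\<dots> \<le> (\<Sum>k\<in>-J. \<bar>real_of_int (A $ j $ k)\<bar> * real c)"
        using \<sigma>0 \<sigma>i by (intro sum_mono mult_mono) auto
      also have "\<dots> = real c * (\<Sum>k\<in>-J. \<bar>real_of_int (A $ j $ k)\<bar>)"
        by (simp add: sum_distrib_left mult.commute)
      also have "\<dots> \<le> real c * (a * q j)" using a[OF j] by (intro mult_left_mono) auto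
      finally show "(\<Sum>k\<in>J. real_of_int (A $ j $ k) * real_of_int (\<sigma> k))
          \<le> real c * a * (\<Sum>k\<in>J. real_of_int (A $ j $ k) * x k)"
        by (simp add: q_def mult.assoc)
    qed
    then have "(\<Sum>j\<in>J. real_of_int (\<sigma> j)) \<le> (\<Sum>j\<in>J. (c * a) * x j)"
      by (intro sum_mono)
    moreover have "(\<Sum>n\<in>XN N. ht n) = (\<Sum>i\<in>UNIV. \<sigma> i)"
      unfolding ht_def \<sigma>_def by (rule sum.swap)
    moreover have "(\<Sum>i\<in>UNIV. \<sigma> i) = (\<Sum>i\<in>J. \<sigma> i) + int c"
      unfolding \<sigma>I[symmetric] by (rule sum_UNIV_split)
    ultimately show ?thesis
      by (simp add: B_def c_def[symmetric] sum_distrib_left algebra_simps)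
  qed
  \<comment> \<open>Markov's inequality: with average height at most \<open>B\<close>, at most half
    of \<open>XN N\<close> lies above height \<open>2 * B\<close>. The rest lies in
    \<open>Y\<close>, which does not depend on \<open>N\<close>.\<close>
  define Y where "Y = XN \<lfloor>2 * B\<rfloor>"
  have card_le: "card (XN N) \<le> 2 * card Y" for N
  proof -
    define Z where "Z = XN N - Y"
    have Z: "2 * B \<le> real_of_int (ht n)" if "n \<in> Z" for n
      using that by (auto simp: Z_def Y_def XN_def) linarith
    have ht0: "ht n \<ge> 0" if "n \<in> X" for n
      unfolding ht_def using that nonneg by (intro sum_nonneg) auto
    have "2 * B * card Z = (\<Sum>n\<in>Z. 2 * B)" by simp
    also have "\<dots> \<le> (\<Sum>n\<in>Z. real_of_int (ht n))" using Z by (rule sum_mono)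
    also have "\<dots> \<le> (\<Sum>n\<in>XN N. real_of_int (ht n))"
      using finXN ht0 by (intro sum_mono2) (auto simp: Z_def XN_def)
    also have "\<dots> \<le> B * card (XN N)" using avg[of N] by simp
    finally have "B * (2 * card Z) \<le> B * card (XN N)" by (simp add: mult_ac)
    then have "2 * card Z \<le> card (XN N)" using B1 by (simp add: mult_le_cancel_left)
    moreover have "card (XN N) \<le> card Y + card Z"
    proof -
      have "card (XN N) \<le> card (Y \<union> Z)"
        using finXN by (intro card_mono) (auto simp: Y_def Z_def)
      then show ?thesis using card_Un_le[of Y Z] by linarith
    qed
    ultimately show ?thesis by linarith
  qed
  show ?thesis
  proof (rule ccontr)
    assume "infinite X"
    then obtain F where F: "F \<subseteq> X" "finite F" "card F = Suc (2 * card Y)"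
      using infinite_arbitrarily_large by blast
    define N where "N = Max (ht ` F)"
    have "F \<subseteq> XN N"
      using F by (auto simp: XN_def N_def)
    then have "card F \<le> card (XN N)" using finXN by (intro card_mono)
    then show False using card_le[of N] F by linarith
  qed
qed

section \<open>The root lattice\<close>

lemma sum_list_map_count:
  fixes g :: "'a \<Rightarrow> 'b::semiring_1"
  assumes "finite F" "set xs \<subseteq> F"
  shows "sum_list (map g xs) = (\<Sum>x\<in>F. of_nat (count_list xs x) * g x)"
  using assms(2)
proof (induction xs)
  case (Cons a xs)
  have "of_nat (count_list (a # xs) x) * g x =
      of_nat (count_list xs x) * g x + (if x = a then g a else 0)" for x
    by (auto simp: algebra_simps)
  then show ?case using Cons assms(1) by (simp add: sum.distrib add.commute del: count_list.simps)
qed simp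

text \<open>Lists with repetition in place of multiplicities allow induction by adding one generator
  at a time.\<close>

lemma nonneg_int_span_iff:
  "x \<in> nonneg_int_span S \<longleftrightarrow> (\<exists>xs. set xs \<subseteq> S \<and> x = sum_list xs)"
proof
  assume "x \<in> nonneg_int_span S"
  then obtain T n where T: "finite T" "T \<subseteq> S" and x: "x = (\<lambda>h. \<Sum>\<beta>\<in>T. of_nat (n \<beta>) * \<beta> h)"
    by (auto simp: nonneg_int_span_def)
  have rep: "sum_list (replicate m \<beta>) = (\<lambda>h. of_nat m * \<beta> h)" for m and \<beta> :: "'a \<Rightarrow> complex"
    by (induction m) (auto simp: fun_eq_iff algebra_simps)
  have "\<exists>xs. set xs \<subseteq> T \<and> (\<lambda>h. \<Sum>\<beta>\<in>T. of_nat (n \<beta>) * \<beta> h) = sum_list xs"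
    using T(1)
  proof (induction T rule: finite_induct)
    case empty
    then show ?case by (intro exI[of _ "[]"]) (auto simp: fun_eq_iff)
  next
    case (insert \<beta> T)
    then obtain xs where xs: "set xs \<subseteq> T" "(\<lambda>h. \<Sum>\<beta>\<in>T. of_nat (n \<beta>) * \<beta> h) = sum_list xs"
      by auto
    have "(\<lambda>h. \<Sum>\<beta>\<in>insert \<beta> T. of_nat (n \<beta>) * \<beta> h) = sum_list (replicate (n \<beta>) \<beta> @ xs)"
      unfolding sum_list_append rep xs(2)[symmetric] plus_fun_def
      using insert.hyps by simp
    moreover have "set (replicate (n \<beta>) \<beta> @ xs) \<subseteq> insert \<beta> T"
      using xs(1) by auto
    ultimately show ?case by blast
  qed
  then show "\<exists>xs. set xs \<subseteq> S \<and> x = sum_list xs" using T x by blast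
next
  assume "\<exists>xs. set xs \<subseteq> S \<and> x = sum_list xs"
  then obtain xs where xs: "set xs \<subseteq> S" "x = sum_list xs" by auto
  have "sum_list xs = (\<lambda>h. \<Sum>\<beta>\<in>set xs. of_nat (count_list xs \<beta>) * \<beta> h)"
  proof
    fix h
    have "sum_list xs h = sum_list (map (\<lambda>\<beta>. \<beta> h) xs)" by (induction xs) auto
    also have "\<dots> = (\<Sum>\<beta>\<in>set xs. of_nat (count_list xs \<beta>) * \<beta> h)"
      by (rule sum_list_map_count) auto
    finally show "sum_list xs h = (\<Sum>\<beta>\<in>set xs. of_nat (count_list xs \<beta>) * \<beta> h)" .
  qed
  then show "x \<in> nonneg_int_span S"
    using xs unfolding nonneg_int_span_def by blast
qed

lemma nonneg_int_span_base: "x \<in> S \<Longrightarrow> x \<in> nonneg_int_span S"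
  unfolding nonneg_int_span_iff by (intro exI[of _ "[x]"]) auto

lemma zero_in_nonneg_int_span: "0 \<in> nonneg_int_span S"
  unfolding nonneg_int_span_iff by (intro exI[of _ "[]"]) auto

lemma nonneg_int_span_add:
  "x \<in> nonneg_int_span S \<Longrightarrow> y \<in> nonneg_int_span S \<Longrightarrow> x + y \<in> nonneg_int_span S"
  unfolding nonneg_int_span_iff by (metis set_append sum_list_append Un_least)

lemma nonneg_int_span_induct [consumes 1, case_names zero add]:
  assumes "x \<in> nonneg_int_span S" and "P 0"
    and "\<And>x y. x \<in> S \<Longrightarrow> y \<in> nonneg_int_span S \<Longrightarrow> P y \<Longrightarrow> P (x + y)"
  shows "P x"
proof -
  obtain xs where "set xs \<subseteq> S" "x = sum_list xs"
    using assms(1) by (auto simp: nonneg_int_span_iff)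
  then show ?thesis
  proof (induction xs arbitrary: x)
    case (Cons a xs)
    moreover have "sum_list xs \<in> nonneg_int_span S"
      using Cons.prems by (auto simp: nonneg_int_span_iff)
    ultimately have "P (a + sum_list xs)" using assms(3)[of a "sum_list xs"] by simp
    then show ?case using Cons.prems(2) by (simp only: sum_list.Cons)
  qed (use assms(2) in simp)
qed

lemma nonneg_int_span_subset:
  assumes "S \<subseteq> nonneg_int_span T"
  shows "nonneg_int_span S \<subseteq> nonneg_int_span T"
proof
  fix x assume "x \<in> nonneg_int_span S"
  then show "x \<in> nonneg_int_span T"
  proof (induction rule: nonneg_int_span_induct)
    case zero
    show ?case by (rule zero_in_nonneg_int_span)
  next
    case (add x y)
    then show ?case using assms by (intro nonneg_int_span_add) auto
  qed
qed

lemma dual_space_diff: "\<mu> \<in> dual_space smul H \<Longrightarrow> \<nu> \<in> dual_space smul H \<Longrightarrow> \<mu> - \<nu> \<in> dual_space smul H"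
  by (auto simp: dual_space_def algebra_simps)

lemma dual_space_uminus: "\<mu> \<in> dual_space smul H \<Longrightarrow> - \<mu> \<in> dual_space smul H"
  by (auto simp: dual_space_def algebra_simps)

lemma dual_space_zero: "0 \<in> dual_space smul H"
  by (auto simp: dual_space_def)

lemma dual_space_eqI:
  assumes "\<mu> \<in> dual_space smul H" "\<nu> \<in> dual_space smul H" "\<And>h. h \<in> H \<Longrightarrow> \<mu> h = \<nu> h"
  shows "\<mu> = \<nu>"
proof
  fix x show "\<mu> x = \<nu> x" using assms by (cases "x \<in> H") (auto simp: dual_space_def)
qed

definition weight_space ::
    "'h set \<Rightarrow> (complex \<Rightarrow> 'v \<Rightarrow> 'v) \<Rightarrow> ('h \<Rightarrow> 'v \<Rightarrow> 'v) \<Rightarrow> ('h \<Rightarrow> complex) \<Rightarrow> 'v set" where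
  "weight_space H scaleV act \<mu> = {v. \<forall>h\<in>H. act h v = scaleV (\<mu> h) v}"

definition unit_vec :: "'i \<Rightarrow> 'i \<Rightarrow> int" where
  "unit_vec j = (\<lambda>i. if i = j then 1 else 0)"

definition cnt :: "'i list \<Rightarrow> 'i \<Rightarrow> int" where
  "cnt a = (\<lambda>i. int (count_list a i))"

lemma cnt_Nil [simp]: "cnt [] = 0"
  by (simp add: cnt_def fun_eq_iff)

lemma cnt_Cons: "cnt (j # a) = unit_vec j + cnt a"
  by (simp add: cnt_def fun_eq_iff unit_vec_def)

context kac_moody_algebra
begin

abbreviation "GW \<equiv> weight_space H smul bracket"

lemma gcm_diag: "A $ i $ i = 2"
  using cartan_matrix by (simp add: generalized_cartan_matrix_def)

lemma bracket_zero_left [simp]: "bracket 0 x = 0"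
  using bracket_add_left[of 0 0 x] by simp

lemma bracket_zero_right [simp]: "bracket x 0 = 0"
  using bracket_add_right[of x 0 0] by simp

lemma bracket_uminus_left: "bracket (- x) y = - bracket x y"
  using bracket_add_left[of "- x" x y] by (simp add: eq_neg_iff_add_eq_0)

lemma bracket_uminus_right: "bracket x (- y) = - bracket x y"
  using bracket_add_right[of x "- y" y] by (simp add: eq_neg_iff_add_eq_0)

lemma bracket_antisym: "bracket x y = - bracket y x"
proof -
  have "bracket (x + y) (x + y) = 0" by (rule bracket_self)
  then have "bracket x y + bracket y x = 0"
    unfolding bracket_add_left bracket_add_right by (simp add: bracket_self add.commute)
  then show ?thesis by (simp add: eq_neg_iff_add_eq_0)
qed

lemma bracket_bracket: "bracket (bracket x y) z = bracket x (bracket y z) - bracket y (bracket x z)"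
proof -
  have "bracket z (bracket x y) = - bracket (bracket x y) z" by (rule bracket_antisym)
  moreover have "bracket y (bracket z x) = - bracket y (bracket x z)"
    by (subst bracket_antisym[of z x]) (rule bracket_uminus_right)
  ultimately show ?thesis using jacobi[of x y z] by (simp add: algebra_simps)
qed

lemma bracket_f_e: "bracket (f i) (e j) = (if i = j then - coroot i else 0)"
  using bracket_antisym[of "f i" "e j"] by (auto simp: bracket_e_f)

text \<open>
  The Chevalley involution at the level of the presentation: it turns each statement about the
  \<open>e\<^sub>i\<close> into one about the \<open>f\<^sub>i\<close> without an automorphism of the algebra having to be constructed.
\<close>

lemma flip: "kac_moody_algebra smul bracket A H f e (\<lambda>i. - coroot i) (\<lambda>i. - sroot i)"
proof -
  interpret neg: Vector_Spaces.linear smul smul uminus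
    by unfold_locales (simp_all add: scale_right_distrib)
  have inj: "inj (\<lambda>i. - coroot i)" using coroot_independent(1) by (auto simp: inj_def)
  have "independent ((\<lambda>x. - x) ` range coroot)"
    using coroot_independent(2) by (rule neg.independent_injective_image) (simp add: inj_on_def)
  then have ind: "independent (range (\<lambda>i. - coroot i))" by (simp add: image_image)
  show ?thesis
  proof unfold_locales
    show "inj (\<lambda>i. - coroot i)" by (rule inj)
    show "independent (range (\<lambda>i. - coroot i))" by (rule ind)
    show "generalized_cartan_matrix A" "subspace H" "dim H + rank (real_matrix A) = 2 * CARD('i)"
      using cartan_matrix H_subspace dim_H by auto
    show "- coroot i \<in> H" for i using coroot_in_H H_subspace by (simp add: subspace_neg)
    show "- sroot i \<in> dual_space smul H" for i using sroot_in_dual by (rule dual_space_uminus)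
    show "c i = 0" if "\<forall>h\<in>H. (\<Sum>i\<in>UNIV. c i * (- sroot i) h) = 0" for c i
      using sroot_independent[of c] that by (simp add: sum_negf)
    show "(- sroot j) (- coroot i) = of_int (A $ i $ j)" for i j
    proof -
      have "sroot j (smul (-1) (coroot i)) = (-1) * sroot j (coroot i)"
        using sroot_in_dual[of j] coroot_in_H[of i] unfolding dual_space_def by blast
      then show ?thesis by (simp add: sroot_coroot)
    qed
    show "bracket h h' = 0" if "h \<in> H" "h' \<in> H" for h h' using bracket_H that .
    show "bracket h (f i) = smul ((- sroot i) h) (f i)" if "h \<in> H" for h i
      using bracket_f[OF that] by simp
    show "bracket h (e i) = smul (- (- sroot i) h) (e i)" if "h \<in> H" for h i
      using bracket_e[OF that] by simp
    show "bracket (f i) (e j) = (if i = j then - coroot i else 0)" for i j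
      by (rule bracket_f_e)
    show "lie_subalgebra smul bracket hull (H \<union> range f \<union> range e) = UNIV"
      using generated by (simp add: Un_ac)
    show "K = {0}" if "lie_ideal smul bracket K" "K \<inter> H = {0}" for K
      using ideal_trivial that .
  qed
qed

section \<open>Integer coordinates on the root lattice\<close>

definition rt :: "('i \<Rightarrow> int) \<Rightarrow> 'g \<Rightarrow> complex" where
  "rt n = (\<lambda>h. \<Sum>i\<in>UNIV. of_int (n i) * sroot i h)"

lemma rt_add: "rt (m + n) = rt m + rt n"
  by (simp add: rt_def fun_eq_iff algebra_simps sum.distrib)

lemma rt_uminus: "rt (- n) = - rt n"
  by (simp add: rt_def fun_eq_iff sum_negf)

lemma rt_diff: "rt (m - n) = rt m - rt n"
  by (simp add: rt_def fun_eq_iff algebra_simps sum_subtractf)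

lemma rt_zero [simp]: "rt 0 = 0"
  using rt_diff[of 0 0] by simp

lemma rt_unit_vec [simp]: "rt (unit_vec j) = sroot j"
proof
  fix h
  have "of_int (unit_vec j i) * sroot i h = (if i = j then sroot j h else 0)" for i
    by (simp add: unit_vec_def)
  then show "rt (unit_vec j) h = sroot j h" by (simp add: rt_def)
qed

lemma rt_upd: "rt (n(j := n j + r)) = rt n + (\<lambda>h. of_int r * sroot j h)"
proof
  fix h
  have "of_int ((n(j := n j + r)) i) * sroot i h =
      of_int (n i) * sroot i h + (if i = j then of_int r * sroot j h else 0)" for i
    by (simp add: algebra_simps)
  then show "rt (n(j := n j + r)) h = (rt n + (\<lambda>h. of_int r * sroot j h)) h"
    by (simp add: rt_def sum.distrib del: fun_upd_apply)
qed

lemma rt_in_dual [simp]: "rt n \<in> dual_space smul H"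
  using sroot_in_dual
  by (auto simp: rt_def dual_space_def algebra_simps sum.distrib sum_distrib_left)

lemma rt_eq_iff [simp]: "rt m = rt n \<longleftrightarrow> m = n"
proof
  assume eq: "rt m = rt n"
  have "complex_of_int (m i - n i) = 0" for i
  proof (rule sroot_independent)
    show "\<forall>h\<in>H. (\<Sum>i\<in>UNIV. complex_of_int (m i - n i) * sroot i h) = 0"
      using fun_cong[OF eq] by (simp add: rt_def algebra_simps sum_subtractf)
  qed
  then show "m = n" by (auto simp: fun_eq_iff)
qed simp

lemma rt_coroot: "rt n (coroot j) = of_int (pairing A j n)"
  by (simp add: rt_def pairing_def sroot_coroot mult.commute)

lemma sroot_coeff_rt: "sroot_coeff sroot (rt n) = (\<lambda>i. of_int (n i))"
  unfolding sroot_coeff_def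
proof (rule the_equality)
  fix c assume c: "rt n = (\<lambda>h. \<Sum>i\<in>UNIV. c i * sroot i h)"
  have "c i - of_int (n i) = 0" for i
  proof (rule sroot_independent)
    show "\<forall>h\<in>H. (\<Sum>i\<in>UNIV. (c i - of_int (n i)) * sroot i h) = 0"
      using fun_cong[OF c] by (simp add: rt_def algebra_simps sum_subtractf)
  qed
  then show "c = (\<lambda>i. of_int (n i))" by auto
qed (simp add: rt_def)

lemma height_rt: "height sroot I (rt n) = of_int (\<Sum>i\<in>I. n i)"
  by (simp add: height_def sroot_coeff_rt)

lemma inj_sroot: "inj sroot"
proof (rule injI)
  fix i j assume "sroot i = sroot j"
  then have "unit_vec i = unit_vec j" by (metis rt_unit_vec rt_eq_iff)
  then show "i = j" by (metis unit_vec_def zero_neq_one)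
qed

lemma int_span_sroot: "int_span (sroot ` J) = {rt n | n. \<forall>i. i \<notin> J \<longrightarrow> n i = 0}"
proof (intro equalityI subsetI)
  fix x assume "x \<in> int_span (sroot ` J)"
  then obtain T n where T: "finite T" "T \<subseteq> sroot ` J" and x: "x = (\<lambda>h. \<Sum>\<beta>\<in>T. of_int (n \<beta>) * \<beta> h)"
    by (auto simp: int_span_def)
  then obtain K where K: "K \<subseteq> J" "T = sroot ` K" by (meson subset_imageE)
  define m where "m i = (if i \<in> K then n (sroot i) else 0)" for i
  have "x = rt m"
  proof
    fix h
    have "x h = (\<Sum>i\<in>K. of_int (n (sroot i)) * sroot i h)"
      using inj_sroot by (simp add: x K sum.reindex inj_on_subset)
    also have "\<dots> = rt m h"
      unfolding rt_def m_def by (intro sum.mono_neutral_cong_left) auto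
    finally show "x h = rt m h" .
  qed
  then show "x \<in> {rt n | n. \<forall>i. i \<notin> J \<longrightarrow> n i = 0}"
    using K by (auto simp: m_def)
next
  fix x assume "x \<in> {rt n | n. \<forall>i. i \<notin> J \<longrightarrow> n i = 0}"
  then obtain n where n: "x = rt n" "\<And>i. i \<notin> J \<Longrightarrow> n i = 0" by auto
  have "x = (\<lambda>h. \<Sum>\<beta>\<in>sroot ` J. of_int (n (inv sroot \<beta>)) * \<beta> h)"
  proof
    fix h
    have "(\<Sum>\<beta>\<in>sroot ` J. of_int (n (inv sroot \<beta>)) * \<beta> h) = (\<Sum>i\<in>J. of_int (n i) * sroot i h)"
      using inj_sroot by (simp add: sum.reindex inj_on_subset)
    also have "\<dots> = rt n h"
      unfolding rt_def using n by (intro sum.mono_neutral_left) auto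
    finally show "x h = (\<Sum>\<beta>\<in>sroot ` J. of_int (n (inv sroot \<beta>)) * \<beta> h)" by (simp add: n)
  qed
  then show "x \<in> int_span (sroot ` J)"
    unfolding int_span_def
    by (intro CollectI exI[of _ "sroot ` J"] exI[of _ "\<lambda>\<beta>. n (inv sroot \<beta>)"]) auto
qed

lemma nonneg_int_span_sroot: "nonneg_int_span (range sroot) = {rt n | n. \<forall>i. 0 \<le> n i}"
proof (intro equalityI subsetI)
  fix x assume "x \<in> nonneg_int_span (range sroot)"
  then show "x \<in> {rt n | n. \<forall>i. 0 \<le> n i}"
  proof (induction rule: nonneg_int_span_induct)
    case zero
    have "0 = rt 0 \<and> (\<forall>i. 0 \<le> (0 :: 'i \<Rightarrow> int) i)"
      using rt_zero by simp
    then show ?case by blast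
  next
    case (add x y)
    then obtain j n where "x = sroot j" "y = rt n" "\<forall>i. 0 \<le> n i" by auto
    then have "x + y = rt (unit_vec j + n)" "\<forall>i. 0 \<le> (unit_vec j + n) i"
      by (simp_all add: rt_add) (simp add: unit_vec_def)
    then show ?case by blast
  qed
next
  fix x assume "x \<in> {rt n | n. \<forall>i. 0 \<le> n i}"
  then obtain n where n: "x = rt n" "\<forall>i. 0 \<le> n i" by auto
  have "x = (\<lambda>h. \<Sum>\<beta>\<in>range sroot. of_nat (nat (n (inv sroot \<beta>))) * \<beta> h)"
  proof
    fix h
    have "(\<Sum>\<beta>\<in>range sroot. of_nat (nat (n (inv sroot \<beta>))) * \<beta> h) =
        (\<Sum>i\<in>UNIV. of_nat (nat (n i)) * sroot i h)"
      using inj_sroot by (simp add: sum.reindex)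
    also have "\<dots> = rt n h"
      unfolding rt_def using n(2) by (intro sum.cong) (auto simp: of_nat_nat)
    finally show "x h = (\<Sum>\<beta>\<in>range sroot. of_nat (nat (n (inv sroot \<beta>))) * \<beta> h)" by (simp add: n)
  qed
  then show "x \<in> nonneg_int_span (range sroot)"
    unfolding nonneg_int_span_def
    by (intro CollectI exI[of _ "range sroot"] exI[of _ "\<lambda>\<beta>. nat (n (inv sroot \<beta>))"]) auto
qed

end

section \<open>Weights of representations\<close>

text \<open>A common frame for the adjoint representation and \<open>L(\<lambda>)\<close> (with
  \<open>P\<close> and \<open>K\<close> equal to \<open>UNIV\<close>), for modules over
  \<open>\<gg>\<^sub>J + \<hh>\<close> (with \<open>K = J\<close>) and, through
  \<open>flip_rep\<close>, for each of these with \<open>e\<close> and \<open>f\<close>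
  exchanged.\<close>

locale km_rep = kac_moody_algebra smul bracket A H e f coroot sroot + V: vector_space scaleV
  for smul :: "complex \<Rightarrow> 'g::ab_group_add \<Rightarrow> 'g"
    and bracket :: "'g \<Rightarrow> 'g \<Rightarrow> 'g"
    and A :: "int^'i^'i"
    and H :: "'g set"
    and e f coroot :: "'i \<Rightarrow> 'g"
    and sroot :: "'i \<Rightarrow> 'g \<Rightarrow> complex"
    and scaleV :: "complex \<Rightarrow> 'v::ab_group_add \<Rightarrow> 'v" +
  fixes act :: "'g \<Rightarrow> 'v \<Rightarrow> 'v"
    and P :: "'g set"
    and K :: "'i set"
  assumes lie_module: "lie_module smul bracket P scaleV act"
    and P_subalgebra: "lie_subalgebra smul bracket P"
    and H_in_P: "h \<in> H \<Longrightarrow> h \<in> P"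
    and e_in_P: "j \<in> K \<Longrightarrow> e j \<in> P"
    and f_in_P: "j \<in> K \<Longrightarrow> f j \<in> P"
    and P_generated: "P \<subseteq> lie_subalgebra smul bracket hull (H \<union> e ` K \<union> f ` K)"
begin

abbreviation "VW \<equiv> weight_space H scaleV act"

lemma P_bracket: "x \<in> P \<Longrightarrow> y \<in> P \<Longrightarrow> bracket x y \<in> P"
  using P_subalgebra by (simp add: lie_subalgebra_def)

lemma act_add: "x \<in> P \<Longrightarrow> act x (u + v) = act x u + act x v"
  using lie_module
  by (auto simp: lie_module_def Vector_Spaces.linear_def module_hom_def module_hom_axioms_def)

lemma act_scale: "x \<in> P \<Longrightarrow> act x (scaleV c v) = scaleV c (act x v)"
  using lie_module
  by (auto simp: lie_module_def Vector_Spaces.linear_def module_hom_def module_hom_axioms_def)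

lemma act_plus: "x \<in> P \<Longrightarrow> y \<in> P \<Longrightarrow> act (x + y) v = act x v + act y v"
  using lie_module by (auto simp: lie_module_def)

lemma act_smul: "x \<in> P \<Longrightarrow> act (smul c x) v = scaleV c (act x v)"
  using lie_module by (auto simp: lie_module_def)

lemma act_bracket: "x \<in> P \<Longrightarrow> y \<in> P \<Longrightarrow> act (bracket x y) v = act x (act y v) - act y (act x v)"
  using lie_module by (auto simp: lie_module_def)

lemma act_0_right [simp]: "x \<in> P \<Longrightarrow> act x 0 = 0"
  using act_scale[of x 0 0] by simp

lemma zero_in_P: "0 \<in> P"
  using P_subalgebra subspace_0 by (auto simp: lie_subalgebra_def)

lemma act_0_left [simp]: "act 0 v = 0"
  using act_smul[OF zero_in_P, of 0 v] by simp

lemma act_uminus_right: "x \<in> P \<Longrightarrow> act x (- v) = - act x v"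
  using act_scale[of x "-1" v] by simp

lemma act_swap: "x \<in> P \<Longrightarrow> y \<in> P \<Longrightarrow> act x (act y v) = act y (act x v) + act (bracket x y) v"
  by (simp add: act_bracket)

lemma act_span:
  assumes x: "x \<in> P" and B: "\<And>b. b \<in> B \<Longrightarrow> act x b \<in> V.span B'" and v: "v \<in> V.span B"
  shows "act x v \<in> V.span B'"
  using v
proof (induction rule: V.span_induct_alt)
  case base
  then show ?case using x by (simp add: V.span_zero)
next
  case (step c b v)
  then show ?case using x B by (simp add: act_add act_scale V.span_add V.span_scale)
qed

lemma act_power_0: "x \<in> P \<Longrightarrow> (act x ^^ n) 0 = 0"
  by (induction n) auto

lemma act_power_add: "x \<in> P \<Longrightarrow> (act x ^^ n) (u + v) = (act x ^^ n) u + (act x ^^ n) v"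
  by (induction n) (auto simp: act_add)

lemma act_power_scale: "x \<in> P \<Longrightarrow> (act x ^^ n) (scaleV c v) = scaleV c ((act x ^^ n) v)"
  by (induction n) (auto simp: act_scale)

lemma act_power_mono: "x \<in> P \<Longrightarrow> (act x ^^ m) v = 0 \<Longrightarrow> m \<le> n \<Longrightarrow> (act x ^^ n) v = 0"
proof (induction n)
  case (Suc n)
  then show ?case by (cases "m = Suc n") auto
qed auto

lemma weight_space_subspace: "V.subspace (VW \<mu>)"
  by (intro V.subspaceI)
    (auto simp: weight_space_def H_in_P act_add act_scale V.scale_right_distrib V.scale_left_commute)

lemma weight_spaceD: "v \<in> VW \<mu> \<Longrightarrow> h \<in> H \<Longrightarrow> act h v = scaleV (\<mu> h) v"
  by (simp add: weight_space_def)

lemma act_weight: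
  assumes x: "x \<in> P" "x \<in> GW \<beta>" and v: "v \<in> VW \<mu>"
  shows "act x v \<in> VW (\<mu> + \<beta>)"
proof -
  have "act h (act x v) = scaleV ((\<mu> + \<beta>) h) (act x v)" if h: "h \<in> H" for h
  proof -
    have "act h (act x v) = act x (act h v) + act (bracket h x) v"
      using x h H_in_P by (intro act_swap) auto
    also have "bracket h x = smul (\<beta> h) x" using x(2) h by (simp add: weight_space_def)
    finally show ?thesis
      using x(1) weight_spaceD[OF v h] by (simp add: act_scale act_smul V.scale_left_distrib)
  qed
  then show ?thesis by (simp add: weight_space_def)
qed

lemma e_weight_vector: "e j \<in> GW (sroot j)"
  by (simp add: weight_space_def bracket_e)

lemma f_weight_vector: "f j \<in> GW (- sroot j)"
  by (simp add: weight_space_def bracket_f)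

lemma e_weight: "j \<in> K \<Longrightarrow> v \<in> VW \<mu> \<Longrightarrow> act (e j) v \<in> VW (\<mu> + sroot j)"
  using act_weight[OF e_in_P e_weight_vector] by simp

lemma f_weight: "j \<in> K \<Longrightarrow> v \<in> VW \<mu> \<Longrightarrow> act (f j) v \<in> VW (\<mu> - sroot j)"
  using act_weight[OF f_in_P f_weight_vector] by simp

lemma coroot_act: "v \<in> VW \<mu> \<Longrightarrow> act (coroot j) v = scaleV (\<mu> (coroot j)) v"
  using weight_spaceD coroot_in_H by blast

lemma e_f_act:
  assumes "j \<in> K" "k \<in> K"
  shows "act (e j) (act (f k) v) = act (f k) (act (e j) v) + (if j = k then act (coroot j) v else 0)"
  using act_swap[OF e_in_P f_in_P, of j k v] assms by (simp add: bracket_e_f)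

section \<open>Reading weights off a spanning set\<close>

text \<open>Choose \<open>h\<close> that separates \<open>\<kappa>\<close> from
  \<open>\<mu>\<close>. The operator \<open>h - \<kappa>(h)\<close> kills the component of weight
  \<open>\<kappa>\<close>, keeps the others in their span and multiplies \<open>v\<close> by a
  nonzero scalar, so \<open>\<kappa>\<close> can be removed from \<open>F\<close>.\<close>

lemma weight_space_disjoint_span:
  assumes "finite F" "F \<subseteq> dual_space smul H" "\<mu> \<in> dual_space smul H" "\<mu> \<notin> F"
    and "v \<in> V.span (\<Union>\<kappa>\<in>F. VW \<kappa>)" "v \<in> VW \<mu>"
  shows "v = 0"
  using assms
proof (induction F arbitrary: v rule: finite_induct)
  case empty
  then show ?case by simp
next
  case (insert \<kappa> F)
  then obtain w0 w where w: "w0 \<in> V.span (VW \<kappa>)" "w \<in> V.span (\<Union>\<kappa>\<in>F. VW \<kappa>)" "v = w0 + w"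
    by (auto simp: V.span_Un)
  have w0: "w0 \<in> VW \<kappa>" using w(1) weight_space_subspace by (metis V.span_eq_iff)
  have "\<kappa> \<noteq> \<mu>" using insert.prems by auto
  then obtain h where h: "h \<in> H" "\<kappa> h \<noteq> \<mu> h"
    using insert.prems dual_space_eqI[of \<kappa> smul H \<mu>] by auto
  have "act h w \<in> V.span (\<Union>\<kappa>\<in>F. VW \<kappa>)"
  proof (rule act_span[OF H_in_P[OF h(1)] _ w(2)])
    fix b assume b: "b \<in> (\<Union>\<kappa>\<in>F. VW \<kappa>)"
    then obtain \<psi> where "b \<in> VW \<psi>" by auto
    then show "act h b \<in> V.span (\<Union>\<kappa>\<in>F. VW \<kappa>)"
      using h(1) b by (simp add: weight_spaceD V.span_base V.span_scale)
  qed
  then have "act h w - scaleV (\<kappa> h) w \<in> V.span (\<Union>\<kappa>\<in>F. VW \<kappa>)"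
    using w(2) by (intro V.span_diff V.span_scale)
  also have "act h w - scaleV (\<kappa> h) w = act h v - scaleV (\<kappa> h) v"
    using weight_spaceD[OF w0 h(1)] H_in_P[OF h(1)] by (simp add: w(3) act_add V.scale_right_distrib)
  also have "\<dots> = scaleV (\<mu> h - \<kappa> h) v"
    using weight_spaceD[OF insert.prems(5) h(1)] by (simp add: V.scale_left_diff_distrib)
  finally have "scaleV (1 / (\<mu> h - \<kappa> h)) (scaleV (\<mu> h - \<kappa> h) v) \<in> V.span (\<Union>\<kappa>\<in>F. VW \<kappa>)"
    by (rule V.span_scale)
  then have "v \<in> V.span (\<Union>\<kappa>\<in>F. VW \<kappa>)" using h(2) by simp
  then show ?case using insert by auto
qed

text \<open>The tool behind every upper bound on weights below: it is enough to know the weights of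
  the members of a spanning set.\<close>

lemma weight_in_span:
  assumes S: "S \<subseteq> dual_space smul H" "\<mu> \<in> dual_space smul H"
    and B: "\<And>b. b \<in> B \<Longrightarrow> b \<noteq> 0 \<Longrightarrow> \<exists>\<kappa>\<in>S. b \<in> VW \<kappa>"
    and v: "v \<in> V.span B" "v \<in> VW \<mu>" "v \<noteq> 0"
  shows "\<mu> \<in> S"
proof (rule ccontr)
  assume \<mu>: "\<mu> \<notin> S"
  have "\<exists>F. finite F \<and> F \<subseteq> S \<and> v \<in> V.span (\<Union>\<kappa>\<in>F. VW \<kappa>)"
    using v(1)
  proof (induction rule: V.span_induct_alt)
    case base
    then show ?case by (intro exI[of _ "{}"]) simp
  next
    case (step c b v)
    then obtain F where F: "finite F" "F \<subseteq> S" "v \<in> V.span (\<Union>\<kappa>\<in>F. VW \<kappa>)" by auto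
    show ?case
    proof (cases "b = 0")
      case True
      then show ?thesis using F by auto
    next
      case False
      then obtain \<kappa> where \<kappa>: "\<kappa> \<in> S" "b \<in> VW \<kappa>" using B step by blast
      have "V.span (\<Union>\<kappa>\<in>F. VW \<kappa>) \<subseteq> V.span (\<Union>\<kappa>\<in>insert \<kappa> F. VW \<kappa>)"
        by (intro V.span_mono) auto
      moreover have "b \<in> V.span (\<Union>\<kappa>\<in>insert \<kappa> F. VW \<kappa>)" using \<kappa>(2) by (intro V.span_base) auto
      ultimately have "scaleV c b + v \<in> V.span (\<Union>\<kappa>\<in>insert \<kappa> F. VW \<kappa>)"
        using F by (intro V.span_add V.span_scale) auto
      then show ?thesis using F \<kappa> by (intro exI[of _ "insert \<kappa> F"]) auto
    qed
  qed
  then obtain F where "finite F" "F \<subseteq> S" "v \<in> V.span (\<Union>\<kappa>\<in>F. VW \<kappa>)" by auto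
  then have "v = 0"
    using weight_space_disjoint_span[of F \<mu> v] S \<mu> v by auto
  then show False using v by simp
qed

text \<open>The elements of \<open>P\<close> that preserve \<open>N\<close> form a subalgebra, so
  the generators decide.\<close>

lemma submodule_generated:
  assumes N: "V.subspace N"
    and h: "\<And>h v. h \<in> H \<Longrightarrow> v \<in> N \<Longrightarrow> act h v \<in> N"
    and e: "\<And>j v. j \<in> K \<Longrightarrow> v \<in> N \<Longrightarrow> act (e j) v \<in> N"
    and f: "\<And>j v. j \<in> K \<Longrightarrow> v \<in> N \<Longrightarrow> act (f j) v \<in> N"
  shows "lie_submodule P scaleV act N"
proof -
  define Q where "Q = {x \<in> P. \<forall>v\<in>N. act x v \<in> N}"
  have subP: "subspace P" using P_subalgebra by (simp add: lie_subalgebra_def)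
  have "lie_subalgebra smul bracket Q"
    unfolding lie_subalgebra_def
  proof (intro conjI ballI)
    show "subspace Q"
      using subP N
      by (intro subspaceI)
        (auto simp: Q_def act_plus act_smul zero_in_P V.subspace_0 V.subspace_add V.subspace_scale
          subspace_add subspace_scale)
    show "bracket x y \<in> Q" if "x \<in> Q" "y \<in> Q" for x y
      using that N by (auto simp: Q_def P_bracket act_bracket V.subspace_diff)
  qed
  moreover have "H \<union> e ` K \<union> f ` K \<subseteq> Q"
    using h e f H_in_P e_in_P f_in_P by (auto simp: Q_def)
  ultimately have "lie_subalgebra smul bracket hull (H \<union> e ` K \<union> f ` K) \<subseteq> Q"
    by (intro hull_minimal)
  then show ?thesis
    using P_generated N by (auto simp: lie_submodule_def Q_def)
qed

lemma flip_rep: "km_rep smul bracket A H f e (\<lambda>i. - coroot i) (\<lambda>i. - sroot i) scaleV act P K"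
proof -
  interpret flip: kac_moody_algebra smul bracket A H f e "\<lambda>i. - coroot i" "\<lambda>i. - sroot i"
    by (rule flip)
  show ?thesis
    by unfold_locales
      (use lie_module P_subalgebra H_in_P e_in_P f_in_P P_generated in \<open>auto simp: Un_ac\<close>)
qed

section \<open>Words in the lowering operators\<close>

definition f_word :: "'i list \<Rightarrow> 'v \<Rightarrow> 'v" where
  "f_word a v = foldr (\<lambda>j. act (f j)) a v"

lemma f_word_simps [simp]: "f_word [] v = v" "f_word (j # a) v = act (f j) (f_word a v)"
  by (simp_all add: f_word_def)

lemma f_word_weight: "set a \<subseteq> K \<Longrightarrow> u \<in> VW \<mu> \<Longrightarrow> f_word a u \<in> VW (\<mu> - rt (cnt a))"
proof (induction a)
  case (Cons j a)
  then have "set a \<subseteq> K" "j \<in> K" by auto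
  then have "act (f j) (f_word a u) \<in> VW (\<mu> - rt (cnt a) - sroot j)"
    using Cons.IH[OF _ Cons.prems(2)] by (intro f_weight)
  moreover have "\<mu> - rt (cnt (j # a)) = \<mu> - rt (cnt a) - sroot j"
    unfolding cnt_Cons rt_add rt_unit_vec by (simp only: diff_diff_eq add.commute)
  ultimately show "f_word (j # a) u \<in> VW (\<mu> - rt (cnt (j # a)))" by (simp only: f_word_simps)
next
  case Nil
  then show "f_word [] u \<in> VW (\<mu> - rt (cnt []))" by simp
qed

text \<open>Moving \<open>e\<^sub>j\<close> to the right through a word leaves coroots, which act on
  the remaining word by scalars, and finally reaches \<open>e\<^sub>j u = 0\<close>.\<close>

lemma singular_span:
  assumes u: "u \<in> VW \<mu>" "\<And>j. j \<in> K \<Longrightarrow> act (e j) u = 0"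
  shows "lie_submodule P scaleV act (V.span {f_word a u | a. set a \<subseteq> K})"
    (is "lie_submodule P scaleV act (V.span ?B)")
proof (rule submodule_generated)
  show "act (f j) v \<in> V.span ?B" if "j \<in> K" "v \<in> V.span ?B" for j v
  proof (rule act_span[OF f_in_P[OF that(1)] _ that(2)])
    fix b assume "b \<in> ?B"
    then obtain a where "b = f_word a u" "set a \<subseteq> K" by auto
    then have "act (f j) b = f_word (j # a) u" "set (j # a) \<subseteq> K" using that by auto
    then show "act (f j) b \<in> V.span ?B" by (intro V.span_base) blast
  qed
  note f_stable = this
  show "act h v \<in> V.span ?B" if "h \<in> H" "v \<in> V.span ?B" for h v
  proof (rule act_span[OF H_in_P[OF that(1)] _ that(2)])
    fix b assume b: "b \<in> ?B"
    then obtain a where "b = f_word a u" "set a \<subseteq> K" by auto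
    then have "b \<in> VW (\<mu> - rt (cnt a))" using u(1) by (simp add: f_word_weight)
    then have "act h b = scaleV ((\<mu> - rt (cnt a)) h) b" using that(1) by (rule weight_spaceD)
    then show "act h b \<in> V.span ?B" using V.span_scale[OF V.span_base[OF b]] by (simp only:)
  qed
  show "act (e j) v \<in> V.span ?B" if "j \<in> K" "v \<in> V.span ?B" for j v
  proof (rule act_span[OF e_in_P[OF that(1)] _ that(2)])
    fix b assume "b \<in> ?B"
    then obtain a where a: "b = f_word a u" "set a \<subseteq> K" by auto
    have "act (e j) (f_word a u) \<in> V.span ?B" using a(2)
    proof (induction a)
      case Nil
      then show ?case using u(2)[OF that(1)] by (simp add: V.span_zero)
    next
      case (Cons k a)
      then have k: "k \<in> K" "set a \<subseteq> K" by auto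
      have "f_word a u \<in> V.span ?B" using k(2) by (intro V.span_base) blast
      then have "act (coroot j) (f_word a u) \<in> V.span ?B"
        unfolding coroot_act[OF f_word_weight[OF k(2) u(1)]] by (rule V.span_scale)
      then have "(if j = k then act (coroot j) (f_word a u) else 0) \<in> V.span ?B"
        using V.span_zero by (cases "j = k") auto
      moreover have "act (f k) (act (e j) (f_word a u)) \<in> V.span ?B"
        using f_stable[OF k(1)] Cons.IH[OF k(2)] .
      ultimately show ?case
        unfolding f_word_simps e_f_act[OF that(1) k(1)] by (intro V.span_add)
    qed
    then show "act (e j) b \<in> V.span ?B" using a by simp
  qed
qed simp

section \<open>Weight strings\<close>

lemma f_power_weight:
  assumes "j \<in> K" "u \<in> VW \<mu>"
  shows "(act (f j) ^^ s) u \<in> VW (\<lambda>h. \<mu> h - of_nat s * sroot j h)"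
proof (induction s)
  case (Suc s)
  have "(\<lambda>h. \<mu> h - of_nat s * sroot j h) - sroot j = (\<lambda>h. \<mu> h - of_nat (Suc s) * sroot j h)"
    by (auto simp: algebra_simps)
  then show ?case using f_weight[OF assms(1) Suc] by simp
qed (use assms in simp)

lemma e_power_weight:
  assumes "j \<in> K" "u \<in> VW \<mu>"
  shows "(act (e j) ^^ s) u \<in> VW (\<lambda>h. \<mu> h + of_nat s * sroot j h)"
proof (induction s)
  case (Suc s)
  have "(\<lambda>h. \<mu> h + of_nat s * sroot j h) + sroot j = (\<lambda>h. \<mu> h + of_nat (Suc s) * sroot j h)"
    by (auto simp: algebra_simps)
  then show ?case using e_weight[OF assms(1) Suc] by simp
qed (use assms in simp)

text \<open>The factor is the sum of \<open>m - 2 * t\<close> over \<open>t \<le> s\<close>, with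
  \<open>m = \<mu>(\<alpha>\<^sub>j\<^sup>\<or>)\<close>: these are the coroot eigenvalues met while
  \<open>e\<^sub>j\<close> moves through the \<open>s + 1\<close> factors
  \<open>f\<^sub>j\<close>.\<close>

lemma e_f_power:
  assumes j: "j \<in> K" and u: "u \<in> VW \<mu>" "act (e j) u = 0"
  shows "act (e j) ((act (f j) ^^ Suc s) u) =
    scaleV (of_nat (Suc s) * (\<mu> (coroot j) - of_nat s)) ((act (f j) ^^ s) u)"
proof (induction s)
  case 0
  then show ?case using e_f_act[OF j j, of u] u coroot_act[OF u(1), of j] f_in_P[OF j] by simp
next
  case (Suc s)
  let ?m = "\<mu> (coroot j)"
  let ?v = "(act (f j) ^^ Suc s) u"
  have "act (e j) (act (f j) ?v) = act (f j) (act (e j) ?v) + act (coroot j) ?v"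
    using e_f_act[OF j j] by simp
  also have "act (coroot j) ?v = scaleV (?m - of_nat (Suc s) * 2) ?v"
    using coroot_act[OF f_power_weight[OF j u(1), of "Suc s"], of j] gcm_diag
    by (simp only: sroot_coroot) simp
  also have "act (f j) (act (e j) ?v) = scaleV (of_nat (Suc s) * (?m - of_nat s)) ?v"
    unfolding Suc using f_in_P[OF j] by (simp add: act_scale)
  also have "\<dots> + scaleV (?m - of_nat (Suc s) * 2) ?v =
      scaleV (of_nat (Suc (Suc s)) * (?m - of_nat (Suc s))) ?v"
    unfolding V.scale_left_distrib[symmetric] by (simp add: algebra_simps)
  finally show ?case by simp
qed

text \<open>Climb from \<open>u\<close> to the last nonzero vector \<open>v\<close>, after
  \<open>q\<close> steps. It is killed by \<open>e\<^sub>j\<close> and has coroot eigenvalue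
  \<open>m + 2 * q\<close>, so the factors of \<open>e_f_power\<close> do not vanish down to depth
  \<open>m + 2 * q\<close> below \<open>v\<close>. The wanted weight lies at depth
  \<open>q + r\<close>.\<close>

lemma weight_string:
  assumes j: "j \<in> K" and u: "u \<in> VW \<mu>" "u \<noteq> 0" and nil: "(act (e j) ^^ k) u = 0"
    and m: "\<mu> (coroot j) = of_nat m" and r: "r \<le> m"
  shows "\<exists>v. v \<noteq> 0 \<and> v \<in> VW (\<lambda>h. \<mu> h - of_nat r * sroot j h)"
proof -
  define l where "l = (LEAST l. (act (e j) ^^ l) u = 0)"
  have l: "(act (e j) ^^ l) u = 0" unfolding l_def using nil by (rule LeastI)
  then obtain q where q: "l = Suc q" using u(2) by (cases l) auto
  have "(act (e j) ^^ q) u \<noteq> 0" using not_less_Least[of q "\<lambda>l. (act (e j) ^^ l) u = 0"] q l_def by simp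
  moreover define v where "v = (act (e j) ^^ q) u"
  ultimately have "v \<noteq> 0" by simp
  have ev: "act (e j) v = 0" using l q by (simp add: v_def)
  define \<nu> where "\<nu> h = \<mu> h + of_nat q * sroot j h" for h
  have v: "v \<in> VW \<nu>" unfolding v_def \<nu>_def using e_power_weight[OF j u(1)] .
  have \<nu>m: "\<nu> (coroot j) = of_nat (m + 2 * q)" by (simp add: \<nu>_def m sroot_coroot gcm_diag)
  have "(act (f j) ^^ s) v \<noteq> 0" if "s \<le> m + 2 * q" for s
    using that
  proof (induction s)
    case (Suc s)
    then have "of_nat (Suc s) * (\<nu> (coroot j) - of_nat s) \<noteq> 0"
      unfolding \<nu>m mult_eq_0_iff right_minus_eq of_nat_eq_iff
      by (auto simp del: of_nat_Suc)
    then have "act (e j) ((act (f j) ^^ Suc s) v) \<noteq> 0"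
      using Suc unfolding e_f_power[OF j v ev] V.scale_eq_0_iff
      by (auto simp del: of_nat_Suc)
    then show ?case using e_in_P[OF j] by (metis act_0_right)
  qed (use \<open>v \<noteq> 0\<close> in simp)
  then have "(act (f j) ^^ (q + r)) v \<noteq> 0" using r by simp
  moreover have "(act (f j) ^^ (q + r)) v \<in> VW (\<lambda>h. \<nu> h - of_nat (q + r) * sroot j h)"
    using f_power_weight[OF j v] .
  moreover have "(\<lambda>h. \<nu> h - of_nat (q + r) * sroot j h) = (\<lambda>h. \<mu> h - of_nat r * sroot j h)"
    by (auto simp: \<nu>_def algebra_simps)
  ultimately show ?thesis by auto
qed

section \<open>Local nilpotency\<close>

text \<open>One application of \<open>f\<^sub>j\<close> to \<open>x v\<close> lowers
  \<open>p\<close> in one term of the Leibniz rule and \<open>q\<close> in the other; once either is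
  0, the product is already 0.\<close>

lemma f_power_leibniz:
  assumes "j \<in> K" "x \<in> P" "(bracket (f j) ^^ p) x = 0" "(act (f j) ^^ q) v = 0"
  shows "(act (f j) ^^ (p + q)) (act x v) = 0"
  using assms(2-)
proof (induction "p + q" arbitrary: p q x v)
  case 0
  then show ?case by simp
next
  case (Suc n)
  note fP = f_in_P[OF assms(1)]
  consider "p = 0" | "q = 0" | p' q' where "p = Suc p'" "q = Suc q'" by (meson not0_implies_Suc)
  then show ?case
  proof cases
    case 3
    have "(act (f j) ^^ (p' + q)) (act (bracket (f j) x) v) = 0"
      using Suc.prems Suc.hyps fP 3 by (intro Suc.hyps(1)) (auto simp: P_bracket funpow_Suc_right simp del: funpow.simps)
    moreover have "(act (f j) ^^ (p + q')) (act x (act (f j) v)) = 0"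
      using Suc.prems Suc.hyps fP 3 by (intro Suc.hyps(1)) (auto simp: funpow_Suc_right simp del: funpow.simps)
    moreover have "p' + q = n" "p + q' = n" "p + q = Suc n" using 3 Suc.hyps by auto
    ultimately show ?thesis
      using fP Suc.prems(1) by (simp add: funpow_Suc_right act_swap[of "f j"] act_power_add del: funpow.simps)
  qed (use Suc.prems fP in \<open>auto simp: act_power_0\<close>)
qed

lemma f_nilpotent_submodule:
  assumes j: "j \<in> K" and nil: "\<And>x. x \<in> P \<Longrightarrow> \<exists>n. (bracket (f j) ^^ n) x = 0"
  shows "lie_submodule P scaleV act {v. \<exists>n. (act (f j) ^^ n) v = 0}"
  unfolding lie_submodule_def
proof (intro conjI ballI)
  note fP = f_in_P[OF j]
  show "V.subspace {v. \<exists>n. (act (f j) ^^ n) v = 0}"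
  proof (rule V.subspaceI)
    show "0 \<in> {v. \<exists>n. (act (f j) ^^ n) v = 0}" using fP by (auto simp: act_power_0)
    fix u v assume "u \<in> {v. \<exists>n. (act (f j) ^^ n) v = 0}" "v \<in> {v. \<exists>n. (act (f j) ^^ n) v = 0}"
    then obtain m n where "(act (f j) ^^ m) u = 0" "(act (f j) ^^ n) v = 0" by auto
    then have "(act (f j) ^^ (max m n)) (u + v) = 0"
      using fP by (simp add: act_power_add act_power_mono[of "f j" m u "max m n"]
          act_power_mono[of "f j" n v "max m n"])
    then show "u + v \<in> {v. \<exists>n. (act (f j) ^^ n) v = 0}" by blast
  next
    fix c v assume "v \<in> {v. \<exists>n. (act (f j) ^^ n) v = 0}"
    then obtain n where "(act (f j) ^^ n) v = 0" by auto
    then have "(act (f j) ^^ n) (scaleV c v) = 0" using fP by (simp add: act_power_scale)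
    then show "scaleV c v \<in> {v. \<exists>n. (act (f j) ^^ n) v = 0}" by blast
  qed
  fix x v assume x: "x \<in> P" and v: "v \<in> {v. \<exists>n. (act (f j) ^^ n) v = 0}"
  then show "act x v \<in> {v. \<exists>n. (act (f j) ^^ n) v = 0}"
    using f_power_leibniz[OF j x] nil[OF x] by blast
qed

end

section \<open>The adjoint representation\<close>

text \<open>Brackets nested to the right, so that stability under each bracket with a generator
  \<open>e\<^sub>i\<close> is built in.\<close>

inductive_set bracket_words :: "('g \<Rightarrow> 'g \<Rightarrow> 'g) \<Rightarrow> ('i \<Rightarrow> 'g) \<Rightarrow> 'g set" for b e where
  single: "e i \<in> bracket_words b e"
| step: "x \<in> bracket_words b e \<Longrightarrow> b (e i) x \<in> bracket_words b e"

context kac_moody_algebra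
begin

lemma adjoint: "km_rep smul bracket A H e f coroot sroot smul bracket UNIV UNIV"
proof -
  have "Vector_Spaces.linear smul smul (bracket x)" for x
    by unfold_locales (simp_all add: bracket_add_right bracket_scale_right)
  then have "lie_module smul bracket UNIV smul bracket"
    unfolding lie_module_def
    by (auto simp: bracket_add_left bracket_scale_left bracket_bracket intro: vector_space_axioms)
  then show ?thesis
    by unfold_locales (use generated in \<open>auto simp: lie_subalgebra_def\<close>)
qed

interpretation ad: km_rep smul bracket A H e f coroot sroot smul bracket UNIV UNIV
  by (rule adjoint)

lemma lie_submodule_adjoint: "lie_submodule UNIV smul bracket N \<longleftrightarrow> lie_ideal smul bracket N"
  by (simp add: lie_submodule_def lie_ideal_def)

lemma H_weight_zero: "h \<in> H \<Longrightarrow> h \<in> GW 0"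
  by (simp add: weight_space_def bracket_H)

lemma bracket_words_weight:
  assumes "x \<in> bracket_words bracket e"
  shows "\<exists>n. (\<forall>i. 0 \<le> n i) \<and> n \<noteq> 0 \<and> x \<in> GW (rt n)"
  using assms
proof (induction rule: bracket_words.induct)
  case (single i)
  have "\<forall>k. 0 \<le> unit_vec i k" "unit_vec i i \<noteq> 0" by (simp_all add: unit_vec_def)
  moreover from this(2) have "unit_vec i \<noteq> 0" by force
  moreover have "e i \<in> GW (rt (unit_vec i))" using ad.e_weight_vector by simp
  ultimately show ?case by blast
next
  case (step x i)
  then obtain n where n: "\<forall>i. 0 \<le> n i" "x \<in> GW (rt n)" by auto
  have "bracket (e i) x \<in> GW (rt (n + unit_vec i))"
    using ad.e_weight[OF _ n(2), of i] by (simp only: rt_add rt_unit_vec UNIV_I)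
  moreover have "\<forall>k. 0 \<le> (n + unit_vec i) k" using n by (simp add: unit_vec_def)
  moreover have "(n + unit_vec i) i > 0" using n(1)[rule_format, of i] by (simp add: unit_vec_def)
  then have "n + unit_vec i \<noteq> 0" by (metis less_irrefl zero_fun_apply)
  ultimately show ?case by blast
qed

text \<open>Coroots arise from \<open>[f\<^sub>i, e\<^sub>i]\<close>, hence the summand
  \<open>H\<close>. They act by scalars on words, and bracketing \<open>H\<close> with
  \<open>e\<^sub>i\<close> only gives multiples of \<open>e\<^sub>i\<close>, so induction on the
  word closes.\<close>

lemma bracket_f_words:
  assumes "x \<in> bracket_words bracket e"
  shows "bracket (f j) x \<in> span (bracket_words bracket e \<union> H)"
  using assms
proof (induction rule: bracket_words.induct)
  case (single i)
  have "coroot i \<in> span (bracket_words bracket e \<union> H)"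
    using coroot_in_H by (intro span_base) auto
  then show ?case by (simp add: bracket_f_e span_neg span_zero)
next
  case (step x i)
  have e: "bracket (e i) y \<in> span (bracket_words bracket e \<union> H)"
    if "y \<in> span (bracket_words bracket e \<union> H)" for y
  proof (rule ad.act_span[OF UNIV_I _ that])
    fix b assume "b \<in> bracket_words bracket e \<union> H"
    then show "bracket (e i) b \<in> span (bracket_words bracket e \<union> H)"
    proof
      assume "b \<in> bracket_words bracket e"
      then show ?thesis by (auto intro: span_base bracket_words.step)
    next
      assume b: "b \<in> H"
      have "bracket (e i) b = smul (- sroot i b) (e i)"
        using bracket_antisym[of "e i" b] bracket_e[OF b] by simp
      also have "\<dots> \<in> span (bracket_words bracket e \<union> H)"
        by (intro span_scale span_base) (auto intro: bracket_words.single)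
      finally show ?thesis .
    qed
  qed
  obtain n where n: "x \<in> GW (rt n)" using bracket_words_weight[OF step.hyps] by auto
  have x: "x \<in> span (bracket_words bracket e \<union> H)"
    using step.hyps by (auto intro: span_base)
  have "bracket (coroot i) x = smul (rt n (coroot i)) x"
    using ad.coroot_act[OF n] .
  then have "bracket (bracket (f j) (e i)) x \<in> span (bracket_words bracket e \<union> H)"
    using x by (simp add: bracket_f_e bracket_uminus_left span_neg span_scale span_zero)
  moreover have "bracket (f j) (bracket (e i) x) =
      bracket (bracket (f j) (e i)) x + bracket (e i) (bracket (f j) x)"
    by (simp add: bracket_bracket)
  ultimately show ?case using e[OF step.IH] by (simp add: span_add)
qed

lemma span_bracket_words_stable:
  assumes "v \<in> span (bracket_words bracket e \<union> H \<union> bracket_words bracket f)"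
  shows "bracket (f j) v \<in> span (bracket_words bracket e \<union> H \<union> bracket_words bracket f)"
proof (rule ad.act_span[OF UNIV_I _ assms])
  let ?T = "bracket_words bracket e \<union> H \<union> bracket_words bracket f"
  fix b assume "b \<in> ?T"
  then consider "b \<in> bracket_words bracket e" | "b \<in> H" | "b \<in> bracket_words bracket f" by auto
  then show "bracket (f j) b \<in> span ?T"
  proof cases
    case 1
    then show ?thesis
      using bracket_f_words[of b j] span_mono[of "bracket_words bracket e \<union> H" ?T] by auto
  next
    case 2
    have "bracket (f j) b = smul (sroot j b) (f j)"
      using bracket_antisym[of "f j" b] bracket_f[OF 2] by simp
    also have "\<dots> \<in> span ?T"
      by (intro span_scale span_base) (auto intro: bracket_words.single)
    finally show ?thesis .
  next
    case 3
    then show ?thesis by (auto intro: span_base bracket_words.step)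
  qed
qed

end

context kac_moody_algebra
begin

interpretation ad: km_rep smul bracket A H e f coroot sroot smul bracket UNIV UNIV
  by (rule adjoint)

text \<open>Stability under the generators makes the span an ideal, in particular a subalgebra, and
  it contains the generators. For the \<open>e\<^sub>j\<close> the stability is that for the
  \<open>f\<^sub>j\<close> in the flipped algebra.\<close>

lemma triangular: "span (bracket_words bracket e \<union> H \<union> bracket_words bracket f) = UNIV"
proof -
  let ?T = "bracket_words bracket e \<union> H \<union> bracket_words bracket f"
  have f: "bracket (f j) v \<in> span ?T" if "v \<in> span ?T" for j v
    using span_bracket_words_stable[OF that] .
  have e: "bracket (e j) v \<in> span ?T" if "v \<in> span ?T" for j v
    using kac_moody_algebra.span_bracket_words_stable[OF flip, of v j] that by (simp add: Un_ac)
  have h: "bracket h v \<in> span ?T" if "h \<in> H" "v \<in> span ?T" for h v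
  proof (rule ad.act_span[OF UNIV_I _ that(2)])
    fix b assume b: "b \<in> ?T"
    have "\<exists>\<mu>. b \<in> GW \<mu>"
      using b H_weight_zero bracket_words_weight[of b]
        kac_moody_algebra.bracket_words_weight[OF flip, of b] by blast
    then obtain \<mu> where "b \<in> GW \<mu>" ..
    then have "bracket h b = smul (\<mu> h) b" using that(1) by (simp add: weight_space_def)
    then show "bracket h b \<in> span ?T" using b by (simp add: span_base span_scale)
  qed
  have "lie_submodule UNIV smul bracket (span ?T)"
    by (rule ad.submodule_generated) (use f e h in auto)
  then have "lie_subalgebra smul bracket (span ?T)"
    by (simp add: lie_submodule_def lie_subalgebra_def)
  moreover have "H \<union> range e \<union> range f \<subseteq> span ?T"
    by (auto intro!: span_base intro: bracket_words.single)
  ultimately have "lie_subalgebra smul bracket hull (H \<union> range e \<union> range f) \<subseteq> span ?T"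
    by (intro hull_minimal)
  then show ?thesis using generated by auto
qed

lemma flip_rt: "kac_moody_algebra.rt (\<lambda>i. - sroot i) n = - rt n"
  using kac_moody_algebra.rt_def[OF flip, of n] by (simp add: rt_def fun_eq_iff sum_negf)

lemma roots_iff: "\<beta> \<in> roots smul bracket H \<longleftrightarrow> \<beta> \<in> dual_space smul H \<and> \<beta> \<noteq> 0 \<and> (\<exists>x. x \<noteq> 0 \<and> x \<in> GW \<beta>)"
  by (auto simp: roots_def weight_space_def)

lemma rt_in_roots_iff: "rt n \<in> roots smul bracket H \<longleftrightarrow> n \<noteq> 0 \<and> (\<exists>x. x \<noteq> 0 \<and> x \<in> GW (rt n))"
  using rt_eq_iff[of n 0] by (auto simp: roots_iff)

lemma root_coordinates:
  assumes "\<beta> \<in> roots smul bracket H"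
  obtains n where "\<beta> = rt n" "n \<noteq> 0" "(\<forall>i. 0 \<le> n i) \<or> (\<forall>i. n i \<le> 0)"
proof -
  obtain x where x: "x \<noteq> 0" "x \<in> GW \<beta>" "\<beta> \<noteq> 0" "\<beta> \<in> dual_space smul H"
    using assms by (auto simp: roots_iff)
  have "\<beta> \<in> {rt n | n. (\<forall>i. 0 \<le> n i) \<or> (\<forall>i. n i \<le> 0)}"
  proof (rule ad.weight_in_span[where v = x])
    show "x \<in> span (bracket_words bracket e \<union> H \<union> bracket_words bracket f)"
      unfolding triangular by simp
    fix b assume "b \<in> bracket_words bracket e \<union> H \<union> bracket_words bracket f"
    then consider "b \<in> bracket_words bracket e" | "b \<in> H" | "b \<in> bracket_words bracket f" by auto
    then show "\<exists>\<kappa>\<in>{rt n | n. (\<forall>i. 0 \<le> n i) \<or> (\<forall>i. n i \<le> 0)}. b \<in> GW \<kappa>"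
    proof cases
      case 1
      then show ?thesis using bracket_words_weight by blast
    next
      case 2
      have "b \<in> GW (rt 0)" "\<forall>i. 0 \<le> (0 :: 'i \<Rightarrow> int) i" using H_weight_zero[OF 2] by simp_all
      then show ?thesis by blast
    next
      case 3
      then obtain n where "\<forall>i. 0 \<le> n i" "b \<in> GW (- rt n)"
        using kac_moody_algebra.bracket_words_weight[OF flip, of b] by (auto simp: flip_rt)
      then have "b \<in> GW (rt (- n))" "\<forall>i. (- n) i \<le> 0" by (simp_all add: rt_uminus)
      then show ?thesis by blast
    qed
  qed (use x in auto)
  then obtain n where n: "\<beta> = rt n" "(\<forall>i. 0 \<le> n i) \<or> (\<forall>i. n i \<le> 0)" by blast
  moreover have "n \<noteq> 0" using x(3) n(1) by auto
  ultimately show ?thesis using that by blast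
qed

lemma e_nonzero: "e i \<noteq> 0"
proof
  assume "e i = 0"
  then have "coroot i = 0" using bracket_e_f[of i i] by simp
  then have "(0::'g) \<in> range coroot" by (metis rangeI)
  then show False using coroot_independent(2) dependent_zero by blast
qed

lemma f_nonzero: "f i \<noteq> 0"
  by (rule kac_moody_algebra.e_nonzero[OF flip])

text \<open>The premise \<open>nz\<close> is there because the string through
  \<open>\<alpha>\<^sub>j\<close> itself passes the weight 0, which is not a root. Nilpotency is a
  premise here since it is derived only below, from the Serre relations.\<close>

lemma rt_root_string:
  assumes root: "rt n \<in> roots smul bracket H"
    and nil: "\<And>x. \<exists>k. (bracket (e j) ^^ k) x = 0"
    and r: "0 \<le> r" "r \<le> pairing A j n" and nz: "n(j := n j - r) \<noteq> 0"
  shows "rt (n(j := n j - r)) \<in> roots smul bracket H"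
proof -
  obtain x where x: "x \<noteq> 0" "x \<in> GW (rt n)" using root by (auto simp: rt_in_roots_iff)
  obtain k where "(bracket (e j) ^^ k) x = 0" using nil by blast
  moreover have "rt n (coroot j) = of_nat (nat (pairing A j n))" using r by (simp add: rt_coroot)
  ultimately obtain v where v: "v \<noteq> 0" "v \<in> GW (\<lambda>h. rt n h - of_nat (nat r) * sroot j h)"
    using ad.weight_string[OF UNIV_I x(2) x(1), where r = "nat r"] r by (metis nat_mono)
  have "(\<lambda>h. rt n h - of_nat (nat r) * sroot j h) = rt (n(j := n j + (- r)))"
    unfolding rt_upd using r by (auto simp: fun_eq_iff)
  then have "v \<in> GW (rt (n(j := n j - r)))" using v by (metis diff_conv_add_uminus)
  then show ?thesis using v nz by (auto simp: rt_in_roots_iff)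
qed

text \<open>
  A vector of positive weight killed by every \<open>f\<^sub>j\<close> generates an ideal all of whose weights are
  positive, hence one that meets \<open>H\<close> trivially.
\<close>

lemma positive_singular_zero:
  assumes x: "x \<in> GW (rt n)" and n: "\<And>i. 0 \<le> n i" "n \<noteq> 0" and f: "\<And>j. bracket (f j) x = 0"
  shows "x = 0"
proof -
  interpret fl: km_rep smul bracket A H f e "\<lambda>i. - coroot i" "\<lambda>i. - sroot i" smul bracket UNIV UNIV
    by (rule ad.flip_rep)
  let ?B = "{fl.f_word a x | a. set a \<subseteq> UNIV}"
  have ideal: "lie_ideal smul bracket (span ?B)"
    using fl.singular_span[OF x] f by (simp add: lie_submodule_adjoint)
  have "h = 0" if h: "h \<in> span ?B" "h \<in> H" for h
  proof (rule ccontr)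
    assume "h \<noteq> 0"
    have "0 \<in> {rt m | m. (\<forall>i. 0 \<le> m i) \<and> m \<noteq> 0}"
    proof (rule ad.weight_in_span[OF _ _ _ h(1) H_weight_zero[OF h(2)] \<open>h \<noteq> 0\<close>])
      fix b assume "b \<in> ?B"
      then obtain a where a: "b = fl.f_word a x" by auto
      have "b \<in> GW (rt n - fl.rt (cnt a))"
        unfolding a using fl.f_word_weight[OF _ x] by simp
      also have "rt n - fl.rt (cnt a) = rt (n + cnt a)"
        by (simp add: flip_rt rt_add)
      finally have "b \<in> GW (rt (n + cnt a))" .
      moreover have "\<forall>i. 0 \<le> (n + cnt a) i" using n by (simp add: cnt_def)
      moreover have "n + cnt a \<noteq> 0"
      proof
        assume eq: "n + cnt a = 0"
        have "n i = 0" for i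
          using fun_cong[OF eq, of i] n(1)[of i] by (simp add: cnt_def)
        then show False using n(2) by (auto simp: fun_eq_iff)
      qed
      ultimately show "\<exists>\<kappa>\<in>{rt m | m. (\<forall>i. 0 \<le> m i) \<and> m \<noteq> 0}. b \<in> GW \<kappa>" by blast
    qed (auto simp: dual_space_zero)
    then obtain m where "rt m = rt 0" "m \<noteq> 0" by auto
    then show False by (metis rt_eq_iff)
  qed
  moreover have "0 \<in> span ?B \<inter> H" using H_subspace subspace_0 span_zero by blast
  ultimately have "span ?B \<inter> H = {0}" by blast
  then have "span ?B = {0}" using ideal_trivial[OF ideal] by simp
  moreover have "x \<in> span ?B"
    by (rule span_base) (force intro: exI[of _ "[]"])
  ultimately show ?thesis by simp
qed

section \<open>Serre relations and nilpotency of the adjoint action\<close>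

text \<open>By \<open>positive_singular_zero\<close> it suffices that every \<open>f\<^sub>l\<close>
  kills the vector. If \<open>l\<close> is neither \<open>i\<close> nor \<open>k\<close>, then
  \<open>f\<^sub>l\<close> commutes with \<open>e\<^sub>i\<close> and \<open>e\<^sub>k\<close>; the
  other two cases are separate computations.\<close>

lemma serre:
  assumes "i \<noteq> k"
  shows "(bracket (e i) ^^ nat (1 - A $ i $ k)) (e k) = 0"
proof -
  interpret fl: km_rep smul bracket A H f e "\<lambda>i. - coroot i" "\<lambda>i. - sroot i" smul bracket UNIV UNIV
    by (rule ad.flip_rep)
  have Aik: "A $ i $ k \<le> 0" using cartan_matrix assms by (simp add: generalized_cartan_matrix_def)
  define N where "N = nat (1 - A $ i $ k)"
  obtain M where N: "N = Suc M" and M: "int M = - A $ i $ k" using Aik by (auto simp: N_def nat_diff_distrib intro!: that[of "nat (- A $ i $ k)"])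
  let ?x = "(bracket (e i) ^^ N) (e k)"
  define n where "n = (unit_vec k)(i := unit_vec k i + int N)"
  have "(\<lambda>h. sroot k h + of_nat N * sroot i h) = rt n"
    unfolding n_def rt_upd rt_unit_vec by (simp add: plus_fun_def)
  then have x: "?x \<in> GW (rt n)" using ad.e_power_weight[OF UNIV_I ad.e_weight_vector] by metis
  have "?x = 0"
  proof (rule positive_singular_zero[OF x])
    show "0 \<le> n l" for l by (simp add: n_def unit_vec_def)
    have "n k \<noteq> 0" using assms by (simp add: n_def unit_vec_def)
    then show "n \<noteq> 0" by force
    show "bracket (f l) ?x = 0" for l
    proof (cases "l = i")
      case True
      have fe: "bracket (f i) (e k) = 0" using assms by (simp add: bracket_f_e)
      \<comment> \<open>With \<open>e\<close> and \<open>f\<close> exchanged, \<open>e k\<close> is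
        singular for the node \<open>i\<close> with coroot eigenvalue \<open>M\<close>, so the
        factor in \<open>e_f_power\<close> vanishes at \<open>s = M\<close>.\<close>
      have "sroot k (- coroot i) = - of_int (A $ i $ k)"
        using fl.sroot_coroot[of k i] by (simp add: neg_eq_iff_add_eq_0 eq_neg_iff_add_eq_0 add.commute)
      also have "\<dots> = of_nat M" using M by (metis of_int_minus of_int_of_nat_eq)
      finally show ?thesis
        unfolding True N using fl.e_f_power[OF UNIV_I ad.e_weight_vector[of k] fe, of M] by simp
    next
      case False
      have comm: "bracket (f l) (bracket (e i) y) = bracket (e i) (bracket (f l) y)" for y
        using ad.act_swap[of "f l" "e i" y] False by (simp add: bracket_f_e)
      have pow: "bracket (f l) ((bracket (e i) ^^ s) y) = (bracket (e i) ^^ s) (bracket (f l) y)" for s y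
        by (induction s) (simp_all add: comm)
      show ?thesis
      proof (cases "l = k")
        case False
        then show ?thesis by (simp add: pow bracket_f_e ad.act_power_0)
      next
        case True
        have "bracket (e i) (coroot k) = smul (- of_int (A $ k $ i)) (e i)"
          using bracket_antisym[of "e i" "coroot k"] bracket_e[OF coroot_in_H, of k i]
          by (simp add: sroot_coroot)
        \<comment> \<open>The first bracket gives a multiple of \<open>e i\<close>, the second gives
          0. There may be one bracket only, namely if \<open>A $ i $ k = 0\<close>; then
          \<open>A $ k $ i = 0\<close> and the multiple is itself 0.\<close>
        then have "(bracket (e i) ^^ Suc M) (coroot k) = 0"
        proof (cases M)
          case 0
          then have "A $ k $ i = 0" using M cartan_matrix by (simp add: generalized_cartan_matrix_def)
          then show ?thesis using \<open>bracket (e i) (coroot k) = _\<close> 0 by simp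
        next
          case (Suc M')
          have "(bracket (e i) ^^ 2) (coroot k) = 0"
            using \<open>bracket (e i) (coroot k) = _\<close>
            by (simp add: numeral_2_eq_2 bracket_uminus_right bracket_scale_right bracket_self)
          then show ?thesis using ad.act_power_mono[of "e i" 2 "coroot k" "Suc M"] Suc by simp
        qed
        then show ?thesis
          unfolding N pow using ad.act_power_scale[of "e i" "Suc M" "-1" "coroot k"]
          by (simp add: True bracket_f_e del: funpow.simps)
      qed
    qed
  qed
  then show ?thesis by (simp add: N_def)
qed

text \<open>By the Leibniz rule the elements on which \<open>ad e\<^sub>i\<close> is nilpotent form
  a subalgebra. It contains \<open>H\<close>, as two brackets suffice, the \<open>e\<^sub>k\<close>
  by \<open>serre\<close>, and the \<open>f\<^sub>k\<close>, because one bracket takes them into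
  \<open>H\<close>.\<close>

lemma ad_e_nilpotent: "\<exists>k. (bracket (e i) ^^ k) x = 0"
proof -
  interpret fl: km_rep smul bracket A H f e "\<lambda>i. - coroot i" "\<lambda>i. - sroot i" smul bracket UNIV UNIV
    by (rule ad.flip_rep)
  define Q where "Q = {x. \<exists>k. (bracket (e i) ^^ k) x = 0}"
  have "lie_subalgebra smul bracket Q"
    unfolding lie_subalgebra_def
  proof (intro conjI ballI)
    show "subspace Q"
    proof (rule subspaceI)
      show "0 \<in> Q" by (auto simp: Q_def ad.act_power_0)
      fix u v assume "u \<in> Q" "v \<in> Q"
      then obtain m n where "(bracket (e i) ^^ m) u = 0" "(bracket (e i) ^^ n) v = 0" by (auto simp: Q_def)
      then have "(bracket (e i) ^^ (max m n)) (u + v) = 0"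
        by (simp add: ad.act_power_add ad.act_power_mono[of "e i" m u "max m n"]
          ad.act_power_mono[of "e i" n v "max m n"])
      then show "u + v \<in> Q" by (auto simp: Q_def)
    next
      fix c v assume "v \<in> Q"
      then show "smul c v \<in> Q" by (auto simp: Q_def ad.act_power_scale)
    qed
    fix x y assume "x \<in> Q" "y \<in> Q"
    then show "bracket x y \<in> Q"
      using fl.f_power_leibniz[OF UNIV_I UNIV_I] by (fastforce simp: Q_def)
  qed
  moreover have "h \<in> Q" if "h \<in> H" for h
  proof -
    have "bracket (e i) h = smul (- sroot i h) (e i)"
      using bracket_antisym[of "e i" h] bracket_e[OF that] by simp
    then have "(bracket (e i) ^^ 2) h = 0"
      by (simp add: numeral_2_eq_2 bracket_uminus_right bracket_scale_right bracket_self)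
    then show ?thesis by (auto simp: Q_def)
  qed
  note H_Q = this
  moreover have "e k \<in> Q" for k
  proof (cases "k = i")
    case True
    have "(bracket (e i) ^^ 1) (e i) = 0" by (simp add: bracket_self)
    then show ?thesis using True unfolding Q_def by blast
  qed (use serre[of i k] in \<open>auto simp: Q_def\<close>)
  moreover have "f k \<in> Q" for k
  proof -
    have "bracket (e i) (f k) \<in> Q"
      using H_Q coroot_in_H ad.act_power_0 by (auto simp: bracket_e_f Q_def)
    then obtain m where "(bracket (e i) ^^ m) (bracket (e i) (f k)) = 0" by (auto simp: Q_def)
    then have "(bracket (e i) ^^ Suc m) (f k) = 0" by (simp add: funpow_Suc_right del: funpow.simps)
    then show ?thesis unfolding Q_def by blast
  qed
  ultimately have "lie_subalgebra smul bracket hull (H \<union> range e \<union> range f) \<subseteq> Q"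
    by (intro hull_minimal) auto
  then show ?thesis using generated by (auto simp: Q_def)
qed

end

context kac_moody_algebra
begin

lemma ad_f_nilpotent: "\<exists>k. (bracket (f i) ^^ k) x = 0"
  by (rule kac_moody_algebra.ad_e_nilpotent[OF flip])

lemma root_down:
  assumes "rt n \<in> roots smul bracket H" "0 \<le> r" "r \<le> pairing A j n" "n(j := n j - r) \<noteq> 0"
  shows "rt (n(j := n j - r)) \<in> roots smul bracket H"
  using rt_root_string[OF assms(1) ad_e_nilpotent assms(2-)] .

lemma root_up:
  assumes "rt n \<in> roots smul bracket H" "0 \<le> r" "r \<le> - pairing A j n" "n(j := n j + r) \<noteq> 0"
  shows "rt (n(j := n j + r)) \<in> roots smul bracket H"
proof -
  have eq: "(- n)(j := (- n) j - r) = - (n(j := n j + r))"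
    by (auto simp: fun_eq_iff)
  have "kac_moody_algebra.rt (\<lambda>i. - sroot i) (- n) \<in> roots smul bracket H"
    using assms(1) by (simp add: flip_rt rt_uminus)
  moreover have "r \<le> pairing A j (- n)"
    using assms(3) pairing_uminus[of A j n] by (simp add: fun_Compl_def)
  moreover have "(- n)(j := (- n) j - r) \<noteq> 0"
    using assms(4) unfolding eq by (metis neg_equal_0_iff_equal)
  ultimately have "kac_moody_algebra.rt (\<lambda>i. - sroot i) ((- n)(j := (- n) j - r)) \<in> roots smul bracket H"
    using kac_moody_algebra.root_down[OF flip] assms(2) by blast
  then show ?thesis unfolding eq flip_rt rt_uminus by simp
qed

end

section \<open>Roots of height one\<close>

lemma sum_Compl_upd:
  fixes n :: "'i::finite \<Rightarrow> int"
  shows "j \<in> J \<Longrightarrow> (\<Sum>i\<in>-J. (n(j := x)) i) = (\<Sum>i\<in>-J. n i)"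
  by (intro sum.cong) auto

lemma nonneg_int_span_uminus: "nonneg_int_span (uminus ` S) = uminus ` nonneg_int_span S"
proof -
  have *: "uminus ` nonneg_int_span S \<subseteq> nonneg_int_span (uminus ` S)" for S :: "('a \<Rightarrow> complex) set"
  proof
    fix x assume "x \<in> uminus ` nonneg_int_span S"
    then obtain y where y: "y \<in> nonneg_int_span S" "x = - y" by auto
    from y(1) have "- y \<in> nonneg_int_span (uminus ` S)"
    proof (induction rule: nonneg_int_span_induct)
      case zero
      show "- 0 \<in> nonneg_int_span (uminus ` S)"
        unfolding minus_zero by (rule zero_in_nonneg_int_span)
    next
      case (add a b)
      have "- a \<in> nonneg_int_span (uminus ` S)"
        using add.hyps(1) by (intro nonneg_int_span_base imageI)
      moreover have "- b \<in> nonneg_int_span (uminus ` S)" by (rule add.IH)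
      ultimately show "- (a + b) \<in> nonneg_int_span (uminus ` S)"
        unfolding minus_add_distrib by (rule nonneg_int_span_add)
    qed
    then show "x \<in> nonneg_int_span (uminus ` S)" using y by simp
  qed
  have "nonneg_int_span (uminus ` S) \<subseteq> uminus ` nonneg_int_span S"
  proof
    fix x assume "x \<in> nonneg_int_span (uminus ` S)"
    then have "- x \<in> nonneg_int_span (uminus ` uminus ` S)" using * by blast
    then have "- x \<in> nonneg_int_span S" by (simp add: image_image)
    then show "x \<in> uminus ` nonneg_int_span S" by (rule image_eqI[rotated]) simp
  qed
  then show ?thesis using * by blast
qed

context kac_moody_algebra
begin

interpretation ad: km_rep smul bracket A H e f coroot sroot smul bracket UNIV UNIV
  by (rule adjoint)

definition grade_one :: "'i set \<Rightarrow> ('i \<Rightarrow> int) set" where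
  "grade_one J = {n. rt n \<in> roots smul bracket H \<and> (\<Sum>i\<in>-J. n i) = 1}"

lemma flip_grade_one:
  "kac_moody_algebra.grade_one smul bracket H (\<lambda>i. - sroot i) J =
     {n. rt (- n) \<in> roots smul bracket H \<and> (\<Sum>i\<in>-J. n i) = 1}"
  by (simp add: kac_moody_algebra.grade_one_def[OF flip] flip_rt rt_uminus)

lemma rt_root_sign:
  assumes "rt n \<in> roots smul bracket H"
  shows "(\<forall>i. 0 \<le> n i) \<or> (\<forall>i. n i \<le> 0)"
  using root_coordinates[OF assms] by (metis rt_eq_iff)

lemma grade_one_nonneg:
  assumes "n \<in> grade_one J"
  shows "0 \<le> n i"
proof -
  have m: "(\<forall>i. 0 \<le> n i) \<or> (\<forall>i. n i \<le> 0)"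
    using assms rt_root_sign by (simp add: grade_one_def)
  have "\<not> (\<forall>i. n i \<le> 0)" using assms sum_nonpos[of "-J" n] by (auto simp: grade_one_def)
  then show ?thesis using m by auto
qed

lemma height_one_roots_eq: "height_one_roots smul bracket H sroot (- J) = rt ` grade_one J"
proof (intro equalityI subsetI)
  fix \<beta> assume \<beta>: "\<beta> \<in> height_one_roots smul bracket H sroot (- J)"
  then obtain n where n: "\<beta> = rt n" by (auto simp: height_one_roots_def elim: root_coordinates)
  have "complex_of_int (\<Sum>i\<in>-J. n i) = of_int 1"
    using \<beta> unfolding n height_one_roots_def by (simp add: height_rt)
  then have "(\<Sum>i\<in>-J. n i) = 1" unfolding of_int_eq_iff .
  then show "\<beta> \<in> rt ` grade_one J"
    using \<beta> n by (auto simp: height_one_roots_def grade_one_def)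
qed (auto simp: height_one_roots_def grade_one_def height_rt simp flip: of_int_sum)

lemma nonzero_if_grade_one: "(\<Sum>i\<in>-J. n i) = 1 \<Longrightarrow> n \<noteq> (0 :: 'i \<Rightarrow> int)"
  by auto

text \<open>Only a coordinate inside \<open>J\<close> changes, so the \<open>I\<close>-height stays
  1 and the result cannot be 0; it is the far end of a root string.\<close>

lemma grade_one_reflect:
  assumes n: "n \<in> grade_one J" and j: "j \<in> J"
  shows "n(j := n j - pairing A j n) \<in> grade_one J"
proof -
  have s: "(\<Sum>i\<in>-J. (n(j := n j - pairing A j n)) i) = 1"
    using n sum_Compl_upd[OF j] by (simp add: grade_one_def)
  note nz = nonzero_if_grade_one[OF s]
  have "rt (n(j := n j - pairing A j n)) \<in> roots smul bracket H"
  proof (cases "0 \<le> pairing A j n")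
    case True
    show ?thesis
      by (rule root_down[OF _ True _ nz]) (use n in \<open>auto simp: grade_one_def\<close>)
  next
    case False
    have "rt (n(j := n j + (- pairing A j n))) \<in> roots smul bracket H"
      by (rule root_up) (use n False nz in \<open>auto simp: grade_one_def simp del: fun_upd_apply\<close>)
    then show ?thesis by simp
  qed
  then show ?thesis using s by (simp add: grade_one_def)
qed

lemma sum_eq_one_unit:
  fixes n :: "'i \<Rightarrow> int"
  assumes nn: "\<And>i. 0 \<le> n i" and s: "(\<Sum>i\<in>-J. n i) = 1"
  shows "\<exists>k. k \<notin> J \<and> (\<lambda>i. if i \<in> J then 0 else n i) = unit_vec k"
proof -
  obtain k where k: "k \<in> -J" "n k \<noteq> 0" using s by (metis sum.neutral zero_neq_one)
  have "(\<Sum>i\<in>-J. n i) = n k + (\<Sum>i\<in>-J-{k}. n i)" using k by (simp add: sum.remove)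
  moreover have "(\<Sum>i\<in>-J-{k}. n i) \<ge> 0" using nn by (simp add: sum_nonneg)
  ultimately have "n k = 1" "(\<Sum>i\<in>-J-{k}. n i) = 0" using s k nn[of k] by linarith+
  then have "\<forall>i\<in>-J-{k}. n i = 0" using nn by (subst (asm) sum_nonneg_eq_0_iff) auto
  then have "(\<lambda>i. if i \<in> J then 0 else n i) = unit_vec k"
    using \<open>n k = 1\<close> k by (auto simp: unit_vec_def fun_eq_iff)
  then show ?thesis using k by auto
qed

text \<open>A substitute, at \<open>I\<close>-height 1, for the symmetry of the roots under
  negation. In \<open>reflection_closed_subset\<close> all \<open>l j\<close> are 0, since pairings
  are those of the roots themselves. The base case is a single simple root: the part of
  \<open>n\<close> outside \<open>J\<close> has total 1, hence is some
  \<open>\<alpha>\<^sub>k\<close>, and \<open>f k\<close> has weight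
  \<open>- \<alpha>\<^sub>k\<close>.\<close>

lemma grade_one_subset_flip:
  assumes ft: "finite_type_on A J"
  shows "grade_one J \<subseteq> {n. rt (- n) \<in> roots smul bracket H \<and> (\<Sum>i\<in>-J. n i) = 1}"
proof (rule reflection_closed_subset[OF cartan_matrix ft, where l = "\<lambda>_. 0"])
  fix m j and r :: int
  assume m: "m \<in> {n. rt (- n) \<in> roots smul bracket H \<and> (\<Sum>i\<in>-J. n i) = 1}" and j: "j \<in> J"
    and r: "0 \<le> r" "r \<le> 0 - pairing A j m"
  have s: "(\<Sum>i\<in>-J. (m(j := m j + r)) i) = 1" using m sum_Compl_upd[OF j] by simp
  have eq: "(- m)(j := (- m) j - r) = - (m(j := m j + r))" by (auto simp: fun_eq_iff)
  have "rt ((- m)(j := (- m) j - r)) \<in> roots smul bracket H"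
  proof (rule root_down)
    show "r \<le> pairing A j (- m)" using r pairing_uminus[of A j m] by (simp add: fun_Compl_def)
    show "(- m)(j := (- m) j - r) \<noteq> 0"
      unfolding eq using nonzero_if_grade_one[OF s] by (metis neg_equal_0_iff_equal)
  qed (use m r in auto)
  then show "m(j := m j + r) \<in> {n. rt (- n) \<in> roots smul bracket H \<and> (\<Sum>i\<in>-J. n i) = 1}"
    unfolding eq using s by simp
next
  fix n j assume "n \<in> grade_one J" "j \<in> J"
  then show "n(j := n j + (0 - pairing A j n)) \<in> grade_one J"
    using grade_one_reflect by simp
next
  fix n assume n: "n \<in> grade_one J"
  then obtain k where k: "k \<notin> J" "(\<lambda>i. if i \<in> J then 0 else n i) = unit_vec k"
    using sum_eq_one_unit[of n J] grade_one_nonneg[OF n] by (auto simp: grade_one_def)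
  have "f k \<in> GW (rt (- unit_vec k))" using ad.f_weight_vector by (simp add: rt_uminus)
  moreover have "- unit_vec k \<noteq> 0"
  proof
    assume "- unit_vec k = 0"
    then have "(- unit_vec k) k = 0" by simp
    then show False by (simp add: unit_vec_def)
  qed
  ultimately have "rt (- unit_vec k) \<in> roots smul bracket H"
    unfolding rt_in_roots_iff using f_nonzero by blast
  moreover have "(\<Sum>i\<in>-J. unit_vec k i) = 1" using k(1) by (simp add: unit_vec_def)
  ultimately show "(\<lambda>i. if i \<in> J then 0 else n i) \<in>
      {n. rt (- n) \<in> roots smul bracket H \<and> (\<Sum>i\<in>-J. n i) = 1}"
    unfolding k(2) by blast
qed (use grade_one_nonneg in auto)

end

context kac_moody_algebra
begin

interpretation ad: km_rep smul bracket A H e f coroot sroot smul bracket UNIV UNIV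
  by (rule adjoint)

lemma grade_one_UNIV: "grade_one UNIV = {}"
  by (simp add: grade_one_def)

lemma flip_grade_one_eq:
  assumes "J = UNIV \<or> finite_type_on A J"
  shows "kac_moody_algebra.grade_one smul bracket H (\<lambda>i. - sroot i) J = grade_one J"
proof (cases "J = UNIV")
  case True
  then show ?thesis by (simp add: flip_grade_one grade_one_def)
next
  case False
  then have ft: "finite_type_on A J" using assms by simp
  have "kac_moody_algebra.grade_one smul bracket H (\<lambda>i. - sroot i) J \<subseteq> grade_one J"
    using kac_moody_algebra.grade_one_subset_flip[OF flip ft]
    by (simp add: flip_rt rt_uminus grade_one_def)
  then show ?thesis using grade_one_subset_flip[OF ft] by (auto simp: flip_grade_one)
qed

lemma finite_grade_one:
  assumes "J = UNIV \<or> finite_type_on A J"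
  shows "finite (grade_one J)"
proof (cases "J = UNIV")
  case False
  then have ft: "finite_type_on A J" using assms by simp
  show ?thesis
  proof (rule reflection_closed_finite[OF cartan_matrix ft])
    show "(\<Sum>i\<in>-J. n i) = 1" if "n \<in> grade_one J" for n
      using that by (simp add: grade_one_def)
  qed (rule grade_one_nonneg grade_one_reflect, assumption+)+
qed (simp add: grade_one_UNIV)

section \<open>Finite-dimensional algebras have matrices of finite type\<close>

text \<open>One nonzero vector per root gives an independent family, by
  \<open>weight_in_span\<close>.\<close>

lemma finite_roots:
  assumes "finite_dimensional smul"
  shows "finite (roots smul bracket H)"
proof -
  let ?R = "roots smul bracket H"
  obtain B where B: "finite B" "span B = UNIV" using assms by (auto simp: finite_dimensional_def)
  have "\<forall>\<beta>\<in>?R. \<exists>x. x \<noteq> 0 \<and> x \<in> GW \<beta>" using roots_iff by blast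
  then obtain x where x: "\<And>\<beta>. \<beta> \<in> ?R \<Longrightarrow> x \<beta> \<noteq> 0 \<and> x \<beta> \<in> GW \<beta>" by metis
  have dual: "?R \<subseteq> dual_space smul H" using roots_iff by blast
  have notin: "x \<beta> \<notin> span (x ` (?R - {\<beta>}))" if "\<beta> \<in> ?R" for \<beta>
  proof
    assume "x \<beta> \<in> span (x ` (?R - {\<beta>}))"
    then have "\<beta> \<in> ?R - {\<beta>}"
    proof (rule ad.weight_in_span[rotated 3])
      show "?R - {\<beta>} \<subseteq> dual_space smul H" "\<beta> \<in> dual_space smul H" using dual that by auto
      show "x \<beta> \<in> GW \<beta>" "x \<beta> \<noteq> 0" using x[OF that] by auto
      show "\<exists>\<kappa>\<in>?R - {\<beta>}. b \<in> GW \<kappa>" if "b \<in> x ` (?R - {\<beta>})" for b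
        using that x by blast
    qed
    then show False by simp
  qed
  have inj: "inj_on x ?R"
  proof (rule inj_onI)
    fix \<beta> \<gamma> assume "\<beta> \<in> ?R" "\<gamma> \<in> ?R" "x \<beta> = x \<gamma>"
    then show "\<beta> = \<gamma>" using notin[of \<beta>] span_base[of "x \<gamma>" "x ` (?R - {\<beta>})"] by fastforce
  qed
  have "independent (x ` ?R)"
    unfolding dependent_def
  proof
    assume "\<exists>a\<in>x ` ?R. a \<in> span (x ` ?R - {a})"
    then obtain \<beta> where \<beta>: "\<beta> \<in> ?R" "x \<beta> \<in> span (x ` ?R - {x \<beta>})" by auto
    have "x ` ?R - {x \<beta>} \<subseteq> x ` (?R - {\<beta>})" by auto
    then show False using notin[OF \<beta>(1)] \<beta>(2) span_mono by blast
  qed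
  then have "finite (x ` ?R)" using independent_span_bound[OF B(1)] B(2) by simp
  then show ?thesis using inj by (rule finite_imageD)
qed

lemma unit_vec_root: "rt (unit_vec i) \<in> roots smul bracket H"
proof -
  have "unit_vec i i \<noteq> 0" by (simp add: unit_vec_def)
  then have "unit_vec i \<noteq> 0" by force
  then show ?thesis
    unfolding rt_in_roots_iff using e_nonzero[of i] ad.e_weight_vector[of i] by auto
qed

text \<open>
  The sum of the positive roots is a witness: the reflection at \<open>j\<close> permutes the positive roots
  that are not multiples of \<open>\<alpha>\<^sub>j\<close>, so these contribute \<open>0\<close> to its pairing with \<open>\<alpha>\<^sub>j\<^sup>\<or>\<close>.
\<close>

lemma finite_dimensional_finite_type:
  assumes "finite_dimensional smul"
  shows "finite_type_on A UNIV"
proof -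
  define R where "R = {n. (\<forall>i. 0 \<le> n i) \<and> rt n \<in> roots smul bracket H}"
  have "rt ` R \<subseteq> roots smul bracket H" by (auto simp: R_def)
  then have fin: "finite R"
    using finite_roots[OF assms] by (intro inj_on_finite[of rt R]) (auto simp: inj_on_def)
  have unit: "unit_vec i \<in> R" for i using unit_vec_root by (auto simp: R_def unit_vec_def)
  have pos: "(\<Sum>n\<in>R. pairing A j n) > 0" for j
  proof -
    define B where "B = {n\<in>R. \<exists>i. i \<noteq> j \<and> n i \<noteq> 0}"
    define s where "s n = n(j := n j - pairing A j n)" for n :: "'i \<Rightarrow> int"
    have ps: "pairing A j (s n) = - pairing A j n" for n
      using pairing_upd[of A j n j "- pairing A j n"] gcm_diag by (simp add: s_def)
    have ss: "s (s n) = n" for n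
      using ps[of n] by (simp add: s_def[of "s n"]) (simp add: s_def)
    have sB: "s n \<in> B" if n: "n \<in> B" for n
    proof -
      obtain i where i: "i \<noteq> j" "n i \<noteq> 0" using n by (auto simp: B_def)
      have "s n i \<noteq> 0" using i by (simp add: s_def)
      then have nz: "s n \<noteq> 0" by force
      have "rt (s n) \<in> roots smul bracket H"
      proof (cases "0 \<le> pairing A j n")
        case True
        then show ?thesis
          using n nz root_down[of n "pairing A j n" j] by (auto simp: B_def R_def s_def)
      next
        case False
        then show ?thesis
          using n nz root_up[of n "- pairing A j n" j] by (auto simp: B_def R_def s_def)
      qed
      \<comment> \<open>The reflection leaves the coordinate at \<open>i\<close> alone; being
        positive, it settles the sign of the whole root.\<close>
      moreover have "s n i > 0"
        using n i by (auto simp: B_def R_def s_def less_le)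
      moreover from this have "\<forall>i. 0 \<le> s n i"
        using rt_root_sign[OF \<open>rt (s n) \<in> roots smul bracket H\<close>] by (meson not_le)
      ultimately show ?thesis using i(1) by (auto simp: B_def R_def less_le)
    qed
    have "(\<Sum>n\<in>B. pairing A j n) = (\<Sum>n\<in>B. pairing A j (s n))"
      by (rule sum.reindex_bij_witness[of _ s s]) (auto simp: ss sB)
    then have B0: "(\<Sum>n\<in>B. pairing A j n) = 0" by (simp add: ps sum_negf)
    have mult: "pairing A j n = 2 * n j \<and> n j > 0" if n: "n \<in> R - B" for n
    proof -
      have off: "n i = 0" if "i \<noteq> j" for i using n that by (auto simp: B_def)
      have "pairing A j n = (\<Sum>i\<in>{j}. A $ j $ i * n i)"
        unfolding pairing_def using off by (intro sum.mono_neutral_right) auto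
      moreover have "n \<noteq> 0" using n rt_in_roots_iff by (auto simp: R_def)
      then have "n j \<noteq> 0" using off by (metis ext zero_fun_apply)
      ultimately show ?thesis using n gcm_diag by (auto simp: R_def less_le)
    qed
    have "(\<Sum>n\<in>R. pairing A j n) = (\<Sum>n\<in>R-B. pairing A j n) + (\<Sum>n\<in>B. pairing A j n)"
      using fin by (intro sum.subset_diff) (auto simp: B_def)
    moreover have "(\<Sum>n\<in>R-B. pairing A j n) > 0"
    proof (rule sum_pos)
      show "R - B \<noteq> {}" using unit[of j] by (auto simp: B_def unit_vec_def)
    qed (use fin mult in auto)
    ultimately show ?thesis using B0 by simp
  qed
  define x where "x i = (\<Sum>n\<in>R. real_of_int (n i))" for i
  have "x i > 0" for i
    unfolding x_def using fin unit
    by (intro sum_pos2[of _ "unit_vec i"]) (auto simp: R_def unit_vec_def)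
  moreover have "(\<Sum>k\<in>UNIV. real_of_int (A $ j $ k) * x k) > 0" for j
  proof -
    have "(\<Sum>k\<in>UNIV. real_of_int (A $ j $ k) * x k) = (\<Sum>k\<in>UNIV. \<Sum>n\<in>R. real_of_int (A $ j $ k * n k))"
      by (simp add: x_def sum_distrib_left)
    also have "\<dots> = (\<Sum>n\<in>R. real_of_int (pairing A j n))"
      by (subst sum.swap) (simp add: pairing_def)
    also have "\<dots> > 0" using pos[of j] by (simp flip: of_int_sum)
    finally show ?thesis .
  qed
  ultimately show ?thesis unfolding finite_type_on_def by blast
qed

end

section \<open>Products of vectors of height one\<close>

context km_rep
begin

text \<open>
  Products \<open>x\<^sub>1 \<dots> x\<^sub>r u\<close> of vectors of height one outside \<open>J\<close>: by the Leibniz rule \<open>e\<^sub>j\<close> with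
  \<open>j \<in> J\<close> moves through the \<open>x\<^sub>t\<close>, and \<open>e\<^sub>i\<close> with \<open>i \<notin> J\<close> is a further factor.
\<close>

definition grade_one_vectors :: "'i set \<Rightarrow> 'g set" where
  "grade_one_vectors J = {x. \<exists>n. (\<Sum>i\<in>-J. n i) = 1 \<and> x \<in> GW (rt n)}"

definition ladder :: "'i set \<Rightarrow> 'v set \<Rightarrow> 'v set" where
  "ladder J U = {foldr act xs u | xs u. set xs \<subseteq> grade_one_vectors J \<and> u \<in> U}"

lemma ladder_stable:
  assumes P: "P = UNIV" and U: "\<And>u j. u \<in> U \<Longrightarrow> j \<in> J \<Longrightarrow> act (e j) u \<in> U"
    and v: "v \<in> V.span (ladder J U)"
  shows "act (e i) v \<in> V.span (ladder J U)"
proof -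
  interpret ad: km_rep smul bracket A H e f coroot sroot smul bracket UNIV UNIV
    by (rule adjoint)
  have P': "x \<in> P" for x using P by simp
  have x_stable: "act x v \<in> V.span (ladder J U)"
    if "x \<in> grade_one_vectors J" "v \<in> V.span (ladder J U)" for x v
  proof (rule act_span[OF P' _ that(2)])
    fix b assume "b \<in> ladder J U"
    then obtain xs u where b: "b = foldr act xs u" "set xs \<subseteq> grade_one_vectors J" "u \<in> U"
      by (auto simp: ladder_def)
    then have "act x b = foldr act (x # xs) u" "set (x # xs) \<subseteq> grade_one_vectors J"
      using that(1) by auto
    then have "act x b \<in> ladder J U" using b(3) unfolding ladder_def by blast
    then show "act x b \<in> V.span (ladder J U)" by (rule V.span_base)
  qed
  show ?thesis
  proof (cases "i \<in> J")
    case False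
    then have "(\<Sum>k\<in>-J. unit_vec i k) = 1" by (simp add: unit_vec_def)
    then have "e i \<in> grade_one_vectors J"
      using e_weight_vector[of i] unfolding grade_one_vectors_def by (auto intro!: exI[of _ "unit_vec i"])
    then show ?thesis using v by (rule x_stable)
  next
    case True
    have "act (e i) (foldr act xs u) \<in> V.span (ladder J U)"
      if "set xs \<subseteq> grade_one_vectors J" "u \<in> U" for xs u
      using that(1)
    proof (induction xs)
      case Nil
      have "act (e i) u = foldr act [] (act (e i) u)" by simp
      then have "act (e i) u \<in> ladder J U"
        using U[OF that(2) True] unfolding ladder_def by (metis (mono_tags, lifting) Nil mem_Collect_eq)
      then show ?case by (auto intro: V.span_base)
    next
      case (Cons x xs)
      then have x: "x \<in> grade_one_vectors J" "set xs \<subseteq> grade_one_vectors J" by auto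
      then obtain n where n: "(\<Sum>i\<in>-J. n i) = 1" "x \<in> GW (rt n)"
        by (auto simp: grade_one_vectors_def)
      have "bracket (e i) x \<in> GW (rt (n + unit_vec i))"
        using ad.e_weight[OF UNIV_I n(2), of i] unfolding rt_add rt_unit_vec .
      moreover have "(\<Sum>k\<in>-J. (n + unit_vec i) k) = 1"
        using n(1) True by (simp add: sum.distrib unit_vec_def)
      ultimately have "bracket (e i) x \<in> grade_one_vectors J"
        unfolding grade_one_vectors_def by blast
      moreover have "foldr act xs u \<in> V.span (ladder J U)"
        using x(2) that(2) unfolding ladder_def by (intro V.span_base) blast
      ultimately have "act (bracket (e i) x) (foldr act xs u) \<in> V.span (ladder J U)"
        by (rule x_stable)
      moreover have "act x (act (e i) (foldr act xs u)) \<in> V.span (ladder J U)"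
        using x_stable[OF x(1) Cons.IH[OF x(2)]] .
      ultimately show ?case
        using act_swap[OF P' P', of "e i" x "foldr act xs u"] by (simp add: V.span_add)
    qed
    then show ?thesis
      by (intro act_span[OF P' _ v]) (auto simp: ladder_def)
  qed
qed

text \<open>Members of \<open>grade_one_vectors\<close> may be 0 and then need not have a root as
  weight. A nonzero product has only nonzero factors, so there every weight is a root.\<close>

lemma ladder_weight:
  assumes P: "P = UNIV" and xs: "set xs \<subseteq> grade_one_vectors J" and u: "u \<in> VW \<mu>"
    and nz: "foldr act xs u \<noteq> 0"
  shows "\<exists>\<nu> \<in> nonneg_int_span (rt ` grade_one J). foldr act xs u \<in> VW (\<mu> + \<nu>)"
  using xs nz
proof (induction xs)
  case Nil
  have "foldr act [] u \<in> VW (\<mu> + 0)" using u by simp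
  then show ?case using zero_in_nonneg_int_span by blast
next
  case (Cons x xs)
  then have x: "x \<in> grade_one_vectors J" "act x (foldr act xs u) \<noteq> 0"
    and xs: "set xs \<subseteq> grade_one_vectors J" by auto
  have "foldr act xs u \<noteq> 0" "x \<noteq> 0" using P x(2) by auto
  then obtain \<nu> where \<nu>: "\<nu> \<in> nonneg_int_span (rt ` grade_one J)" "foldr act xs u \<in> VW (\<mu> + \<nu>)"
    using Cons.IH[OF xs] by blast
  obtain n where n: "(\<Sum>i\<in>-J. n i) = 1" "x \<in> GW (rt n)" using x by (auto simp: grade_one_vectors_def)
  then have "n \<in> grade_one J"
    using \<open>x \<noteq> 0\<close> nonzero_if_grade_one[OF n(1)] unfolding grade_one_def rt_in_roots_iff by blast
  then have "rt n + \<nu> \<in> nonneg_int_span (rt ` grade_one J)"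
    using \<nu>(1) by (rule nonneg_int_span_add[OF nonneg_int_span_base[OF imageI]])
  moreover have "act x (foldr act xs u) \<in> VW (\<mu> + \<nu> + rt n)"
    using P by (intro act_weight[OF _ n(2) \<nu>(2)]) simp
  then have "foldr act (x # xs) u \<in> VW (\<mu> + (rt n + \<nu>))" by (simp add: ac_simps)
  ultimately show ?case by blast
qed

end

section \<open>The cone generated by the roots of height one\<close>

context kac_moody_algebra
begin

interpretation ad: km_rep smul bracket A H e f coroot sroot smul bracket UNIV UNIV
  by (rule adjoint)

text \<open>The ladder is built over \<open>U\<close>, the vectors with weight supported on
  \<open>J\<close>. Since \<open>U\<close> contains \<open>H\<close>, the span of the ladder
  contains \<open>H\<close> and all words in the \<open>e\<^sub>i\<close>; by
  \<open>triangular\<close>, only words in the \<open>f\<^sub>i\<close> remain, and their weights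
  are nonpositive.\<close>

lemma positive_root_in_cone:
  assumes n: "\<And>i. 0 \<le> n i" and root: "rt n \<in> roots smul bracket H"
  shows "(\<forall>i. i \<notin> J \<longrightarrow> n i = 0) \<or> rt n \<in> nonneg_int_span (rt ` grade_one J)"
proof -
  define U where "U = {u. \<exists>m. (\<forall>i. i \<notin> J \<longrightarrow> m i = 0) \<and> u \<in> GW (rt m)}"
  have U_e: "bracket (e j) u \<in> U" if u: "u \<in> U" and j: "j \<in> J" for u j
  proof -
    obtain m where m: "\<forall>i. i \<notin> J \<longrightarrow> m i = 0" "u \<in> GW (rt m)" using u by (auto simp: U_def)
    have "bracket (e j) u \<in> GW (rt (m + unit_vec j))"
      using ad.e_weight[OF UNIV_I m(2), of j] unfolding rt_add rt_unit_vec .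
    moreover have "\<forall>i. i \<notin> J \<longrightarrow> (m + unit_vec j) i = 0" using m(1) j by (auto simp: unit_vec_def)
    ultimately show ?thesis unfolding U_def by blast
  qed
  let ?B = "ad.ladder J U"
  have stable: "bracket (e i) v \<in> span ?B" if "v \<in> span ?B" for i v
    using ad.ladder_stable[OF refl U_e that] by simp
  have HU: "h \<in> U" if "h \<in> H" for h
  proof -
    have "h \<in> GW (rt 0)" using H_weight_zero[OF that] by simp
    then show ?thesis unfolding U_def by (intro CollectI exI[of _ 0]) simp
  qed
  have UB: "u \<in> span ?B" if "u \<in> U" for u
  proof -
    have "u = foldr bracket [] u" by simp
    then have "u \<in> ?B" using that unfolding ad.ladder_def by (metis (mono_tags, lifting) empty_set empty_subsetI mem_Collect_eq)
    then show ?thesis by (rule span_base)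
  qed
  have words: "x \<in> span ?B" if "x \<in> bracket_words bracket e" for x
    using that
  proof (induction rule: bracket_words.induct)
    case (single i)
    \<comment> \<open>The letter \<open>e i\<close> is recovered, up to the factor -2, from its
      bracket with \<open>coroot i\<close>, which lies in \<open>U\<close>.\<close>
    have "bracket (e i) (coroot i) \<in> span ?B" using stable[OF UB[OF HU[OF coroot_in_H]]] .
    then have "smul (-1/2) (bracket (e i) (coroot i)) \<in> span ?B" by (rule span_scale)
    moreover have "bracket (e i) (coroot i) = smul (-2) (e i)"
      using bracket_antisym[of "e i" "coroot i"] bracket_e[OF coroot_in_H, of i i]
      by (simp add: sroot_coroot gcm_diag)
    ultimately show ?case by simp
  qed (use stable in auto)
  have "bracket_words bracket e \<union> H \<union> bracket_words bracket f \<subseteq> span (?B \<union> bracket_words bracket f)"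
  proof -
    have "span ?B \<subseteq> span (?B \<union> bracket_words bracket f)" by (intro span_mono) auto
    then show ?thesis using words UB HU span_base[of _ "?B \<union> bracket_words bracket f"] by blast
  qed
  then have full: "span (?B \<union> bracket_words bracket f) = UNIV"
    using triangular span_minimal[OF _ subspace_span] by (metis top.extremum_uniqueI)
  obtain x where x: "x \<noteq> 0" "x \<in> GW (rt n)" and n0: "n \<noteq> 0"
    using root unfolding rt_in_roots_iff by auto
  define S where "S = {rt m | m. \<forall>i. i \<notin> J \<longrightarrow> m i = 0} \<union> {rt m | m. rt m \<in> nonneg_int_span (rt ` grade_one J)}
      \<union> {rt m | m. \<forall>i. m i \<le> 0}"
  have "rt n \<in> S"
  proof (rule ad.weight_in_span[rotated 3, OF _ x(2) x(1)])
    show "x \<in> span (?B \<union> bracket_words bracket f)" unfolding full by simp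
    show "S \<subseteq> dual_space smul H" "rt n \<in> dual_space smul H" by (auto simp: S_def)
    have sumform: "\<exists>m. \<nu> = rt m" if "\<nu> \<in> nonneg_int_span (rt ` grade_one J)" for \<nu>
      using that
    proof (induction rule: nonneg_int_span_induct)
      case zero
      show "\<exists>m. 0 = rt m" using rt_zero by metis
    next
      case (add \<beta> \<nu>)
      then obtain k m where "\<beta> = rt k" "\<nu> = rt m" by blast
      then have "\<beta> + \<nu> = rt (k + m)" by (simp only: rt_add)
      then show "\<exists>m. \<beta> + \<nu> = rt m" by blast
    qed
    fix b assume b: "b \<in> ?B \<union> bracket_words bracket f" "b \<noteq> 0"
    show "\<exists>\<kappa>\<in>S. b \<in> GW \<kappa>"
    proof (cases "b \<in> ?B")
      case True
      then obtain xs u where bu: "b = foldr bracket xs u" "set xs \<subseteq> ad.grade_one_vectors J" "u \<in> U"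
        by (auto simp: ad.ladder_def)
      then obtain m where m: "\<forall>i. i \<notin> J \<longrightarrow> m i = 0" "u \<in> GW (rt m)" by (auto simp: U_def)
      show ?thesis
      proof (cases xs rule: rev_cases)
        case Nil
        then have "b \<in> GW (rt m)" using bu m by simp
        then show ?thesis using m unfolding S_def by blast
      next
        case (snoc zs y)
        \<comment> \<open>The weight of \<open>u\<close>, which may be of any sign on
          \<open>J\<close>, is absorbed by the innermost factor: \<open>bracket y u\<close> is a
          nonzero vector of \<open>I\<close>-height 1, so its weight \<open>m + k\<close> is again a
          generator of the cone.\<close>
        have b': "b = foldr bracket zs (bracket y u)" using bu snoc by simp
        then have nz: "bracket y u \<noteq> 0"
        proof -
          have "foldr bracket zs 0 = 0" by (induction zs) auto
          then show ?thesis using b' b(2) by metis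
        qed
        obtain k where k: "(\<Sum>i\<in>-J. k i) = 1" "y \<in> GW (rt k)"
          using bu(2) snoc by (auto simp: ad.grade_one_vectors_def)
        have yu: "bracket y u \<in> GW (rt (m + k))"
          using ad.act_weight[OF UNIV_I k(2) m(2)] by (simp only: rt_add)
        have one: "(\<Sum>i\<in>-J. (m + k) i) = 1" using k(1) m(1) by (simp add: sum.distrib)
        then have "m + k \<in> grade_one J"
          using nz yu nonzero_if_grade_one[OF one] unfolding grade_one_def rt_in_roots_iff by blast
        moreover obtain \<nu> where \<nu>: "\<nu> \<in> nonneg_int_span (rt ` grade_one J)" "b \<in> GW (rt (m + k) + \<nu>)"
          using ad.ladder_weight[OF refl _ yu, of zs J] bu(2) snoc b' b(2) by auto
        ultimately have cone: "rt (m + k) + \<nu> \<in> nonneg_int_span (rt ` grade_one J)"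
          by (metis nonneg_int_span_add nonneg_int_span_base imageI)
        then obtain l where l: "rt (m + k) + \<nu> = rt l" using sumform by blast
        then have "rt l \<in> S" using cone unfolding S_def l by blast
        then show ?thesis using \<nu>(2) unfolding l by blast
      qed
    next
      case False
      then have "b \<in> bracket_words bracket f" using b by auto
      then obtain m where m: "\<forall>i. 0 \<le> m i" "b \<in> GW (- rt m)"
        using kac_moody_algebra.bracket_words_weight[OF flip, of b] by (auto simp: flip_rt)
      then have "b \<in> GW (rt (- m))" "\<forall>i. (- m) i \<le> 0" by (simp_all add: rt_uminus)
      then show ?thesis unfolding S_def by blast
    qed
  qed
  moreover have "\<not> (\<forall>i. n i \<le> 0)"
  proof
    assume "\<forall>i. n i \<le> 0"
    then have "n i = 0" for i using n[of i] by (metis order_antisym)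
    then show False using n0 by (auto simp: fun_eq_iff)
  qed
  ultimately show ?thesis unfolding S_def by auto
qed

lemma grade_one_positive:
  assumes "n \<in> grade_one J"
  shows "rt n \<in> positive_roots smul bracket H sroot - sub_positive_roots smul bracket H sroot J"
proof -
  have "rt n \<notin> int_span (sroot ` J)"
  proof
    assume "rt n \<in> int_span (sroot ` J)"
    then have "\<forall>i. i \<notin> J \<longrightarrow> n i = 0" by (auto simp: int_span_sroot)
    then have "(\<Sum>i\<in>-J. n i) = 0" by (intro sum.neutral) auto
    then show False using assms by (simp add: grade_one_def)
  qed
  then show ?thesis
    using assms grade_one_nonneg[OF assms]
    by (auto simp: positive_roots_def sub_positive_roots_def sub_roots_def nonneg_int_span_sroot grade_one_def)
qed

lemma cone_generated:
  "nonneg_int_span (rt ` grade_one J) =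
     nonneg_int_span (positive_roots smul bracket H sroot - sub_positive_roots smul bracket H sroot J)"
proof
  show "nonneg_int_span (rt ` grade_one J) \<subseteq>
      nonneg_int_span (positive_roots smul bracket H sroot - sub_positive_roots smul bracket H sroot J)"
    using grade_one_positive by (intro nonneg_int_span_subset) (auto intro: nonneg_int_span_base)
  show "nonneg_int_span (positive_roots smul bracket H sroot - sub_positive_roots smul bracket H sroot J)
      \<subseteq> nonneg_int_span (rt ` grade_one J)"
  proof (rule nonneg_int_span_subset, rule subsetI)
    fix \<beta> assume \<beta>: "\<beta> \<in> positive_roots smul bracket H sroot - sub_positive_roots smul bracket H sroot J"
    then obtain n where n: "\<beta> = rt n" "\<forall>i. 0 \<le> n i"
      by (auto simp: positive_roots_def nonneg_int_span_sroot)
    have root: "rt n \<in> roots smul bracket H" using \<beta> n by (auto simp: positive_roots_def)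
    have "\<not> (\<forall>i. i \<notin> J \<longrightarrow> n i = 0)"
    proof
      assume "\<forall>i. i \<notin> J \<longrightarrow> n i = 0"
      then have "rt n \<in> int_span (sroot ` J)" unfolding int_span_sroot by blast
      then show False using \<beta> n root by (simp add: sub_positive_roots_def sub_roots_def)
    qed
    then show "\<beta> \<in> nonneg_int_span (rt ` grade_one J)"
      using positive_root_in_cone[of n J] n root by blast
  qed
qed

lemma cone_minimal:
  assumes S: "S \<subset> rt ` grade_one J"
  shows "nonneg_int_span S \<noteq> nonneg_int_span (rt ` grade_one J)"
proof
  assume eq: "nonneg_int_span S = nonneg_int_span (rt ` grade_one J)"
  obtain n where n: "n \<in> grade_one J" "rt n \<notin> S" using S by auto
  \<comment> \<open>The three alternatives stand for no summand, one summand, and two or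
    more.\<close>
  have "\<exists>m. x = rt m \<and> (m = 0 \<or> rt m \<in> S \<or> (\<Sum>i\<in>-J. m i) \<ge> 2)" if "x \<in> nonneg_int_span S" for x
    using that
  proof (induction rule: nonneg_int_span_induct)
    case zero
    have "0 = rt 0" by simp
    then show "\<exists>m. 0 = rt m \<and> (m = 0 \<or> rt m \<in> S \<or> (\<Sum>i\<in>-J. m i) \<ge> 2)" by blast
  next
    case (add x y)
    then obtain k where k: "x = rt k" "k \<in> grade_one J" using S by auto
    obtain m where m: "y = rt m" "m = 0 \<or> rt m \<in> S \<or> (\<Sum>i\<in>-J. m i) \<ge> 2" using add by blast
    have "x + y = rt (k + m)" using k m by (simp only: rt_add)
    moreover have "k + m = k \<or> (\<Sum>i\<in>-J. (k + m) i) \<ge> 2"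
    proof (cases "m = 0")
      case False
      have "(\<Sum>i\<in>-J. m i) \<ge> 1"
      proof (cases "rt m \<in> S")
        case True
        then have "m \<in> grade_one J" using S by auto
        then show ?thesis by (simp add: grade_one_def)
      qed (use m False in auto)
      then show ?thesis using k(2) by (simp add: grade_one_def sum.distrib)
    qed simp
    ultimately show "\<exists>m. x + y = rt m \<and> (m = 0 \<or> rt m \<in> S \<or> (\<Sum>i\<in>-J. m i) \<ge> 2)"
      using add.hyps(1) k(1) by metis
  qed
  moreover have "rt n \<in> nonneg_int_span S" unfolding eq using n by (intro nonneg_int_span_base) auto
  ultimately obtain m where "rt n = rt m" "m = 0 \<or> rt m \<in> S \<or> (\<Sum>i\<in>-J. m i) \<ge> 2" by blast
  then show False using n by (auto simp: grade_one_def)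
qed

text \<open>The map \<open>k \<mapsto> k(j := k j - pairing A j k)\<close> is additive, so closure
  of the cone under the reflections at \<open>J\<close> follows from that of its generators.\<close>

lemma cone_coordinates:
  assumes "\<nu> \<in> nonneg_int_span (rt ` grade_one J)"
  shows "\<exists>k. \<nu> = rt k \<and> (\<forall>i. 0 \<le> k i) \<and>
    (\<forall>j\<in>J. rt (k(j := k j - pairing A j k)) \<in> nonneg_int_span (rt ` grade_one J))"
  using assms
proof (induction rule: nonneg_int_span_induct)
  case zero
  have "(0 :: 'i \<Rightarrow> int)(j := 0 j - pairing A j 0) = 0" for j
    by (auto simp: pairing_def)
  then have "0 = rt 0 \<and> (\<forall>i. 0 \<le> (0 :: 'i \<Rightarrow> int) i) \<and>
      (\<forall>j\<in>J. rt (0(j := 0 j - pairing A j 0)) \<in> nonneg_int_span (rt ` grade_one J))"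
    by (simp add: zero_in_nonneg_int_span)
  then show "\<exists>k. 0 = rt k \<and> (\<forall>i. 0 \<le> k i) \<and>
    (\<forall>j\<in>J. rt (k(j := k j - pairing A j k)) \<in> nonneg_int_span (rt ` grade_one J))" by blast
next
  case (add x y)
  then obtain n k where n: "x = rt n" "n \<in> grade_one J" and k: "y = rt k" "\<forall>i. 0 \<le> k i"
      "\<forall>j\<in>J. rt (k(j := k j - pairing A j k)) \<in> nonneg_int_span (rt ` grade_one J)"
    by blast
  have "rt ((n + k)(j := (n + k) j - pairing A j (n + k))) \<in> nonneg_int_span (rt ` grade_one J)"
    if j: "j \<in> J" for j
  proof -
    have "(n + k)(j := (n + k) j - pairing A j (n + k)) =
        n(j := n j - pairing A j n) + k(j := k j - pairing A j k)"
      using pairing_add[of A j n k] by (auto simp: fun_eq_iff plus_fun_def)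
    moreover have "rt (n(j := n j - pairing A j n)) + rt (k(j := k j - pairing A j k))
        \<in> nonneg_int_span (rt ` grade_one J)"
      using k(3) j grade_one_reflect[OF n(2) j]
      by (intro nonneg_int_span_add[OF nonneg_int_span_base[OF imageI]]) blast+
    ultimately show ?thesis by (simp only: rt_add)
  qed
  moreover have "x + y = rt (n + k)" using n k by (simp only: rt_add)
  moreover have "\<forall>i. 0 \<le> (n + k) i" using k(2) grade_one_nonneg[OF n(2)] by simp
  ultimately show "\<exists>k. x + y = rt k \<and> (\<forall>i. 0 \<le> k i) \<and>
    (\<forall>j\<in>J. rt (k(j := k j - pairing A j k)) \<in> nonneg_int_span (rt ` grade_one J))" by blast
qed

end

section \<open>Highest weight modules\<close>

text \<open>
  Applied to a highest weight vector of weight \<open>\<lambda>\<close>, with \<open>l j = \<lambda>(\<alpha>\<^sub>j\<^sup>\<or>)\<close>, the operator \<open>e\<^sub>j\<close> turns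
  the \<open>f\<close>-word \<open>a\<close> into the combination \<open>lower A l j a\<close> of shorter ones, whatever the module.
\<close>

primrec lower :: "int^'i^'i \<Rightarrow> ('i::finite \<Rightarrow> complex) \<Rightarrow> 'i \<Rightarrow> 'i list \<Rightarrow> (complex \<times> 'i list) list" where
  "lower A l j [] = []"
| "lower A l j (k # a) = map (\<lambda>(c, b). (c, k # b)) (lower A l j a) @
     (if j = k then [(l j - of_int (pairing A j (cnt a)), a)] else [])"

text \<open>An entry of the Shapovalov form: for \<open>b\<close> as long as \<open>a\<close>, the
  scalar by which the \<open>e\<close>-word \<open>b\<close>, first letter acting first, takes the
  \<open>f\<close>-word \<open>a\<close> back to the highest weight vector (see
  \<open>e_word_f_word\<close>).\<close>

primrec coef :: "int^'i^'i \<Rightarrow> ('i::finite \<Rightarrow> complex) \<Rightarrow> 'i list \<Rightarrow> 'i list \<Rightarrow> complex" where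
  "coef A l [] a = (if a = [] then 1 else 0)"
| "coef A l (j # b) a = (\<Sum>(c, a')\<leftarrow>lower A l j a. c * coef A l b a')"

lemma lower_set:
  "(c, b) \<in> set (lower A l j a) \<Longrightarrow> j \<in> set a \<and> set b \<subseteq> set a \<and> length a = Suc (length b)"
  by (induction a arbitrary: b) (fastforce split: if_splits)+

lemma coef_nonzero_subset: "coef A l b a \<noteq> 0 \<Longrightarrow> set b \<subseteq> set a"
proof (induction b arbitrary: a)
  case (Cons j b)
  have "\<exists>(c, a')\<in>set (lower A l j a). c * coef A l b a' \<noteq> 0"
  proof (rule ccontr)
    assume "\<not> ?thesis"
    then have zero: "map (\<lambda>(c, a'). c * coef A l b a') (lower A l j a) = map (\<lambda>_. 0) (lower A l j a)"
      by (intro map_cong) auto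
    have "coef A l (j # b) a = 0" unfolding coef.simps zero by simp
    then show False using Cons.prems by contradiction
  qed
  then obtain c a' where a': "(c, a') \<in> set (lower A l j a)" "coef A l b a' \<noteq> 0" by auto
  then show ?case using lower_set[OF a'(1)] Cons.IH[OF a'(2)] by auto
qed simp

section \<open>Weights in terms of the Cartan matrix and the highest weight\<close>

locale hw_rep = km_rep smul bracket A H e f coroot sroot scaleV act P K
  for smul :: "complex \<Rightarrow> 'g::ab_group_add \<Rightarrow> 'g"
    and bracket :: "'g \<Rightarrow> 'g \<Rightarrow> 'g"
    and A :: "int^'i^'i"
    and H :: "'g set"
    and e f coroot :: "'i \<Rightarrow> 'g"
    and sroot :: "'i \<Rightarrow> 'g \<Rightarrow> complex"
    and scaleV :: "complex \<Rightarrow> 'v::ab_group_add \<Rightarrow> 'v"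
    and act :: "'g \<Rightarrow> 'v \<Rightarrow> 'v"
    and P :: "'g set"
    and K :: "'i set" +
  fixes lam :: "'g \<Rightarrow> complex" and v0 :: 'v
  assumes lam_dual: "lam \<in> dual_space smul H"
    and v0_nonzero: "v0 \<noteq> 0"
    and v0_weight: "v0 \<in> weight_space H scaleV act lam"
    and v0_singular: "j \<in> K \<Longrightarrow> act (e j) v0 = 0"
    and simple: "lie_submodule P scaleV act N \<Longrightarrow> N = {0} \<or> N = UNIV"
begin

abbreviation "wts \<equiv> wt smul H scaleV act"

lemma wts_iff: "\<mu> \<in> wts \<longleftrightarrow> \<mu> \<in> dual_space smul H \<and> (\<exists>v. v \<noteq> 0 \<and> v \<in> VW \<mu>)"
  by (auto simp: wt_def weight_space_def)

lemma lam_minus_rt_dual: "lam - rt n \<in> dual_space smul H"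
  using lam_dual by (intro dual_space_diff) simp_all

lemma span_f_words: "V.span {f_word a v0 | a. set a \<subseteq> K} = UNIV"
proof -
  let ?B = "{f_word a v0 | a. set a \<subseteq> K}"
  have "v0 = f_word [] v0" "set [] \<subseteq> K" by auto
  then have "v0 \<in> ?B" by blast
  then have "v0 \<in> V.span ?B" by (rule V.span_base)
  then have "V.span ?B \<noteq> {0}" using v0_nonzero by auto
  then show ?thesis using simple[OF singular_span[OF v0_weight v0_singular]] by blast
qed

lemma wts_eq: "wts = {lam - rt (cnt a) | a. set a \<subseteq> K \<and> f_word a v0 \<noteq> 0}"
proof (intro equalityI subsetI)
  fix \<mu> assume "\<mu> \<in> wts"
  then obtain v where v: "v \<noteq> 0" "v \<in> VW \<mu>" "\<mu> \<in> dual_space smul H" by (auto simp: wts_iff)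
  show "\<mu> \<in> {lam - rt (cnt a) | a. set a \<subseteq> K \<and> f_word a v0 \<noteq> 0}"
  proof (rule weight_in_span[rotated 3, OF _ v(2,1) _ v(3)])
    show "v \<in> V.span {f_word a v0 | a. set a \<subseteq> K}" unfolding span_f_words by simp
    show "{lam - rt (cnt a) | a. set a \<subseteq> K \<and> f_word a v0 \<noteq> 0} \<subseteq> dual_space smul H"
      using lam_minus_rt_dual by auto
    fix b assume "b \<in> {f_word a v0 | a. set a \<subseteq> K}" "b \<noteq> 0"
    then obtain a where a: "b = f_word a v0" "set a \<subseteq> K" by auto
    have "b \<in> VW (lam - rt (cnt a))" unfolding a(1) using f_word_weight[OF a(2) v0_weight] .
    then show "\<exists>\<kappa>\<in>{lam - rt (cnt a) | a. set a \<subseteq> K \<and> f_word a v0 \<noteq> 0}. b \<in> VW \<kappa>"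
      using a \<open>b \<noteq> 0\<close> by blast
  qed
next
  fix \<mu> assume "\<mu> \<in> {lam - rt (cnt a) | a. set a \<subseteq> K \<and> f_word a v0 \<noteq> 0}"
  then obtain a where a: "\<mu> = lam - rt (cnt a)" "set a \<subseteq> K" "f_word a v0 \<noteq> 0" by auto
  then show "\<mu> \<in> wts"
    unfolding wts_iff a(1) using lam_minus_rt_dual f_word_weight[OF a(2) v0_weight] by blast
qed

text \<open>If nonzero, \<open>u\<close> would generate the whole module by simplicity; but what it
  generates has only weights different from \<open>\<lambda>\<close>, and so misses
  \<open>v0\<close>.\<close>

lemma singular_zero:
  assumes u: "u \<in> VW (lam - rt n)" "\<And>j. j \<in> K \<Longrightarrow> act (e j) u = 0"
    and n: "\<And>i. 0 \<le> n i" "n \<noteq> 0"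
  shows "u = 0"
proof (rule ccontr)
  assume "u \<noteq> 0"
  let ?B = "{f_word a u | a. set a \<subseteq> K}"
  have "u = f_word [] u" "set [] \<subseteq> K" by auto
  then have "u \<in> ?B" by blast
  then have "u \<in> V.span ?B" by (rule V.span_base)
  then have full: "V.span ?B = UNIV"
    using simple[OF singular_span[OF u]] \<open>u \<noteq> 0\<close> by blast
  have "lam \<in> {lam - rt m | m. m \<noteq> 0}"
  proof (rule weight_in_span[rotated 3, OF _ v0_weight v0_nonzero _ lam_dual])
    show "v0 \<in> V.span ?B" unfolding full by simp
    show "{lam - rt m | m. m \<noteq> 0} \<subseteq> dual_space smul H" using lam_minus_rt_dual by auto
    fix b assume "b \<in> ?B"
    then obtain a where a: "b = f_word a u" "set a \<subseteq> K" by auto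
    have "lam - rt n - rt (cnt a) = lam - rt (n + cnt a)"
      unfolding rt_add by (simp only: diff_diff_eq)
    then have "b \<in> VW (lam - rt (n + cnt a))"
      unfolding a(1) using f_word_weight[OF a(2) u(1)] by (simp only:)
    moreover have "n + cnt a \<noteq> 0"
    proof
      assume eq: "n + cnt a = 0"
      have "n i = 0" for i
        using fun_cong[OF eq, of i] n(1)[of i] by (simp add: cnt_def)
      then show False using n(2) by (auto simp: fun_eq_iff)
    qed
    ultimately show "\<exists>\<kappa>\<in>{lam - rt m | m. m \<noteq> 0}. b \<in> VW \<kappa>" by blast
  qed
  then obtain m where "lam = lam - rt m" "m \<noteq> 0" by blast
  then have "rt m = rt 0" by simp
  then show False using \<open>m \<noteq> 0\<close> unfolding rt_eq_iff by simp
qed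

lemma e_f_word:
  assumes j: "j \<in> K" and a: "set a \<subseteq> K"
  shows "act (e j) (f_word a v0) =
    (\<Sum>(c, b)\<leftarrow>lower A (\<lambda>i. lam (coroot i)) j a. scaleV c (f_word b v0))"
  using a
proof (induction a)
  case Nil
  then show ?case using v0_singular[OF j] by simp
next
  case (Cons k a)
  let ?l = "\<lambda>i. lam (coroot i)"
  have k: "k \<in> K" "set a \<subseteq> K" using Cons.prems by auto
  have sum: "act (f k) (\<Sum>(c, b)\<leftarrow>L. scaleV c (f_word b v0)) =
      (\<Sum>(c, b)\<leftarrow>map (\<lambda>(c, b). (c, k # b)) L. scaleV c (f_word b v0))" for L
    by (induction L) (auto simp: act_add act_scale f_in_P[OF k(1)])
  have cor: "act (coroot j) (f_word a v0) = scaleV (lam (coroot j) - of_int (pairing A j (cnt a))) (f_word a v0)"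
    using coroot_act[OF f_word_weight[OF k(2) v0_weight], of j] by (simp add: rt_coroot)
  have "act (e j) (f_word (k # a) v0) =
      act (f k) (act (e j) (f_word a v0)) + (if j = k then act (coroot j) (f_word a v0) else 0)"
    using e_f_act[OF j k(1)] by simp
  also have "\<dots> = (\<Sum>(c, b)\<leftarrow>lower A ?l j (k # a). scaleV c (f_word b v0))"
    unfolding Cons.IH[OF k(2)] sum cor by (cases "j = k") simp_all
  finally show ?case .
qed

definition e_word :: "'i list \<Rightarrow> 'v \<Rightarrow> 'v" where
  "e_word b v = fold (\<lambda>j. act (e j)) b v"

lemma e_word_simps [simp]: "e_word [] v = v" "e_word (j # b) v = e_word b (act (e j) v)"
  by (simp_all add: e_word_def)

lemma e_word_linear:
  assumes "set b \<subseteq> K"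
  shows "e_word b 0 = 0" "e_word b (u + v) = e_word b u + e_word b v"
    "e_word b (scaleV c v) = scaleV c (e_word b v)"
  using assms by (induction b arbitrary: u v) (auto simp: act_add act_scale e_in_P)

lemma e_word_f_word:
  assumes "length b = length a" "set b \<subseteq> K" "set a \<subseteq> K"
  shows "e_word b (f_word a v0) = scaleV (coef A (\<lambda>i. lam (coroot i)) b a) v0"
  using assms
proof (induction b arbitrary: a)
  case (Cons j b)
  let ?l = "\<lambda>i. lam (coroot i)"
  have j: "j \<in> K" "set b \<subseteq> K" using Cons.prems by auto
  have sum: "e_word b (\<Sum>(c, a')\<leftarrow>L. scaleV c (f_word a' v0)) =
      scaleV (\<Sum>(c, a')\<leftarrow>L. c * coef A ?l b a') v0" if "set L \<subseteq> set (lower A ?l j a)" for L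
    using that
  proof (induction L)
    case (Cons x L)
    obtain c a' where x: "x = (c, a')" by force
    then have "(c, a') \<in> set (lower A ?l j a)" using Cons.prems by auto
    then have "length b = length a'" "set a' \<subseteq> K"
      using lower_set[of c a' A ?l j a] \<open>length (j # b) = length a\<close> \<open>set a \<subseteq> K\<close> by auto
    then show ?case
      using Cons j \<open>\<And>a. length b = length a \<Longrightarrow> set b \<subseteq> K \<Longrightarrow> set a \<subseteq> K \<Longrightarrow> _ a\<close>
      by (simp add: x e_word_linear V.scale_left_distrib)
  qed (simp add: e_word_linear j)
  show ?case using e_f_word[OF j(1) Cons.prems(3)] sum[OF subset_refl] by simp
qed simp

text \<open>By \<open>singular_zero\<close>, below the highest weight some \<open>e\<^sub>j\<close>
  does not kill the vector; apply such operators until the highest weight is reached.\<close>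

lemma e_word_nonzero:
  assumes "u \<in> VW (lam - rt (cnt a))" "u \<noteq> 0"
  shows "\<exists>b. length b = length a \<and> set b \<subseteq> K \<and> e_word b u \<noteq> 0"
  using assms
proof (induction "length a" arbitrary: a u)
  case 0
  then show ?case by (intro exI[of _ "[]"]) auto
next
  case (Suc n)
  then obtain k a1 where "a = k # a1" by (cases a) auto
  then have "cnt a k > 0" by (simp add: cnt_def)
  then have "cnt a \<noteq> 0" by force
  then obtain j where j: "j \<in> K" "act (e j) u \<noteq> 0"
    using singular_zero[OF Suc.prems(1)] Suc.prems(2) by (auto simp: cnt_def)
  have eq: "lam - rt (cnt a) + sroot j = lam - rt (cnt a - unit_vec j)"
    unfolding rt_diff rt_unit_vec by (simp only: diff_diff_eq2 diff_add_eq)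
  have w: "act (e j) u \<in> VW (lam - rt (cnt a - unit_vec j))"
    using e_weight[OF j(1) Suc.prems(1)] unfolding eq .
  \<comment> \<open>The raised vector makes this a weight of the module, hence by
    \<open>wts_eq\<close> the weight of some word \<open>a'\<close>, one letter shorter, to which
    the induction applies.\<close>
  then have "lam - rt (cnt a - unit_vec j) \<in> wts" using j lam_minus_rt_dual by (auto simp: wts_iff)
  then obtain a' where a': "lam - rt (cnt a - unit_vec j) = lam - rt (cnt a')" by (auto simp: wts_eq)
  then have c: "cnt a - unit_vec j = cnt a'" by simp
  have len: "(\<Sum>i\<in>UNIV. cnt b i) = int (length b)" for b :: "'i list"
  proof (induction b)
    case (Cons k b)
    then show "(\<Sum>i\<in>UNIV. cnt (k # b) i) = int (length (k # b))"
      unfolding cnt_Cons by (simp add: sum.distrib unit_vec_def)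
  qed (simp add: cnt_def)
  have "(\<Sum>i\<in>UNIV. (cnt a - unit_vec j) i) = int (length a) - 1"
    by (simp add: sum_subtractf len unit_vec_def)
  then have "n = length a'" using len[of a'] Suc.hyps(2) unfolding c by simp
  then obtain b where "length b = length a'" "set b \<subseteq> K" "e_word b (act (e j) u) \<noteq> 0"
    using Suc.hyps(1)[of a' "act (e j) u"] w j(2) unfolding a' by blast
  then show ?case
    using j(1) \<open>n = length a'\<close> Suc.hyps(2) by (intro exI[of _ "j # b"]) auto
qed

text \<open>The right-hand side no longer mentions the module, so words in \<open>J\<close> vanish
  in \<open>L(\<lambda>)\<close> exactly when they do in \<open>L\<^sub>J(\<lambda>)\<close>. The
  letters of \<open>b\<close> need not be restricted to \<open>K\<close>:
  \<open>coef_nonzero_subset\<close> does so.\<close>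

lemma f_word_nonzero_iff:
  assumes a: "set a \<subseteq> K"
  shows "f_word a v0 \<noteq> 0 \<longleftrightarrow>
    (\<exists>b. length b = length a \<and> coef A (\<lambda>i. lam (coroot i)) b a \<noteq> 0)"
proof
  assume "f_word a v0 \<noteq> 0"
  then obtain b where "length b = length a" "set b \<subseteq> K" "e_word b (f_word a v0) \<noteq> 0"
    using e_word_nonzero[OF f_word_weight[OF a v0_weight]] by blast
  then show "\<exists>b. length b = length a \<and> coef A (\<lambda>i. lam (coroot i)) b a \<noteq> 0"
    using e_word_f_word[OF _ _ a] by (intro exI[of _ b]) auto
next
  assume "\<exists>b. length b = length a \<and> coef A (\<lambda>i. lam (coroot i)) b a \<noteq> 0"
  then obtain b where b: "length b = length a" "coef A (\<lambda>i. lam (coroot i)) b a \<noteq> 0" by auto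
  have bK: "set b \<subseteq> K" using coef_nonzero_subset[OF b(2)] a by auto
  have "e_word b (f_word a v0) \<noteq> 0"
    using e_word_f_word[OF b(1) bK a] b(2) v0_nonzero by simp
  then show "f_word a v0 \<noteq> 0" using e_word_linear(1)[OF bK] by metis
qed

lemma wts_eq_coef:
  "wts = {lam - rt (cnt a) | a. set a \<subseteq> K \<and>
     (\<exists>b. length b = length a \<and> coef A (\<lambda>i. lam (coroot i)) b a \<noteq> 0)}"
  unfolding wts_eq using f_word_nonzero_iff by blast

section \<open>Strings, reflections and free directions of the set of weights\<close>

lemma e_nilpotent:
  assumes j: "j \<in> K" and u: "u \<in> VW (lam - rt n)"
  shows "\<exists>k. (act (e j) ^^ k) u = 0"
proof -
  \<comment> \<open>After so many steps the coordinate at \<open>j\<close> would be negative, which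
    no weight of the module allows.\<close>
  define k where "k = nat (n j + 1)"
  have eq: "(\<lambda>h. (lam - rt n) h + of_nat k * sroot j h) = lam - rt (n(j := n j + (- int k)))"
    unfolding rt_upd by (auto simp: fun_eq_iff)
  have w: "(act (e j) ^^ k) u \<in> VW (lam - rt (n(j := n j + (- int k))))"
    using e_power_weight[OF j u, of k] unfolding eq .
  have "(act (e j) ^^ k) u = 0"
  proof (rule ccontr)
    assume "(act (e j) ^^ k) u \<noteq> 0"
    then have "lam - rt (n(j := n j + (- int k))) \<in> wts"
      using w lam_minus_rt_dual by (auto simp: wts_iff)
    then obtain a where "n(j := n j + (- int k)) = cnt a" by (auto simp: wts_eq)
    then have "n j - int k = cnt a j" by (metis add_uminus_conv_diff fun_upd_same)
    then show False by (auto simp: k_def cnt_def split: if_splits)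
  qed
  then show ?thesis ..
qed

text \<open>The vectors on which \<open>f\<^sub>j\<close> is nilpotent form a submodule, so they are
  everything or only 0, and \<open>v0\<close> decides. If
  \<open>\<lambda>(\<alpha>\<^sub>j\<^sup>\<or>) = m\<close> is a natural number, then
  \<open>f\<^sub>j\<close> applied \<open>m + 1\<close> times to \<open>v0\<close> gives a singular
  vector, hence 0; otherwise the factors of \<open>e_f_power\<close> never vanish.\<close>

lemma
  assumes P: "P = UNIV" and K: "K = UNIV"
  shows f_nilpotent_iff: "(\<forall>v. \<exists>k. (act (f j) ^^ k) v = 0) \<longleftrightarrow> lam (coroot j) \<in> \<nat>"
    and f_injective: "lam (coroot j) \<notin> \<nat> \<Longrightarrow> v \<noteq> 0 \<Longrightarrow> act (f j) v \<noteq> 0"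
proof -
  have j: "j \<in> K" using K by simp
  let ?N = "{v. \<exists>k. (act (f j) ^^ k) v = 0}"
  have N: "?N = {0} \<or> ?N = UNIV"
    using simple[OF f_nilpotent_submodule[OF j ad_f_nilpotent]] .
  have nonnil: "(act (f j) ^^ k) v0 \<noteq> 0" if "lam (coroot j) \<notin> \<nat>" for k
  proof (induction k)
    case (Suc k)
    have "lam (coroot j) \<noteq> of_nat k" using that by auto
    then have "act (e j) ((act (f j) ^^ Suc k) v0) \<noteq> 0"
      unfolding e_f_power[OF j v0_weight v0_singular[OF j]] using Suc by (simp del: of_nat_Suc)
    then show ?case using e_in_P[OF j] by (metis act_0_right)
  qed (use v0_nonzero in simp)
  have nil: "\<exists>k. (act (f j) ^^ k) v0 = 0" if "lam (coroot j) \<in> \<nat>"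
  proof -
    obtain m where m: "lam (coroot j) = of_nat m" using \<open>lam (coroot j) \<in> \<nat>\<close> by (auto elim: Nats_cases)
    let ?u = "(act (f j) ^^ Suc m) v0"
    define n where "n = (\<lambda>i. 0 :: int)(j := int (Suc m))"
    have "(\<lambda>h. lam h - of_nat (Suc m) * sroot j h) = lam - rt (0(j := 0 j + int (Suc m)))"
      unfolding rt_upd by (auto simp: fun_eq_iff)
    also have "(0 :: 'i \<Rightarrow> int)(j := 0 j + int (Suc m)) = n" by (auto simp: n_def)
    finally have "?u \<in> VW (lam - rt n)" using f_power_weight[OF j v0_weight, of "Suc m"] by metis
    moreover have "act (e k) ?u = 0" if k: "k \<in> K" for k
    proof (cases "k = j")
      case True
      then show ?thesis using e_f_power[OF j v0_weight v0_singular[OF j], of m] by (simp add: m)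
    next
      case False
      have "act (e k) ((act (f j) ^^ s) v0) = 0" for s
        using e_f_act[OF k j] False f_in_P[OF j] v0_singular[OF k] by (induction s) simp_all
      then show ?thesis .
    qed
    moreover have "0 \<le> n i" for i by (simp add: n_def)
    moreover have "n j \<noteq> 0" by (simp add: n_def)
    then have "n \<noteq> 0" by force
    ultimately have "?u = 0" by (rule singular_zero)
    then show ?thesis ..
  qed
  show "(\<forall>v. \<exists>k. (act (f j) ^^ k) v = 0) \<longleftrightarrow> lam (coroot j) \<in> \<nat>"
  proof
    assume "lam (coroot j) \<in> \<nat>"
    then have "v0 \<in> ?N" using nil by simp
    then have "?N = UNIV" using N v0_nonzero by auto
    then show "\<forall>v. \<exists>k. (act (f j) ^^ k) v = 0" by auto
  qed (use nonnil in blast)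
  assume "lam (coroot j) \<notin> \<nat>" "v \<noteq> 0"
  then have "v0 \<notin> ?N" using nonnil by simp
  then have "?N = {0}" using N by auto
  show "act (f j) v \<noteq> 0"
  proof
    assume "act (f j) v = 0"
    then have "(act (f j) ^^ 1) v = 0" by simp
    then have "v \<in> ?N" by blast
    then show False using \<open>?N = {0}\<close> \<open>v \<noteq> 0\<close> by auto
  qed
qed

definition depths :: "('i \<Rightarrow> int) set" where
  "depths = {n. lam - rt n \<in> wts}"

lemma wts_depths: "wts = {lam - rt n | n. n \<in> depths}"
  unfolding depths_def using wts_eq by blast

lemma depths_nonneg: "n \<in> depths \<Longrightarrow> 0 \<le> n i"
  by (auto simp: depths_def wts_eq cnt_def)

lemma zero_in_depths: "0 \<in> depths"
proof -
  have "lam - rt 0 \<in> wts"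
    unfolding wts_eq using v0_nonzero by (intro CollectI exI[of _ "[]"]) simp
  then show ?thesis by (simp only: depths_def mem_Collect_eq)
qed

lemma depths_vector:
  assumes "n \<in> depths"
  obtains u where "u \<noteq> 0" "u \<in> VW (lam - rt n)"
  using assms by (auto simp: depths_def wts_iff)

lemma depthsI: "u \<noteq> 0 \<Longrightarrow> u \<in> VW (lam - rt n) \<Longrightarrow> n \<in> depths"
  using lam_minus_rt_dual by (auto simp: depths_def wts_iff)

lemma depths_string:
  assumes j: "j \<in> K" and n: "n \<in> depths" and l: "lam (coroot j) = of_int l"
    and r: "0 \<le> r" "r \<le> l - pairing A j n"
  shows "n(j := n j + r) \<in> depths"
proof -
  obtain u where u: "u \<noteq> 0" "u \<in> VW (lam - rt n)" using n by (rule depths_vector)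
  obtain k where k: "(act (e j) ^^ k) u = 0" using e_nilpotent[OF j u(2)] by blast
  have "(lam - rt n) (coroot j) = of_int (l - pairing A j n)" by (simp add: l rt_coroot)
  also have "\<dots> = of_nat (nat (l - pairing A j n))" using r by simp
  finally obtain v where v: "v \<noteq> 0" "v \<in> VW (\<lambda>h. (lam - rt n) h - of_nat (nat r) * sroot j h)"
    using weight_string[OF j u(2,1) k, where r = "nat r"] r by (metis nat_mono)
  have "(\<lambda>h. (lam - rt n) h - of_nat (nat r) * sroot j h) = lam - rt (n(j := n j + r))"
    unfolding rt_upd using r(1) by (auto simp: fun_eq_iff)
  then show ?thesis using v by (metis depthsI)
qed

text \<open>If the depth increases, this is the end of an ordinary string. Otherwise the string runs
  along \<open>e\<^sub>j\<close>, and the flipped \<open>weight_string\<close> asks for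
  \<open>f\<^sub>j\<close> to be nilpotent on the vector, which \<open>f_nilpotent_iff\<close>
  supplies.\<close>

lemma depths_reflect:
  assumes P: "P = UNIV" and K: "K = UNIV" and n: "n \<in> depths"
    and l: "lam (coroot j) = of_int l" "0 \<le> l"
  shows "n(j := n j + (l - pairing A j n)) \<in> depths"
proof (cases "0 \<le> l - pairing A j n")
  case True
  have "j \<in> K" using K by simp
  then show ?thesis using n l(1) True by (rule depths_string) simp
next
  case False
  interpret fl: km_rep smul bracket A H f e "\<lambda>i. - coroot i" "\<lambda>i. - sroot i" scaleV act P K
    by (rule flip_rep)
  define r where "r = pairing A j n - l"
  have r: "r > 0" using False by (simp add: r_def)
  have j: "j \<in> K" using K by simp
  obtain u where u: "u \<noteq> 0" "u \<in> VW (lam - rt n)" using n by (rule depths_vector)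
  have "lam (coroot j) \<in> \<nat>" using l by (metis Nats_def of_int_of_nat_eq rangeI zero_le_imp_eq_int)
  then obtain k where k: "(act (f j) ^^ k) u = 0" using f_nilpotent_iff[OF P K] by blast
  have "lam - rt n \<in> dual_space smul H" by (rule lam_minus_rt_dual)
  moreover have "smul (-1) (coroot j) = - coroot j" by simp
  ultimately have "(lam - rt n) (- coroot j) = - (lam - rt n) (coroot j)"
    using coroot_in_H[of j] unfolding dual_space_def mem_Collect_eq
    by (metis mult_minus1)
  also have "\<dots> = of_int r" by (simp add: l rt_coroot r_def)
  also have "\<dots> = of_nat (nat r)" using r by simp
  finally obtain v where v: "v \<noteq> 0" "v \<in> VW (\<lambda>h. (lam - rt n) h - of_nat (nat r) * (- sroot j) h)"
    using fl.weight_string[OF j u(2,1) k, where r = "nat r"] by blast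
  have "(\<lambda>h. (lam - rt n) h - of_nat (nat r) * (- sroot j) h) = lam - rt (n(j := n j + (- r)))"
    unfolding rt_upd using r by (auto simp: fun_eq_iff)
  then have "n(j := n j + (- r)) \<in> depths" using v by (metis depthsI)
  then show ?thesis by (simp add: r_def)
qed

lemma depths_add:
  assumes P: "P = UNIV" and K: "K = UNIV" and n: "n \<in> depths" and i: "lam (coroot i) \<notin> \<nat>"
  shows "n(i := n i + int k) \<in> depths"
proof (induction k)
  case (Suc k)
  let ?n = "n(i := n i + int k)"
  have step: "lam - rt ?n - sroot i = lam - rt (?n(i := ?n i + 1))"
    unfolding rt_upd[of ?n] by (auto simp: fun_eq_iff)
  obtain u where u: "u \<noteq> 0" "u \<in> VW (lam - rt ?n)" using Suc by (rule depths_vector)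
  have "act (f i) u \<in> VW (lam - rt (?n(i := ?n i + 1)))"
    using f_weight[OF _ u(2), of i] K unfolding step by simp
  moreover have "act (f i) u \<noteq> 0" using f_injective[OF P K i u(1)] .
  ultimately have "?n(i := ?n i + 1) \<in> depths" by (intro depthsI)
  moreover have "?n(i := ?n i + 1) = n(i := n i + int (Suc k))" by auto
  ultimately show "n(i := n i + int (Suc k)) \<in> depths" by metis
qed (use n in simp)

text \<open>These are the weights without \<open>J\<close>-part from which the descent in
  \<open>reflection_closed_subset\<close> starts.\<close>

lemma depths_orthant:
  assumes P: "P = UNIV" and K: "K = UNIV" and J: "\<And>i. i \<notin> J \<Longrightarrow> lam (coroot i) \<notin> \<nat>"
    and n: "\<And>i. 0 \<le> n i"
  shows "(\<lambda>i. if i \<in> J then 0 else n i) \<in> depths"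
proof -
  have "(\<lambda>i. if i \<in> F then n i else 0) \<in> depths" if "finite F" "F \<subseteq> -J" for F
    using that
  proof (induction F rule: finite_induct)
    case empty
    have "(\<lambda>i. if i \<in> {} then n i else 0) = (0 :: 'i \<Rightarrow> int)" by auto
    then show "(\<lambda>i. if i \<in> {} then n i else 0) \<in> depths" using zero_in_depths by simp
  next
    case (insert k F)
    let ?m = "\<lambda>i. if i \<in> F then n i else 0"
    have "?m(k := ?m k + int (nat (n k))) \<in> depths"
      using insert by (intro depths_add[OF P K] J) auto
    moreover have "?m(k := ?m k + int (nat (n k))) = (\<lambda>i. if i \<in> insert k F then n i else 0)"
      using insert.hyps n by auto
    ultimately show "(\<lambda>i. if i \<in> insert k F then n i else 0) \<in> depths" by simp
  qed
  from this[of "-J"] have "(\<lambda>i. if i \<in> -J then n i else 0) \<in> depths" by simp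
  moreover have "(\<lambda>i. if i \<in> -J then n i else 0) = (\<lambda>i. if i \<in> J then 0 else n i)" by auto
  ultimately show ?thesis by simp
qed

section \<open>The two inclusions of the weight formula\<close>

text \<open>These turn out, in \<open>wt_L_eq\<close>, to be the depths of the weights of
  \<open>L\<^sub>J(\<lambda>)\<close>.\<close>

definition top_depths :: "'i set \<Rightarrow> ('i \<Rightarrow> int) set" where
  "top_depths J = {m \<in> depths. \<forall>i. i \<notin> J \<longrightarrow> m i = 0}"

text \<open>The flipped ladder over \<open>U\<close>, the vectors whose depth is supported on
  \<open>J\<close>. As \<open>v0\<close> lies in \<open>U\<close>, stability under the
  \<open>f\<^sub>i\<close> makes the ladder span the module. Its base vector accounts for
  \<open>m\<close>, its factors for \<open>\<nu>\<close>, once \<open>flip_grade_one_eq\<close> has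
  turned flipped roots into members of \<open>grade_one J\<close>.\<close>

lemma wts_subset:
  assumes P: "P = UNIV" and K: "K = UNIV" and ft: "J = UNIV \<or> finite_type_on A J"
    and n: "n \<in> depths"
  shows "\<exists>m\<in>top_depths J. \<exists>\<nu>\<in>nonneg_int_span (rt ` grade_one J). rt n = rt m + \<nu>"
proof -
  interpret fl: km_rep smul bracket A H f e "\<lambda>i. - coroot i" "\<lambda>i. - sroot i" scaleV act P K
    by (rule flip_rep)
  have cone: "nonneg_int_span (fl.rt ` fl.grade_one J) = uminus ` nonneg_int_span (rt ` grade_one J)"
  proof -
    have "fl.rt ` fl.grade_one J = uminus ` rt ` grade_one J"
      unfolding flip_grade_one_eq[OF ft] by (simp add: flip_rt image_image)
    then show ?thesis using nonneg_int_span_uminus by simp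
  qed
  define U where "U = {u. \<exists>m. (\<forall>i. i \<notin> J \<longrightarrow> m i = 0) \<and> u \<in> VW (lam - rt m)}"
  have U_f: "act (f j) u \<in> U" if "u \<in> U" "j \<in> J" for u j
  proof -
    obtain m where m: "\<forall>i. i \<notin> J \<longrightarrow> m i = 0" "u \<in> VW (lam - rt m)" using \<open>u \<in> U\<close> by (auto simp: U_def)
    have "lam - rt m - sroot j = lam - rt (m + unit_vec j)"
      unfolding rt_add rt_unit_vec by (simp only: diff_diff_eq)
    then have "act (f j) u \<in> VW (lam - rt (m + unit_vec j))"
      using f_weight[OF _ m(2), of j] K by (metis UNIV_I)
    moreover have "\<forall>i. i \<notin> J \<longrightarrow> (m + unit_vec j) i = 0"
      using m(1) \<open>j \<in> J\<close> by (auto simp: unit_vec_def)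
    ultimately show ?thesis unfolding U_def by blast
  qed
  let ?B = "fl.ladder J U"
  have "v0 \<in> VW (lam - rt 0)" using v0_weight by simp
  then have "v0 \<in> U" unfolding U_def by (intro CollectI exI[of _ 0]) simp
  moreover have "v0 = foldr act [] v0" by simp
  ultimately have "v0 \<in> ?B"
    unfolding fl.ladder_def by (metis (mono_tags, lifting) empty_set empty_subsetI mem_Collect_eq)
  then have "f_word a v0 \<in> V.span ?B" for a
    by (induction a) (auto intro: V.span_base fl.ladder_stable[OF P U_f])
  then have "V.span {f_word a v0 | a. set a \<subseteq> K} \<subseteq> V.span ?B"
    by (intro V.span_minimal) auto
  then have full: "V.span ?B = UNIV" unfolding span_f_words by auto
  obtain u where u: "u \<noteq> 0" "u \<in> VW (lam - rt n)" using n by (rule depths_vector)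
  define S where "S = {lam - rt m - \<nu> | m \<nu>. m \<in> top_depths J \<and> \<nu> \<in> nonneg_int_span (rt ` grade_one J)}"
  have "lam - rt n \<in> S"
  proof (rule weight_in_span[rotated 3, OF _ u(2,1) _ lam_minus_rt_dual])
    show "u \<in> V.span ?B" unfolding full by simp
    show "S \<subseteq> dual_space smul H"
    proof
      fix \<kappa> assume "\<kappa> \<in> S"
      then obtain m \<nu> where "\<kappa> = lam - rt m - \<nu>" "\<nu> \<in> nonneg_int_span (rt ` grade_one J)"
        by (auto simp: S_def)
      moreover from this obtain k where "\<nu> = rt k" using cone_coordinates by blast
      ultimately show "\<kappa> \<in> dual_space smul H"
        using dual_space_diff[OF lam_minus_rt_dual rt_in_dual] by simp
    qed
    fix b assume "b \<in> ?B" and b0: "b \<noteq> 0"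
    then obtain xs w where b: "b = foldr act xs w" "set xs \<subseteq> fl.grade_one_vectors J" "w \<in> U"
      by (auto simp: fl.ladder_def)
    obtain m where m: "\<forall>i. i \<notin> J \<longrightarrow> m i = 0" "w \<in> VW (lam - rt m)" using b(3) by (auto simp: U_def)
    have "foldr act xs 0 = 0" using P by (induction xs) auto
    then have "w \<noteq> 0" using b0 b(1) by metis
    then have "m \<in> top_depths J" using m depthsI by (auto simp: top_depths_def)
    moreover obtain \<nu> where \<nu>: "\<nu> \<in> nonneg_int_span (rt ` grade_one J)" "b \<in> VW (lam - rt m + - \<nu>)"
      using fl.ladder_weight[OF P b(2) m(2)] b0 b(1) unfolding cone by blast
    ultimately have "lam - rt m - \<nu> \<in> S" unfolding S_def by blast
    moreover have "b \<in> VW (lam - rt m - \<nu>)"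
      using \<nu>(2) by (simp only: add_uminus_conv_diff)
    ultimately show "\<exists>\<kappa>\<in>S. b \<in> VW \<kappa>" by blast
  qed
  then obtain m \<nu> where m: "m \<in> top_depths J" "\<nu> \<in> nonneg_int_span (rt ` grade_one J)"
    "lam - rt n = lam - rt m - \<nu>" unfolding S_def by blast
  have "rt n = lam - (lam - rt n)" by simp
  also have "\<dots> = rt m + \<nu>" unfolding m(3) by simp
  finally have "rt n = rt m + \<nu>" .
  then show ?thesis using m by blast
qed

text \<open>The set \<open>D\<close> of all such sums is closed under the reflections at
  \<open>J\<close>: on \<open>m\<close> they act as in \<open>depths_reflect\<close>, on
  \<open>k\<close> linearly as in \<open>cone_coordinates\<close>, and the two changes add up to the
  reflection of \<open>m + k\<close>. Hence \<open>reflection_closed_subset\<close> applies, with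
  \<open>depths_orthant\<close> as its base.\<close>

lemma depths_superset:
  assumes P: "P = UNIV" and K: "K = UNIV" and ft: "J = UNIV \<or> finite_type_on A J"
    and J: "J = integrable_nodes coroot lam"
    and m: "m \<in> top_depths J" and k: "rt k \<in> nonneg_int_span (rt ` grade_one J)"
  shows "m + k \<in> depths"
proof (cases "J = UNIV")
  case True
  then have "rt k \<in> nonneg_int_span {}" using k by (simp add: grade_one_UNIV)
  then have "rt k = 0" by (auto simp: nonneg_int_span_iff)
  then have "k = 0" using rt_eq_iff[of k 0] by simp
  then show ?thesis using m by (simp add: top_depths_def)
next
  case False
  then have ft: "finite_type_on A J" using ft by simp
  define D where "D = {m + k | m k. m \<in> top_depths J \<and> rt k \<in> nonneg_int_span (rt ` grade_one J)}"
  have "\<exists>l. lam (coroot j) = of_int l \<and> 0 \<le> l" if j: "j \<in> J" for j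
  proof -
    have "lam (coroot j) \<in> \<nat>" using j by (simp add: J integrable_nodes_def)
    then obtain n where "lam (coroot j) = of_nat n" by (auto elim: Nats_cases)
    then show ?thesis by (intro exI[of _ "int n"]) simp
  qed
  then obtain l where l: "\<And>j. j \<in> J \<Longrightarrow> lam (coroot j) = of_int (l j) \<and> 0 \<le> l j" by metis
  have kD: "(\<forall>i. 0 \<le> k i) \<and> (\<forall>j\<in>J. rt (k(j := k j - pairing A j k)) \<in> nonneg_int_span (rt ` grade_one J))"
    if "rt k \<in> nonneg_int_span (rt ` grade_one J)" for k
    using cone_coordinates[OF that] by auto
  have "D \<subseteq> depths"
  proof (rule reflection_closed_subset[OF cartan_matrix ft, where l = l])
    show "n(j := n j + r) \<in> depths"
      if "n \<in> depths" "j \<in> J" "0 \<le> r" "r \<le> l j - pairing A j n" for n j r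
      using depths_string[of j n "l j" r] that l[OF \<open>j \<in> J\<close>] K by simp
    have nonneg: "0 \<le> n i" if "n \<in> D" for n i
      using that kD depths_nonneg by (fastforce simp: D_def top_depths_def)
    then show "0 \<le> n j" if "n \<in> D" "j \<in> J" for n j using that by blast
    show "(\<lambda>i. if i \<in> J then 0 else n i) \<in> depths" if "n \<in> D" for n
      using nonneg[OF that] by (intro depths_orthant[OF P K]) (auto simp: J integrable_nodes_def)
    fix n j assume "n \<in> D" and j: "j \<in> J"
    then obtain m k where n: "n = m + k" "m \<in> top_depths J" "rt k \<in> nonneg_int_span (rt ` grade_one J)"
      by (auto simp: D_def)
    have "m(j := m j + (l j - pairing A j m)) \<in> top_depths J"
      using n(2) depths_reflect[OF P K, of m j "l j"] l[OF j] j by (auto simp: top_depths_def)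
    moreover have "rt (k(j := k j - pairing A j k)) \<in> nonneg_int_span (rt ` grade_one J)"
      using kD[OF n(3)] j by blast
    moreover have "n(j := n j + (l j - pairing A j n)) =
        m(j := m j + (l j - pairing A j m)) + k(j := k j - pairing A j k)"
      unfolding n(1) using pairing_add[of A j m k] by (auto simp: fun_eq_iff plus_fun_def)
    ultimately show "n(j := n j + (l j - pairing A j n)) \<in> D" unfolding D_def by blast
  qed
  then show ?thesis using m k by (auto simp: D_def)
qed

end

section \<open>From models of the simple modules to the locales\<close>

context kac_moody_algebra
begin

lemma lie_subalgebra_hull: "lie_subalgebra smul bracket (lie_subalgebra smul bracket hull S)"
  by (rule hull_in) (auto simp: lie_subalgebra_def intro: subspace_Inter)

text \<open>The sum is closed under brackets because \<open>H\<close> normalizes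
  \<open>\<gg>\<^sub>J\<close>: for each \<open>h\<close>, the elements of
  \<open>\<gg>\<^sub>J\<close> that \<open>ad h\<close> keeps in \<open>\<gg>\<^sub>J\<close> form a
  subalgebra, and it contains the generators.\<close>

lemma levi_subalgebra_props:
  fixes J :: "'i set"
  defines "P \<equiv> levi_subalgebra smul bracket H e f coroot J"
  shows "lie_subalgebra smul bracket P" "h \<in> H \<Longrightarrow> h \<in> P"
    "j \<in> J \<Longrightarrow> e j \<in> P" "j \<in> J \<Longrightarrow> f j \<in> P"
    "P \<subseteq> lie_subalgebra smul bracket hull (H \<union> e ` J \<union> f ` J)"
proof -
  define G where "G = sub_kac_moody smul bracket e f coroot J"
  have G: "lie_subalgebra smul bracket G"
    unfolding G_def sub_kac_moody_def by (rule lie_subalgebra_hull)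
  then have subG: "subspace G" and bG: "\<And>x y. x \<in> G \<Longrightarrow> y \<in> G \<Longrightarrow> bracket x y \<in> G"
    by (auto simp: lie_subalgebra_def)
  have gens: "e ` J \<union> f ` J \<union> coroot ` J \<subseteq> G"
    unfolding G_def sub_kac_moody_def by (rule hull_subset)
  have HG: "bracket h x \<in> G" if h: "h \<in> H" and x: "x \<in> G" for h x
  proof -
    define Q where "Q = {x \<in> G. bracket h x \<in> G}"
    have "lie_subalgebra smul bracket Q"
      unfolding lie_subalgebra_def
    proof (intro conjI ballI)
      show "subspace Q"
        using subG by (intro subspaceI)
          (auto simp: Q_def bracket_add_right bracket_scale_right subspace_0 subspace_add subspace_scale)
      fix x y assume xy: "x \<in> Q" "y \<in> Q"
      have "bracket h (bracket x y) = bracket (bracket h x) y + bracket x (bracket h y)"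
        by (simp add: bracket_bracket)
      then show "bracket x y \<in> Q" using xy bG subG by (simp add: Q_def subspace_add)
    qed
    moreover have "e ` J \<union> f ` J \<union> coroot ` J \<subseteq> Q"
      using gens h subG
      by (auto simp: Q_def bracket_e bracket_f bracket_H[OF h coroot_in_H] subspace_scale subspace_0 subspace_neg)
    ultimately have "G \<subseteq> Q" unfolding G_def sub_kac_moody_def by (intro hull_minimal)
    then show ?thesis using x by (auto simp: Q_def)
  qed
  have P: "P = {x + h | x h. x \<in> G \<and> h \<in> H}"
    by (simp add: P_def levi_subalgebra_def G_def)
  show "lie_subalgebra smul bracket P"
    unfolding lie_subalgebra_def
  proof (intro conjI ballI)
    show "subspace P" unfolding P by (rule subspace_sums[OF subG H_subspace])
    fix x y assume "x \<in> P" "y \<in> P"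
    then obtain a h b k where x: "x = a + h" "a \<in> G" "h \<in> H" and y: "y = b + k" "b \<in> G" "k \<in> H"
      unfolding P by blast
    have "bracket x y = (bracket a b + bracket h b - bracket k a) + 0"
      using bracket_H[OF x(3) y(3)] bracket_antisym[of a k]
      by (simp add: x(1) y(1) bracket_add_left bracket_add_right)
    moreover have "bracket a b + bracket h b - bracket k a \<in> G"
      using bG HG x y subG by (intro subspace_diff subspace_add) auto
    ultimately show "bracket x y \<in> P"
      unfolding P using subspace_0[OF H_subspace] by blast
  qed
  have GP: "x \<in> P" if "x \<in> G" for x
  proof -
    have "x = x + 0" by simp
    then show ?thesis unfolding P using that subspace_0[OF H_subspace] by blast
  qed
  show "e j \<in> P" "f j \<in> P" if "j \<in> J" using gens that GP by auto
  show "h \<in> P" if "h \<in> H"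
  proof -
    have "h = 0 + h" by simp
    then show ?thesis unfolding P using that subspace_0[OF subG] by blast
  qed
  let ?T = "lie_subalgebra smul bracket hull (H \<union> e ` J \<union> f ` J)"
  have T: "lie_subalgebra smul bracket ?T" by (rule lie_subalgebra_hull)
  have HT: "H \<union> e ` J \<union> f ` J \<subseteq> ?T" by (rule hull_subset)
  have "e ` J \<union> f ` J \<union> coroot ` J \<subseteq> ?T" using HT coroot_in_H by auto
  then have "G \<subseteq> ?T" unfolding G_def sub_kac_moody_def using T by (intro hull_minimal)
  then show "P \<subseteq> ?T"
    using HT T unfolding P lie_subalgebra_def by (auto intro: subspace_add)
qed

lemma hw_repI:
  assumes "km_rep smul bracket A H e f coroot sroot scaleV act P K"
    and "simple_lie_module smul bracket P scaleV act"
    and "highest_weight_module smul bracket H e P K lam scaleV act"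
    and "lam \<in> dual_space smul H"
  shows "\<exists>v0. hw_rep smul bracket A H e f coroot sroot scaleV act P K lam v0"
proof -
  obtain v0 where v0: "v0 \<noteq> 0" "\<forall>h\<in>H. act h v0 = scaleV (lam h) v0" "\<forall>j\<in>K. act (e j) v0 = 0"
    using assms(3) by (auto simp: highest_weight_module_def)
  have "hw_rep smul bracket A H e f coroot sroot scaleV act P K lam v0"
    using assms v0
    by (auto simp: hw_rep_def hw_rep_axioms_def weight_space_def simple_lie_module_def)
  then show ?thesis ..
qed

lemma is_L_hw_rep:
  assumes "is_L smul bracket H e lam scaleV act" "lam \<in> dual_space smul H"
  shows "\<exists>v0. hw_rep smul bracket A H e f coroot sroot scaleV act UNIV UNIV lam v0"
proof (rule hw_repI)
  have mod: "lie_module smul bracket UNIV scaleV act"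
    using assms by (simp add: is_L_def simple_lie_module_def)
  then interpret V: vector_space scaleV by (simp add: lie_module_def)
  show "km_rep smul bracket A H e f coroot sroot scaleV act UNIV UNIV"
    using mod generated by unfold_locales (auto simp: lie_subalgebra_def)
qed (use assms in \<open>auto simp: is_L_def\<close>)

lemma is_L_sub_hw_rep:
  assumes "is_L_sub smul bracket H e f coroot J lam scaleV act" "lam \<in> dual_space smul H"
  shows "\<exists>v0. hw_rep smul bracket A H e f coroot sroot scaleV act
    (levi_subalgebra smul bracket H e f coroot J) J lam v0"
proof (rule hw_repI)
  let ?P = "levi_subalgebra smul bracket H e f coroot J"
  have mod: "lie_module smul bracket ?P scaleV act"
    using assms by (simp add: is_L_sub_def simple_lie_module_def)
  then interpret V: vector_space scaleV by (simp add: lie_module_def)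
  show "km_rep smul bracket A H e f coroot sroot scaleV act ?P J"
    by unfold_locales (use mod levi_subalgebra_props in auto)
qed (use assms in \<open>auto simp: is_L_sub_def\<close>)

lemma wt_L_eq:
  fixes scaleV :: "complex \<Rightarrow> 'v::ab_group_add \<Rightarrow> 'v" and scaleW :: "complex \<Rightarrow> 'w::ab_group_add \<Rightarrow> 'w"
  assumes ft: "J = UNIV \<or> finite_type_on A J" and lam: "lam \<in> dual_space smul H"
    and J: "J = integrable_nodes coroot lam"
    and V: "is_L smul bracket H e lam scaleV actV"
    and W: "is_L_sub smul bracket H e f coroot J lam scaleW actW"
  shows "wt smul H scaleV actV = {\<mu> - \<nu> | \<mu> \<nu>. \<mu> \<in> wt smul H scaleW actW \<and>
    \<nu> \<in> nonneg_int_span (rt ` grade_one J)}"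
proof -
  obtain v0 where "hw_rep smul bracket A H e f coroot sroot scaleV actV UNIV UNIV lam v0"
    using is_L_hw_rep[OF V lam] ..
  then interpret V: hw_rep smul bracket A H e f coroot sroot scaleV actV UNIV UNIV lam v0 .
  obtain w0 where "hw_rep smul bracket A H e f coroot sroot scaleW actW
      (levi_subalgebra smul bracket H e f coroot J) J lam w0"
    using is_L_sub_hw_rep[OF W lam] ..
  then interpret W: hw_rep smul bracket A H e f coroot sroot scaleW actW
    "levi_subalgebra smul bracket H e f coroot J" J lam w0 .
  have supp: "set a \<subseteq> J \<longleftrightarrow> (\<forall>i. i \<notin> J \<longrightarrow> cnt a i = 0)" for a
    by (auto simp: cnt_def count_list_0_iff)
  \<comment> \<open>By \<open>wts_eq_coef\<close> both modules obey the same criterion on words,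
    with letters in \<open>J\<close> for the second. The depth of a word determines its set of
    letters, so depths supported on \<open>J\<close> come from words in \<open>J\<close>.\<close>
  have top: "wt smul H scaleW actW = {lam - rt m | m. m \<in> V.top_depths J}"
  proof (intro equalityI subsetI)
    fix \<mu> assume "\<mu> \<in> wt smul H scaleW actW"
    then obtain a where a: "\<mu> = lam - rt (cnt a)" "set a \<subseteq> J"
      "\<exists>b. length b = length a \<and> coef A (\<lambda>i. lam (coroot i)) b a \<noteq> 0"
      unfolding W.wts_eq_coef by blast
    then have "\<mu> \<in> wt smul H scaleV actV" unfolding V.wts_eq_coef by blast
    then have "cnt a \<in> V.top_depths J"
      using a(1,2) supp by (simp add: V.top_depths_def V.depths_def)
    then show "\<mu> \<in> {lam - rt m | m. m \<in> V.top_depths J}" using a(1) by blast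
  next
    fix \<mu> assume "\<mu> \<in> {lam - rt m | m. m \<in> V.top_depths J}"
    then obtain m where m: "\<mu> = lam - rt m" "\<mu> \<in> wt smul H scaleV actV" "\<forall>i. i \<notin> J \<longrightarrow> m i = 0"
      by (auto simp: V.top_depths_def V.depths_def)
    then obtain a where a: "\<mu> = lam - rt (cnt a)"
      "\<exists>b. length b = length a \<and> coef A (\<lambda>i. lam (coroot i)) b a \<noteq> 0"
      unfolding V.wts_eq_coef by blast
    have "rt m = rt (cnt a)" using m(1) a(1) by simp
    then have "set a \<subseteq> J" using m(3) supp by simp
    then show "\<mu> \<in> wt smul H scaleW actW" unfolding W.wts_eq_coef using a by blast
  qed
  show ?thesis
  proof (intro equalityI subsetI)
    fix \<mu> assume "\<mu> \<in> wt smul H scaleV actV"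
    then obtain n where n: "\<mu> = lam - rt n" "n \<in> V.depths" unfolding V.wts_depths by blast
    obtain m \<nu> where m: "m \<in> V.top_depths J" "\<nu> \<in> nonneg_int_span (rt ` grade_one J)" "rt n = rt m + \<nu>"
      using V.wts_subset[OF refl refl ft n(2)] by blast
    have "\<mu> = (lam - rt m) - \<nu>" unfolding n m(3) by (simp only: diff_diff_eq)
    then show "\<mu> \<in> {\<mu> - \<nu> | \<mu> \<nu>. \<mu> \<in> wt smul H scaleW actW \<and> \<nu> \<in> nonneg_int_span (rt ` grade_one J)}"
      unfolding top using m by blast
  next
    fix \<mu> assume "\<mu> \<in> {\<mu> - \<nu> | \<mu> \<nu>. \<mu> \<in> wt smul H scaleW actW \<and> \<nu> \<in> nonneg_int_span (rt ` grade_one J)}"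
    then obtain m \<nu> where m: "\<mu> = (lam - rt m) - \<nu>" "m \<in> V.top_depths J"
      "\<nu> \<in> nonneg_int_span (rt ` grade_one J)" unfolding top by blast
    obtain k where k: "\<nu> = rt k" using cone_coordinates[OF m(3)] by blast
    have "m + k \<in> V.depths" using V.depths_superset[OF refl refl ft J m(2)] m(3) k by blast
    moreover have "\<mu> = lam - rt (m + k)" unfolding m(1) k rt_add by (simp only: diff_diff_eq)
    ultimately show "\<mu> \<in> wt smul H scaleV actV" by (simp only: V.depths_def mem_Collect_eq)
  qed
qed

end

theorem theorem3p2:
  fixes smul :: "complex \<Rightarrow> 'g::ab_group_add \<Rightarrow> 'g"
    and bracket :: "'g \<Rightarrow> 'g \<Rightarrow> 'g"
    and A :: "int^'i^'i"
    and H :: "'g set"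
    and e f coroot :: "'i \<Rightarrow> 'g"
    and sroot :: "'i \<Rightarrow> 'g \<Rightarrow> complex"
    and lam :: "'g \<Rightarrow> complex"
    and J :: "'i set"
  assumes "kac_moody_algebra smul bracket A H e f coroot sroot"
    and "(finite_dimensional smul \<and> simple_lie_algebra smul bracket) \<or> affine_cartan_matrix A"
    and "lam \<in> dual_space smul H"
    and "J = integrable_nodes coroot lam"
  shows
    "nonneg_int_span (height_one_roots smul bracket H sroot (- J)) =
       nonneg_int_span (positive_roots smul bracket H sroot -
                        sub_positive_roots smul bracket H sroot J) \<and>
     (\<forall>S. S \<subset> height_one_roots smul bracket H sroot (- J) \<longrightarrow>
        nonneg_int_span S \<noteq>
        nonneg_int_span (positive_roots smul bracket H sroot -
                         sub_positive_roots smul bracket H sroot J)) \<and>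
     finite (height_one_roots smul bracket H sroot (- J)) \<and>
     (\<forall>(scaleV :: complex \<Rightarrow> 'v::ab_group_add \<Rightarrow> 'v) (actV :: 'g \<Rightarrow> 'v \<Rightarrow> 'v)
       (scaleW :: complex \<Rightarrow> 'w::ab_group_add \<Rightarrow> 'w) (actW :: 'g \<Rightarrow> 'w \<Rightarrow> 'w).
        is_L smul bracket H e lam scaleV actV \<longrightarrow>
        is_L_sub smul bracket H e f coroot J lam scaleW actW \<longrightarrow>
        wt smul H scaleV actV =
          {\<mu> - \<nu> | \<mu> \<nu>. \<mu> \<in> wt smul H scaleW actW \<and>
                     \<nu> \<in> nonneg_int_span (height_one_roots smul bracket H sroot (- J))})"
proof -
  interpret kac_moody_algebra smul bracket A H e f coroot sroot by (rule assms(1))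
  \<comment> \<open>In the finite-dimensional case the whole matrix is of finite type and every
    \<open>J\<close> inherits this; in affine type only proper subsets are of finite type.\<close>
  have ft: "J = UNIV \<or> finite_type_on A J"
    using assms(2)
  proof
    assume "finite_dimensional smul \<and> simple_lie_algebra smul bracket"
    then have "finite_type_on A UNIV" using finite_dimensional_finite_type by blast
    then show ?thesis using finite_type_on_subset[OF cartan_matrix] by blast
  qed (use affine_finite_type in blast)
  show ?thesis
    unfolding height_one_roots_eq cone_generated[symmetric]
    using cone_minimal finite_grade_one[OF ft] wt_L_eq[OF ft assms(3,4)] by blast
qed

end
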